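(* Let $T>0$ and let $\mu$ be a centred probability measure on $\mathbb{R}$ without atoms. Let $F:\mathbb{R}\times\mathbb{R}\to\mathbb{R}$, $(w,s)\mapsto F(w,s)$, be a continuous strictly supermodular serrated function whose ridge is $R_F=\{(w,+\infty): w\in\mathbb{R}\}$ (that is, for every $w_0\in\mathbb{R}$ the function $s\mapsto F(w_0,s)$ is increasing on $\mathbb{R}$). Then the functional $\mathbb{E}[F(M_T,S_T)]$, where $S_T=\max_{0\le t\le T}M_t$, considered on the set of all $\mu$-admissible processes $M$, is maximized by the Azéma-Yor embedding of $\mu$.
   Context: A probability measure $\mu$ on $\mathbb{R}$ is centred if $\int_{\mathbb{R}_{\ge 0}}x\,\mu(dx)<+\infty$ and $\int_{\mathbb{R}}x\,\mu(dx)=0$. A process $(M_t)_{0\le t\le T}$ is $\mu$-admissible if it is a uniformly integrable martingale with $M_0=0$ and $M_T\sim\mu$. Different admissible processes may live on different probability spaces; jumps are allowed. $F$ is supermodular if $w_1<w_2$ and $s_1<s_2$ imply $F(w_1,s_1)+F(w_2,s_2)\ge F(w_1,s_2)+F(w_2,s_1)$; it is strictly supermodular if the latter inequality is always strict. $F$ is serrated if for every $w_0\in\mathbb{R}$ there is $a_{w_0}\in\mathbb{R}\cup\{-\infty,+\infty\}$ such that $s\mapsto F(w_0,s)$ is increasing on $(-\infty,a_{w_0})$ and decreasing on $(a_{w_0},+\infty)$ (the value $-\infty$ or $+\infty$ means that $F(w_0,\cdot)$ is decreasing, respectively increasing, on all of $\mathbb{R}$). The ridge of $F$ is $R_F=\{(w_0,a_{w_0}):w_0\in\mathbb{R}\}$.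 The barycenter function of $\mu$ is $\beta_\mu(k)=\mathbb{E}_\mu[x\mid x\ge k]$, defined for $k$ with $\mu([k,+\infty))>0$ (a set of full $\mu$-measure). The Azéma-Yor embedding is given by the stopping time $\tau=\inf\{t\ge 0:\ \max_{0\le u\le t}W_u\ge\beta_\mu(W_t)\}$ of a standard Brownian motion $W$ started at $0$. It is regarded as a $\mu$-admissible process on $[0,T]$ by a deterministic time change, e.g. $M_t=W_{\tau\wedge (t/(T-t))}$ for $t<T$ and $M_T=W_\tau$. The joint law of $(M_T,S_T)$ for it is the image of $\mu$ under $w\mapsto(w,\beta_\mu(w))$. Convention: "the functional is maximized by a process" means that no $\mu$-admissible process achieves a higher value of the functional; if the value of the functional at the maximizing process is $-\infty$, then all $\mu$-admissible processes are optimal. *)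

theory Defs
  imports "HOL-Probability.Probability"
begin

definition centred :: "real measure \<Rightarrow> bool" where
  \<comment> \<open>Integrability is demanded explicitly because the Bochner integral of a non-integrable
      function is 0. It is implied by a finite positive part together with a zero mean.\<close>
  "centred \<mu> \<longleftrightarrow> integrable \<mu> (\<lambda>x. x) \<and> (\<integral>x. x \<partial>\<mu>) = 0"

definition atomless :: "real measure \<Rightarrow> bool" where
  "atomless \<mu> \<longleftrightarrow> (\<forall>x. measure \<mu> {x} = 0)"

definition uniformly_integrable_on :: "'a measure \<Rightarrow> 'i set \<Rightarrow> ('i \<Rightarrow> 'a \<Rightarrow> real) \<Rightarrow> bool" where
  "uniformly_integrable_on P I X \<longleftrightarrow>
     (\<forall>i\<in>I. integrable P (X i)) \<and>
     (\<forall>\<epsilon>>0. \<exists>K. \<forall>i\<in>I. (\<integral>\<omega>. \<bar>X i \<omega>\<bar> * indicator {\<omega>. K \<le> \<bar>X i \<omega>\<bar>} \<omega> \<partial>P) \<le> \<epsilon>)"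

definition filtration_on :: "real \<Rightarrow> 'a measure \<Rightarrow> (real \<Rightarrow> 'a measure) \<Rightarrow> bool" where
  "filtration_on T P \<F> \<longleftrightarrow>
     (\<forall>t\<in>{0..T}. subalgebra P (\<F> t)) \<and>
     (\<forall>s\<in>{0..T}. \<forall>t\<in>{0..T}. s \<le> t \<longrightarrow> sets (\<F> s) \<subseteq> sets (\<F> t))"

definition martingale_on ::
    "real \<Rightarrow> 'a measure \<Rightarrow> (real \<Rightarrow> 'a measure) \<Rightarrow> (real \<Rightarrow> 'a \<Rightarrow> real) \<Rightarrow> bool" where
  "martingale_on T P \<F> M \<longleftrightarrow>
     (\<forall>t\<in>{0..T}. M t \<in> borel_measurable (\<F> t) \<and> integrable P (M t)) \<and>
     (\<forall>s\<in>{0..T}. \<forall>t\<in>{0..T}. s \<le> t \<longrightarrow> (AE \<omega> in P. real_cond_exp P (\<F> s) (M t) \<omega> = M s \<omega>))"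

definition cadlag_on :: "real \<Rightarrow> (real \<Rightarrow> real) \<Rightarrow> bool" where
  "cadlag_on T f \<longleftrightarrow>
     (\<forall>t\<in>{0..<T}. (f \<longlongrightarrow> f t) (at_right t)) \<and>
     (\<forall>t\<in>{0<..T}. \<exists>l. (f \<longlongrightarrow> l) (at_left t))"

definition admissible :: "real \<Rightarrow> real measure \<Rightarrow> 'a measure \<Rightarrow> (real \<Rightarrow> 'a \<Rightarrow> real) \<Rightarrow> bool" where
  \<comment> \<open>The filtration is not part of the data. Almost surely cadlag paths are the usual regularity
      convention for martingales in continuous time: jumps are allowed, and the running supremum
      is finite and determined up to null sets.\<close>
  "admissible T \<mu> P M \<longleftrightarrow>
     prob_space P \<and>
     (\<exists>\<F>. filtration_on T P \<F> \<and> martingale_on T P \<F> M) \<and>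
     uniformly_integrable_on P {0..T} M \<and>
     (AE \<omega> in P. cadlag_on T (\<lambda>t. M t \<omega>)) \<and>
     (AE \<omega> in P. M 0 \<omega> = 0) \<and>
     distr P borel (M T) = \<mu>"

definition running_max :: "(real \<Rightarrow> 'a \<Rightarrow> real) \<Rightarrow> real \<Rightarrow> 'a \<Rightarrow> real" where
  "running_max M t \<omega> = (SUP u\<in>{0..t}. M u \<omega>)"

definition strictly_supermodular :: "(real \<Rightarrow> real \<Rightarrow> real) \<Rightarrow> bool" where
  "strictly_supermodular F \<longleftrightarrow>
     (\<forall>w1 w2 s1 s2. w1 < w2 \<and> s1 < s2 \<longrightarrow> F w1 s1 + F w2 s2 > F w1 s2 + F w2 s1)"

definition serrated_at :: "(real \<Rightarrow> real \<Rightarrow> real) \<Rightarrow> real \<Rightarrow> ereal \<Rightarrow> bool" where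
  "serrated_at F w a \<longleftrightarrow>
     mono_on {s. ereal s < a} (F w) \<and> antimono_on {s. a < ereal s} (F w)"

definition serrated :: "(real \<Rightarrow> real \<Rightarrow> real) \<Rightarrow> bool" where
  "serrated F \<longleftrightarrow> (\<forall>w. \<exists>a. serrated_at F w a)"

definition has_ridge :: "(real \<Rightarrow> real \<Rightarrow> real) \<Rightarrow> (real \<times> ereal) set \<Rightarrow> bool" where
  \<comment> \<open>A relation, since monotonicity is not strict and the turning points need not be unique.\<close>
  "has_ridge F R \<longleftrightarrow> (\<exists>a. (\<forall>w. serrated_at F w (a w)) \<and> R = {(w, a w) | w. True})"

definition barycenter :: "real measure \<Rightarrow> real \<Rightarrow> real" where
  \<comment> \<open>Beyond the right end of the support, where the conditional mean is undefined, we use the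
      customary value \<open>k\<close>.\<close>
  "barycenter \<mu> k =
     (if measure \<mu> {k..} > 0 then (LINT x:{k..}|\<mu>. x) / measure \<mu> {k..} else k)"

definition brownian_motion :: "'a measure \<Rightarrow> (real \<Rightarrow> 'a \<Rightarrow> real) \<Rightarrow> bool" where
  "brownian_motion P W \<longleftrightarrow>
     prob_space P \<and>
     (\<forall>t\<ge>0. W t \<in> borel_measurable P) \<and>
     (\<forall>\<omega>\<in>space P. W 0 \<omega> = 0 \<and> continuous_on {0..} (\<lambda>t. W t \<omega>)) \<and>
     (\<forall>s t. 0 \<le> s \<and> s < t \<longrightarrow>
        distributed P lborel (\<lambda>\<omega>. W t \<omega> - W s \<omega>) (normal_density 0 (sqrt (t - s)))) \<and>
     (\<forall>(n::nat) t. 0 \<le> t 0 \<and> (\<forall>i<n. t i < t (Suc i)) \<longrightarrow>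
        prob_space.indep_vars P (\<lambda>_. borel) (\<lambda>i \<omega>. W (t (Suc i)) \<omega> - W (t i) \<omega>) {..<n})"

definition azema_yor_time :: "real measure \<Rightarrow> (real \<Rightarrow> 'a \<Rightarrow> real) \<Rightarrow> 'a \<Rightarrow> ereal" where
  "azema_yor_time \<mu> W \<omega> =
     Inf {ereal t | t. 0 \<le> t \<and> running_max W t \<omega> \<ge> barycenter \<mu> (W t \<omega>)}"

definition azema_yor_process ::
    "real \<Rightarrow> real measure \<Rightarrow> (real \<Rightarrow> 'a \<Rightarrow> real) \<Rightarrow> real \<Rightarrow> 'a \<Rightarrow> real" where
  \<comment> \<open>On \<open>azema_yor_time \<mu> W \<omega> = \<infinity>\<close> the value at time \<open>T\<close> is the junk value \<open>W 0 \<omega>\<close>.\<close>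
  "azema_yor_process T \<mu> W t \<omega> =
     (if t < T then W (real_of_ereal (min (azema_yor_time \<mu> W \<omega>) (ereal (t / (T - t))))) \<omega>
      else W (real_of_ereal (azema_yor_time \<mu> W \<omega>)) \<omega>)"

definition has_ext_expectation :: "'a measure \<Rightarrow> ('a \<Rightarrow> real) \<Rightarrow> ereal \<Rightarrow> bool" where
  \<comment> \<open>The expectation as an extended real; no value is assigned to \<open>\<infinity> - \<infinity>\<close>
      (on type \<open>ereal\<close> this difference would be \<open>\<infinity>\<close>).\<close>
  "has_ext_expectation P Y v \<longleftrightarrow>
     ((\<integral>\<^sup>+\<omega>. ennreal (Y \<omega>) \<partial>P) \<noteq> \<infinity> \<or> (\<integral>\<^sup>+\<omega>. ennreal (- Y \<omega>) \<partial>P) \<noteq> \<infinity>) \<and>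
     v = enn2ereal (\<integral>\<^sup>+\<omega>. ennreal (Y \<omega>) \<partial>P) - enn2ereal (\<integral>\<^sup>+\<omega>. ennreal (- Y \<omega>) \<partial>P)"

definition functional_value ::
    "real \<Rightarrow> (real \<Rightarrow> real \<Rightarrow> real) \<Rightarrow> 'a measure \<Rightarrow> (real \<Rightarrow> 'a \<Rightarrow> real) \<Rightarrow> ereal \<Rightarrow> bool" where
  "functional_value T F P M v \<longleftrightarrow>
     has_ext_expectation P (\<lambda>\<omega>. F (M T \<omega>) (running_max M T \<omega>)) v"

end

theory Submission
  imports Defs
begin

text \<open>
  Let \<open>\<beta>\<close> be the barycenter function and \<open>\<tau>\<close> the stopping time. By continuity of the paths, \<open>S\<^sub>\<tau> = \<beta>(W\<^sub>\<tau>)\<close>, and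
  \<open>{S\<^sub>\<tau> \<ge> \<beta>(k)} = {W\<^sub>\<tau> \<ge> k}\<close>. Optional stopping at the time when \<open>S\<close> reaches \<open>\<beta>(k)\<close> therefore gives
  \<open>E[W\<^sub>\<tau>; W\<^sub>\<tau> < k] + \<beta>(k) P(W\<^sub>\<tau> \<ge> k) = 0\<close>, a relation which \<open>\<mu>\<close> satisfies as well and which determines the law.
  Hence \<open>W\<^sub>\<tau>\<close> has law \<open>\<mu>\<close>, and since \<open>\<beta>(k) \<mu>[k, \<infinity>) \<rightarrow> 0\<close> the stopped process is closed by \<open>W\<^sub>\<tau>\<close>.

  For optimality, \<open>F(w, s) \<le> \<phi>(w) + \<psi>(s)\<close> with equality for \<open>s = \<beta>(w)\<close>, where \<open>\<psi>\<close> is an increasing potential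
  of the graph of \<open>\<beta>\<close>, which is cyclically monotone because \<open>F\<close> is supermodular. By Doob's inequality the
  maximum of any admissible process is stochastically dominated by \<open>\<beta>\<close> under \<open>\<mu>\<close>. Neither \<open>\<phi>\<close> nor \<open>\<psi>\<close>
  need be integrable, but truncating both at level \<open>n\<close> gives expectations that still converge to
  that of the sum.\<close>

section \<open>Barycenters determine centred laws\<close>

text \<open>At the outset neither finiteness of \<tau> nor integrability of the stopped value is
  known, and the path is bounded on neither side before \<tau>. Optional stopping is therefore
  proved for sets that confine the path to a bounded interval, and the two sides are then released
  in turn. From below, a barrier at \<open>- a\<close> does little harm: a path that reaches it
  before being stopped has a maximum of at most \<beta>(-a), which tends to 0 because the mean is 0.
  From above, the cut at the level \<beta>(k) gives the relation that fixes the law; only when the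
  law is known to be \<mu> does the error of the cut become an explicit tail mean. A priori the law
  of the stopped value may have atoms and a positive part of infinite mean, so uniqueness is proved
  in a wider class than that of the centred laws without atoms. For \<mu> itself, the absence of
  atoms makes \<beta> continuous and hence the stopping region closed. That F increases in s keeps
  the potential \<psi> finite and makes it increasing, which is the property that stochastic
  dominance of the maximum can exploit.\<close>

locale centred_law = prob_space \<mu> for \<mu> :: "real measure" +
  assumes sets_eq: "sets \<mu> = sets borel" and centred: "centred \<mu>" and atomless: "atomless \<mu>"
begin

lemma space_eq [simp]: "space \<mu> = UNIV"
  using sets_eq_imp_space_eq[OF sets_eq] by simp

lemma measurable_eq [measurable_cong]: "sets \<mu> = sets borel"
  by (fact sets_eq)

lemma integrable_id [intro, simp]: "integrable \<mu> (\<lambda>x. x)" and mean_0: "(\<integral>x. x \<partial>\<mu>) = 0"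
  using centred by (auto simp: centred_def)

definition tail :: "real \<Rightarrow> real" where "tail k = measure \<mu> {k..}"
definition tail_mean :: "real \<Rightarrow> real" where "tail_mean k = (\<integral>x. x * indicator {k..} x \<partial>\<mu>)"
definition call :: "real \<Rightarrow> real" where "call k = (\<integral>x. max (x - k) 0 \<partial>\<mu>)"

lemma integrable_mult_ind [intro, simp]: "A \<in> sets borel \<Longrightarrow> integrable \<mu> (\<lambda>x. x * indicator A x)"
  by (rule integrable_real_mult_indicator) (auto simp: sets_eq)

lemma integrable_call [intro, simp]: "integrable \<mu> (\<lambda>x. max (x - k) 0)"
  by (intro integrable_max) auto

lemma integrable_ind [intro, simp]: "A \<in> sets borel \<Longrightarrow> integrable \<mu> (indicator A :: real \<Rightarrow> real)"
  by (simp add: sets_eq emeasure_eq_measure)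

lemma tail_nonneg: "0 \<le> tail k"
  by (simp add: tail_def)

lemma tail_antimono: "k \<le> l \<Longrightarrow> tail l \<le> tail k"
  unfolding tail_def by (intro finite_measure_mono) (auto simp: sets_eq)

lemma call_nonneg: "0 \<le> call k"
  unfolding call_def by (rule integral_nonneg_AE) auto

lemma call_eq: "call k = tail_mean k - k * tail k"
proof -
  have "call k = (\<integral>x. x * indicator {k..} x - k * indicator {k..} x \<partial>\<mu>)"
    unfolding call_def by (intro Bochner_Integration.integral_cong) (auto simp: indicator_def)
  also have "\<dots> = tail_mean k - k * tail k"
    unfolding tail_mean_def by (subst Bochner_Integration.integral_diff) (auto simp: tail_def)
  finally show ?thesis .
qed

text \<open>Free of division, and valid also where the conditional mean is undefined, since both
  sides then vanish. Later algebra with \<beta> starts from this form.\<close>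

lemma barycenter_mult: "barycenter \<mu> k * tail k = tail_mean k"
proof (cases "tail k > 0")
  case True
  have "(LINT x:{k..}|\<mu>. x) = tail_mean k"
    unfolding tail_mean_def set_lebesgue_integral_def by (simp add: mult.commute)
  then show ?thesis using True unfolding tail_def[symmetric] barycenter_def by (simp add: tail_def)
next
  case False
  then have t0: "tail k = 0" using tail_nonneg[of k] by simp
  then have "{k..} \<in> null_sets \<mu>"
    by (auto simp: tail_def sets_eq emeasure_eq_measure null_sets_def)
  then have "AE x in \<mu>. x \<notin> {k..}" by (rule AE_not_in)
  then have "tail_mean k = (\<integral>x. 0 \<partial>\<mu>)"
    unfolding tail_mean_def by (intro integral_cong_AE) (auto elim: eventually_mono)
  then show ?thesis using t0 by simp
qed

text \<open>The link to Doob's inequality: at a point \<open>k\<close> with \<beta>(k) = c > k, the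
  bound \<open>call k / (c - k)\<close> is exactly the tail mass.\<close>

lemma barycenter_call: "(barycenter \<mu> k - k) * tail k = call k"
  using barycenter_mult[of k] call_eq[of k] by (simp add: algebra_simps)

lemma barycenter_tail_0: "tail k = 0 \<Longrightarrow> barycenter \<mu> k = k"
  by (simp add: barycenter_def tail_def)

lemma barycenter_ge: "k \<le> barycenter \<mu> k"
proof (cases "tail k = 0")
  case False
  then have "0 < tail k" using tail_nonneg[of k] by simp
  then show ?thesis using barycenter_call[of k] call_nonneg[of k]
    by (metis diff_ge_0_iff_ge linorder_not_le mult_neg_pos)
qed (simp add: barycenter_tail_0)

lemma tail_mean_diff:
  assumes "k \<le> l"
  shows "tail_mean k - tail_mean l = (\<integral>x. x * indicator {k..<l} x \<partial>\<mu>)"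
proof -
  have "tail_mean k - tail_mean l = (\<integral>x. x * indicator {k..} x - x * indicator {l..} x \<partial>\<mu>)"
    unfolding tail_mean_def by (subst Bochner_Integration.integral_diff) auto
  also have "\<dots> = (\<integral>x. x * indicator {k..<l} x \<partial>\<mu>)"
    using assms by (intro Bochner_Integration.integral_cong) (auto simp: indicator_def)
  finally show ?thesis .
qed

lemma tail_diff:
  assumes "k \<le> l"
  shows "tail k - tail l = measure \<mu> {k..<l}"
proof -
  have "{k..<l} = {k..} - {l..}" by auto
  then show ?thesis unfolding tail_def using assms by (simp add: finite_measure_Diff sets_eq)
qed

lemma tail_mean_diff_bounds:
  assumes "k \<le> l"
  shows "tail_mean k - tail_mean l \<le> l * (tail k - tail l)"
    and "k * (tail k - tail l) \<le> tail_mean k - tail_mean l"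
proof -
  have "(\<integral>x. x * indicator {k..<l} x \<partial>\<mu>) \<le> (\<integral>x. l * indicator {k..<l} x \<partial>\<mu>)"
    by (intro integral_mono) (auto split: split_indicator)
  then show "tail_mean k - tail_mean l \<le> l * (tail k - tail l)"
    unfolding tail_mean_diff[OF assms] tail_diff[OF assms] by simp
  have "(\<integral>x. k * indicator {k..<l} x \<partial>\<mu>) \<le> (\<integral>x. x * indicator {k..<l} x \<partial>\<mu>)"
    by (intro integral_mono) (auto split: split_indicator)
  then show "k * (tail k - tail l) \<le> tail_mean k - tail_mean l"
    unfolding tail_mean_diff[OF assms] tail_diff[OF assms] by simp
qed

text \<open>The law above \<open>k\<close> splits into its part on \<open>[k, l)\<close>, which lies
  below \<open>l \<le> \<beta>(l)\<close>, and its part above \<open>l\<close>, whose mean is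
  \<beta>(l). So \<beta>(k) averages quantities that are at most \<beta>(l).\<close>

lemma mono_barycenter: "mono (barycenter \<mu>)"
proof (rule monoI)
  fix k l :: real assume kl: "k \<le> l"
  show "barycenter \<mu> k \<le> barycenter \<mu> l"
  proof (cases "tail k = 0")
    case True
    then show ?thesis using kl barycenter_ge[of l] by (simp add: barycenter_tail_0)
  next
    case False
    then have pos: "0 < tail k" using tail_nonneg[of k] by simp
    have "barycenter \<mu> k * tail k \<le> barycenter \<mu> l * tail l + l * (tail k - tail l)"
      using tail_mean_diff_bounds(1)[OF kl] by (simp add: barycenter_mult)
    also have "\<dots> \<le> barycenter \<mu> l * tail l + barycenter \<mu> l * (tail k - tail l)"
      using tail_antimono[OF kl] barycenter_ge[of l] by (intro add_left_mono mult_right_mono) auto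
    also have "\<dots> = barycenter \<mu> l * tail k" by (simp add: algebra_simps)
    finally show ?thesis using pos by simp
  qed
qed

lemma tail_mean_split: "(\<integral>x. x * indicator {..<k} x \<partial>\<mu>) = - tail_mean k"
proof -
  have "(\<integral>x. x * indicator {..<k} x \<partial>\<mu>) + tail_mean k = (\<integral>x. x * indicator {..<k} x + x * indicator {k..} x \<partial>\<mu>)"
    unfolding tail_mean_def by (subst Bochner_Integration.integral_add) auto
  also have "\<dots> = (\<integral>x. x \<partial>\<mu>)" by (intro Bochner_Integration.integral_cong) (auto simp: indicator_def)
  finally show ?thesis using mean_0 by simp
qed

text \<open>Convergence of the integrands can fail only at the point \<open>k\<close>, a null set
  because there are no atoms. The continuity of \<beta> rests on this.\<close>

lemma isCont_tail_integral:
  fixes g :: "real \<Rightarrow> real"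
  assumes g: "integrable \<mu> g"
  shows "isCont (\<lambda>k. \<integral>x. g x * indicator {k..} x \<partial>\<mu>) k"
  unfolding continuous_at_sequentially comp_def
proof safe
  fix X :: "nat \<Rightarrow> real" assume X: "X \<longlonglongrightarrow> k"
  have [measurable]: "g \<in> borel_measurable \<mu>" using g by simp
  have "{k} \<in> null_sets \<mu>"
    using atomless by (auto simp: null_sets_def sets_eq emeasure_eq_measure atomless_def)
  then have AEk: "AE x in \<mu>. x \<notin> {k}" by (rule AE_not_in)
  show "(\<lambda>n. \<integral>x. g x * indicator {X n..} x \<partial>\<mu>) \<longlonglongrightarrow> (\<integral>x. g x * indicator {k..} x \<partial>\<mu>)"
  proof (rule integral_dominated_convergence[where w = "\<lambda>x. \<bar>g x\<bar>"])
    show "AE x in \<mu>. (\<lambda>n. g x * indicator {X n..} x) \<longlonglongrightarrow> g x * indicator {k..} x"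
      using AEk
    proof eventually_elim
      case (elim x)
      have "eventually (\<lambda>n. indicator {X n..} x = (indicator {k..} x :: real)) sequentially"
      proof (cases "x < k")
        case True
        from order_tendstoD(1)[OF X this] show ?thesis
          by eventually_elim (use True in \<open>auto simp: indicator_def\<close>)
      next
        case False
        then have "k < x" using elim by simp
        from order_tendstoD(2)[OF X this] show ?thesis
          by eventually_elim (use \<open>k < x\<close> in \<open>auto simp: indicator_def\<close>)
      qed
      then show ?case by (intro tendsto_intros tendsto_eventually)
    qed
  qed (use g in \<open>auto simp: indicator_def\<close>)
qed

lemma isCont_tail: "isCont tail k"
  using isCont_tail_integral[of "\<lambda>_. 1" k] by (simp add: tail_def[abs_def])

lemma isCont_tail_mean: "isCont tail_mean k"
  using isCont_tail_integral[of "\<lambda>x. x" k] by (simp add: tail_mean_def[abs_def])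

lemma isCont_barycenter: "isCont (barycenter \<mu>) k"
proof (cases "tail k = 0")
  case True
  \<comment> \<open>At and beyond the right end of the support the quotient breaks down. To the
    right of \<open>k\<close> the function \<beta> is the identity; to the left,
    \<open>l \<le> \<beta>(l) \<le> \<beta>(k) = k\<close>.\<close>
  have "\<bar>barycenter \<mu> l - barycenter \<mu> k\<bar> \<le> \<bar>l - k\<bar>" for l
  proof (cases "l \<le> k")
    case True
    with \<open>tail k = 0\<close> show ?thesis
      using barycenter_ge[of l] monoD[OF mono_barycenter True] barycenter_tail_0[of k] by auto
  next
    case False
    then have "tail l = 0" using tail_antimono[of k l] tail_nonneg[of l] True by auto
    then show ?thesis using True barycenter_tail_0 by auto
  qed
  then show ?thesis
    unfolding isCont_def LIM_def dist_real_def by (meson le_less_trans)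
next
  case False
  then have pos: "0 < tail k" using tail_nonneg[of k] by simp
  have "((\<lambda>l. tail_mean l / tail l) \<longlongrightarrow> tail_mean k / tail k) (at k)"
    using False isCont_tail isCont_tail_mean by (intro tendsto_divide) (auto simp: isCont_def)
  moreover have "tail_mean k / tail k = barycenter \<mu> k"
    using barycenter_mult[of k] pos by (simp add: field_simps)
  moreover have "eventually (\<lambda>l. 0 < tail l) (at k)"
    using isCont_tail[of k] pos by (auto simp: isCont_def intro: order_tendstoD)
  then have "eventually (\<lambda>l. tail_mean l / tail l = barycenter \<mu> l) (at k)"
    by eventually_elim (use barycenter_mult in \<open>simp add: field_simps\<close>)
  ultimately show ?thesis unfolding isCont_def using Lim_transform_eventually by fastforce
qed

text \<open>The mean 0 enters in the second limit, which makes \<beta> tend to 0 at the lower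
  end.\<close>

lemma tail_limits: "(tail \<longlongrightarrow> 1) at_bot" "(tail_mean \<longlongrightarrow> 0) at_bot" "(tail_mean \<longlongrightarrow> 0) at_top"
proof -
  have bot: "((\<lambda>k. \<integral>x. g x * indicator {k..} x \<partial>\<mu>) \<longlongrightarrow> (\<integral>x. g x \<partial>\<mu>)) at_bot"
    if g: "integrable \<mu> g" for g :: "real \<Rightarrow> real"
  proof (rule tendsto_at_botI_sequentially)
    fix X :: "nat \<Rightarrow> real" assume X: "filterlim X at_bot sequentially"
    have [measurable]: "g \<in> borel_measurable \<mu>" using g by simp
    show "(\<lambda>n. \<integral>x. g x * indicator {X n..} x \<partial>\<mu>) \<longlonglongrightarrow> (\<integral>x. g x \<partial>\<mu>)"
    proof (rule integral_dominated_convergence[where w = "\<lambda>x. \<bar>g x\<bar>"])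
      show "AE x in \<mu>. (\<lambda>n. g x * indicator {X n..} x) \<longlonglongrightarrow> g x"
      proof (rule AE_I2)
        fix x
        have "eventually (\<lambda>n. X n \<le> x) sequentially" using X by (simp add: filterlim_at_bot)
        then have "eventually (\<lambda>n. g x * indicator {X n..} x = g x) sequentially"
          by eventually_elim auto
        then show "(\<lambda>n. g x * indicator {X n..} x) \<longlonglongrightarrow> g x" by (rule tendsto_eventually)
      qed
    qed (use g in \<open>auto simp: indicator_def\<close>)
  qed
  show "(tail \<longlongrightarrow> 1) at_bot"
    using bot[of "\<lambda>_. 1"] prob_space by (simp add: tail_def[abs_def])
  show "(tail_mean \<longlongrightarrow> 0) at_bot"
    using bot[of "\<lambda>x. x"] mean_0 by (simp add: tail_mean_def[abs_def])
  show "(tail_mean \<longlongrightarrow> 0) at_top"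
  proof (rule tendsto_at_topI_sequentially)
    fix X :: "nat \<Rightarrow> real" assume X: "filterlim X at_top sequentially"
    have "(\<lambda>n. \<integral>x. x * indicator {X n..} x \<partial>\<mu>) \<longlonglongrightarrow> (\<integral>x. 0 \<partial>\<mu>)"
    proof (rule integral_dominated_convergence[where w = "\<lambda>x. \<bar>x\<bar>"])
      show "AE x in \<mu>. (\<lambda>n. x * indicator {X n..} x) \<longlonglongrightarrow> 0"
      proof (rule AE_I2)
        fix x
        have "eventually (\<lambda>n. x < X n) sequentially" using X by (simp add: filterlim_at_top_dense)
        then have "eventually (\<lambda>n. x * indicator {X n..} x = 0) sequentially"
          by eventually_elim auto
        then show "(\<lambda>n. x * indicator {X n..} x) \<longlonglongrightarrow> 0" by (rule tendsto_eventually)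
      qed
    qed (auto simp: indicator_def)
    then show "(\<lambda>n. tail_mean (X n)) \<longlonglongrightarrow> 0" by (simp add: tail_mean_def)
  qed
qed

lemma barycenter_at_bot: "(barycenter \<mu> \<longlongrightarrow> 0) at_bot"
proof -
  have "((\<lambda>k. tail_mean k / tail k) \<longlongrightarrow> 0 / 1) at_bot"
    by (intro tendsto_divide tail_limits) auto
  moreover have "eventually (\<lambda>k. 0 < tail k) at_bot"
    using tail_limits(1) by (auto intro: order_tendstoD)
  then have "eventually (\<lambda>k. tail_mean k / tail k = barycenter \<mu> k) at_bot"
    by eventually_elim (use barycenter_mult in \<open>simp add: field_simps\<close>)
  ultimately show ?thesis by (simp add: Lim_transform_eventually)
qed

lemma barycenter_nonneg: "0 \<le> barycenter \<mu> k"
proof -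
  have "eventually (\<lambda>l. barycenter \<mu> l \<le> barycenter \<mu> k) at_bot"
    using eventually_le_at_bot[of k] by eventually_elim (rule monoD[OF mono_barycenter])
  then show ?thesis by (rule tendsto_upperbound[OF barycenter_at_bot]) simp
qed

text \<open>If \<beta>(0) vanished, the positive part and then, by the mean 0, the whole law would
  sit at 0, which would be an atom. Strict positivity keeps the starting point \<open>(0, 0)\<close>
  outside the stopping region.\<close>

lemma barycenter_0_pos: "0 < barycenter \<mu> 0"
proof (rule ccontr)
  assume "\<not> ?thesis"
  then have "barycenter \<mu> 0 = 0" using barycenter_nonneg[of 0] by simp
  then have "call 0 = 0" using barycenter_call[of 0] by simp
  then have "(\<integral>x. max x 0 \<partial>\<mu>) = 0" "(\<integral>x. max x 0 - x \<partial>\<mu>) = 0"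
    using integrable_call[of 0] mean_0 by (simp_all add: call_def)
  moreover have "(\<integral>x. max x 0 \<partial>\<mu>) = 0 \<longleftrightarrow> (AE x in \<mu>. max x 0 = 0)"
    using integrable_call[of 0] by (intro integral_nonneg_eq_0_iff_AE) auto
  moreover have "(\<integral>x. max x 0 - x \<partial>\<mu>) = 0 \<longleftrightarrow> (AE x in \<mu>. max x 0 - x = 0)"
    using integrable_call[of 0] by (intro integral_nonneg_eq_0_iff_AE) auto
  ultimately have "AE x in \<mu>. max x 0 = 0" "AE x in \<mu>. max x 0 - x = 0" by blast+
  then have "AE x in \<mu>. x \<in> {0}" by eventually_elim auto
  then have "measure \<mu> {0} = 1" by (subst prob_eq_1) (auto simp: sets_eq)
  then show False using atomless by (simp add: atomless_def)
qed

end

text \<open>The barycenter identity with the mean of the upper part eliminated, so that only the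
  negative part has to be integrable. This is what optional stopping provides for the stopped value
  before its law is known.\<close>

locale barycenter_relation = nu: prob_space \<nu> for \<nu> :: "real measure" and b :: "real \<Rightarrow> real" +
  assumes sets_eq: "sets \<nu> = sets borel"
    and int_neg: "integrable \<nu> (\<lambda>x. x * indicator {..<0} x)"
    and rel: "(\<integral>x. x * indicator {..<k} x \<partial>\<nu>) = - b k * measure \<nu> {k..}"
    and cont_b: "isCont b k"
begin

lemma space_eq [simp]: "space \<nu> = UNIV"
  using sets_eq_imp_space_eq[OF sets_eq] by simp

lemma measurable_eq [measurable_cong]: "sets \<nu> = sets borel"
  by (fact sets_eq)

definition N :: "real \<Rightarrow> real" where "N k = measure \<nu> {k..}"
definition put :: "real \<Rightarrow> real" where "put k = (\<integral>x. max (k - x) 0 \<partial>\<nu>)"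
text \<open>By put-call parity this is the call function if the law is centred. The put is used
  because the positive part need not be integrable here.\<close>

definition potential :: "real \<Rightarrow> real" where "potential k = put k - k"

lemma integrable_put [intro, simp]: "integrable \<nu> (\<lambda>x. max (k - x) 0)"
proof (rule Bochner_Integration.integrable_bound)
  show "integrable \<nu> (\<lambda>x. \<bar>k\<bar> + \<bar>x * indicator {..<0} x\<bar>)" using int_neg by auto
qed (auto simp: indicator_def sets_eq)

lemma integrable_ind [intro, simp]: "A \<in> sets borel \<Longrightarrow> integrable \<nu> (indicator A :: real \<Rightarrow> real)"
  by (simp add: sets_eq nu.emeasure_eq_measure)

lemma integrable_below [intro, simp]: "integrable \<nu> (\<lambda>x. x * indicator {..<k} x)"
proof (rule Bochner_Integration.integrable_bound)
  show "integrable \<nu> (\<lambda>x. \<bar>k\<bar> + \<bar>x * indicator {..<0} x\<bar>)" using int_neg by auto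
qed (auto simp: indicator_def sets_eq)

lemma below: "measure \<nu> {..<k} = 1 - N k"
proof -
  have "UNIV - {k..} = {..<k}" by auto
  then show ?thesis using nu.prob_compl[of "{k..}"] by (simp add: N_def sets_eq)
qed

lemma potential_eq: "potential k = (b k - k) * N k"
proof -
  have "put k = (\<integral>x. k * indicator {..<k} x - x * indicator {..<k} x \<partial>\<nu>)"
    unfolding put_def by (intro Bochner_Integration.integral_cong) (auto simp: indicator_def)
  also have "\<dots> = k * (1 - N k) + b k * N k"
    by (subst Bochner_Integration.integral_diff) (auto simp: rel below N_def)
  finally show ?thesis by (simp add: potential_def algebra_simps)
qed

lemma N_nonneg: "0 \<le> N k" and N_le_1: "N k \<le> 1" by (auto simp: N_def)

text \<open>Convexity: when the strike moves from \<open>k\<close> to \<open>l\<close>, the payoff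
  of the put grows by at least \<open>l - k\<close> on \<open>{..<k}\<close> and by at most
  \<open>l - k\<close> on \<open>{..<l}\<close>.\<close>

lemma potential_diff:
  assumes "k \<le> l"
  shows "(l - k) * N l \<le> potential k - potential l" "potential k - potential l \<le> (l - k) * N k"
proof -
  have eq: "put l - put k = (\<integral>x. max (l - x) 0 - max (k - x) 0 \<partial>\<nu>)"
    unfolding put_def by simp
  have "(\<integral>x. (l - k) * indicator {..<k} x \<partial>\<nu>) \<le> (\<integral>x. max (l - x) 0 - max (k - x) 0 \<partial>\<nu>)"
    using assms by (intro integral_mono) (auto split: split_indicator)
  then show "potential k - potential l \<le> (l - k) * N k"
    unfolding eq[symmetric] by (simp add: below potential_def algebra_simps)
  have "(\<integral>x. max (l - x) 0 - max (k - x) 0 \<partial>\<nu>) \<le> (\<integral>x. (l - k) * indicator {..<l} x \<partial>\<nu>)"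
    using assms by (intro integral_mono) (auto split: split_indicator)
  then show "(l - k) * N l \<le> potential k - potential l"
    unfolding eq[symmetric] by (simp add: below potential_def algebra_simps)
qed

lemma isCont_potential: "isCont potential k"
proof -
  have le: "\<bar>potential l - potential k\<bar> \<le> \<bar>l - k\<bar>" if "l \<le> k" for l k
  proof -
    have "(k - l) * N l \<le> (k - l) * 1"
      using that by (intro mult_left_mono N_le_1) auto
    moreover have "0 \<le> (k - l) * N k" using that N_nonneg by simp
    ultimately show ?thesis using potential_diff[OF that] that by auto
  qed
  have "\<bar>potential l - potential k\<bar> \<le> \<bar>l - k\<bar>" for l
    using le[of l k] le[of k l] by (cases "l \<le> k") (auto simp: abs_minus_commute)
  then show ?thesis
    unfolding isCont_def LIM_def dist_real_def by (meson le_less_trans)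
qed

text \<open>The law \<nu> may have atoms a priori, so the continuity of \<open>N\<close> at
  \<open>k\<close> has to come from the relation itself: near \<open>k\<close>, \<open>N\<close> is
  the continuous quotient of \<open>potential\<close> by \<open>b - id\<close>.\<close>

lemma potential_deriv:
  assumes k: "k < b k"
  shows "(potential has_real_derivative - N k) (at k)"
proof -
  have ev: "eventually (\<lambda>l. l < b l) (at k)"
  proof -
    have "((\<lambda>l. b l - l) \<longlongrightarrow> b k - k) (at k)" using cont_b by (intro tendsto_intros) (auto simp: isCont_def)
    then have "eventually (\<lambda>l. 0 < b l - l) (at k)" using k by (intro order_tendstoD) auto
    then show ?thesis by eventually_elim simp
  qed
  have "((\<lambda>l. potential l / (b l - l)) \<longlongrightarrow> potential k / (b k - k)) (at k)"
    using cont_b isCont_potential k by (intro tendsto_intros) (auto simp: isCont_def)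
  moreover have "potential k / (b k - k) = N k" using k by (simp add: potential_eq)
  moreover have "eventually (\<lambda>l. potential l / (b l - l) = N l) (at k)"
    using ev by eventually_elim (simp add: potential_eq)
  ultimately have N: "(N \<longlongrightarrow> N k) (at k)" using Lim_transform_eventually by fastforce
  have bound: "\<bar>(potential l - potential k) / (l - k) + N k\<bar> \<le> \<bar>N l - N k\<bar>" if "l \<noteq> k" for l
  proof (cases "k < l")
    case True
    have "- N k \<le> (potential l - potential k) / (l - k)"
      using potential_diff(2)[of k l] True by (simp add: pos_le_divide_eq algebra_simps)
    moreover have "(potential l - potential k) / (l - k) \<le> - N l"
      using potential_diff(1)[of k l] True by (simp add: pos_divide_le_eq algebra_simps)
    ultimately show ?thesis by linarith
  next
    case False
    have "- N l \<le> (potential l - potential k) / (l - k)"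
      using potential_diff(2)[of l k] False that by (simp add: neg_le_divide_eq algebra_simps)
    moreover have "(potential l - potential k) / (l - k) \<le> - N k"
      using potential_diff(1)[of l k] False that by (simp add: neg_divide_le_eq algebra_simps)
    ultimately show ?thesis by linarith
  qed
  have "((\<lambda>l. (potential l - potential k) / (l - k) + N k) \<longlongrightarrow> 0) (at k)"
  proof (rule tendsto_0_le[where K = 1])
    show "((\<lambda>l. N l - N k) \<longlongrightarrow> 0) (at k)" using N by (simp add: LIM_zero)
    show "eventually (\<lambda>l. norm ((potential l - potential k) / (l - k) + N k) \<le> norm (N l - N k) * 1) (at k)"
      using bound by (auto simp: eventually_at_filter)
  qed
  then have "((\<lambda>l. (potential l - potential k) / (l - k)) \<longlongrightarrow> - N k) (at k)"
    using tendsto_add[OF _ tendsto_const[of "- N k"]] by force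
  then show ?thesis by (simp add: has_field_derivative_iff)
qed

lemma put_at_bot: "(put \<longlongrightarrow> 0) at_bot"
proof (rule tendsto_at_botI_sequentially)
  fix X :: "nat \<Rightarrow> real" assume X: "filterlim X at_bot sequentially"
  \<comment> \<open>The put at strike 0 dominates only puts at strikes below 0, hence the shift by
    \<open>M\<close>.\<close>
  have "eventually (\<lambda>n. X n \<le> 0) sequentially" using X by (simp add: filterlim_at_bot)
  then obtain M where M: "\<And>n. n \<ge> M \<Longrightarrow> X n \<le> 0" by (auto simp: eventually_sequentially)
  have "(\<lambda>n. \<integral>x. max (X (n + M) - x) 0 \<partial>\<nu>) \<longlonglongrightarrow> (\<integral>x. 0 \<partial>\<nu>)"
  proof (rule integral_dominated_convergence[where w = "\<lambda>x. max (0 - x) 0"])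
    show "AE x in \<nu>. (\<lambda>n. max (X (n + M) - x) 0) \<longlonglongrightarrow> 0"
    proof (rule AE_I2)
      fix x
      have "eventually (\<lambda>n. X n \<le> x) sequentially" using X by (simp add: filterlim_at_bot)
      then have "eventually (\<lambda>n. X (n + M) \<le> x) sequentially"
        by (subst eventually_sequentially_seg)
      then have "eventually (\<lambda>n. max (X (n + M) - x) 0 = 0) sequentially"
        by eventually_elim auto
      then show "(\<lambda>n. max (X (n + M) - x) 0) \<longlonglongrightarrow> 0" by (rule tendsto_eventually)
    qed
    show "AE x in \<nu>. norm (max (X (n + M) - x) 0) \<le> max (0 - x) 0" for n
      using M[of "n + M"] by (intro AE_I2) auto
  qed (use integrable_put[of 0] in auto)
  then have "(\<lambda>n. put (X (n + M))) \<longlonglongrightarrow> 0" by (simp add: put_def)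
  then show "(\<lambda>n. put (X n)) \<longlonglongrightarrow> 0" by (rule LIMSEQ_offset)
qed

lemma potential_ratio_at_bot: "((\<lambda>k. potential k / (- k)) \<longlongrightarrow> 1) at_bot"
proof -
  have "((\<lambda>k. put k * inverse (- k) + 1) \<longlongrightarrow> 0 * 0 + 1) at_bot"
    by (intro tendsto_intros put_at_bot tendsto_inverse_0_at_top filterlim_uminus_at_top_at_bot)
  moreover have "eventually (\<lambda>k::real. k < 0) at_bot" by (rule eventually_gt_at_bot)
  then have "eventually (\<lambda>k. put k * inverse (- k) + 1 = potential k / (- k)) at_bot"
    by eventually_elim (simp add: potential_def field_simps)
  ultimately show ?thesis by (simp add: Lim_transform_eventually)
qed

lemma N_antimono: "k \<le> l \<Longrightarrow> N l \<le> N k"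
  unfolding N_def by (intro nu.finite_measure_mono) (auto simp: sets_eq)

end

section \<open>Uniqueness of the law with a given barycenter function\<close>

context centred_law
begin

lemma barycenter_relation_self: "barycenter_relation \<mu> (barycenter \<mu>)"
proof unfold_locales
  show "(\<integral>x. x * indicator {..<k} x \<partial>\<mu>) = - barycenter \<mu> k * measure \<mu> {k..}" for k
    using tail_mean_split[of k] barycenter_mult[of k] by (simp add: tail_def)
qed (auto simp: sets_eq isCont_barycenter)

text \<open>The potential functions of both laws solve \<open>\<phi>' = - \<phi> / (\<beta> - id)\<close> wherever \<open>\<beta> > id\<close>, so their
  ratio is constant; both are asymptotic to \<open>- k\<close> at \<open>-\<infinity>\<close>.\<close>

lemma barycenter_unique:
  assumes "barycenter_relation \<nu> (barycenter \<mu>)"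
  shows "\<nu> = \<mu>"
proof -
  let ?b = "barycenter \<mu>"
  interpret n: barycenter_relation \<nu> ?b by fact
  interpret m: barycenter_relation \<mu> ?b by (rule barycenter_relation_self)
  have mN: "m.N = tail" by (simp add: m.N_def[abs_def] tail_def[abs_def])
  define A where "A = {k. k < ?b k}"
  have pot: "0 < m.potential k" if "k \<in> A" for k
  proof -
    have "tail k \<noteq> 0" using barycenter_tail_0[of k] that by (auto simp: A_def)
    then have "0 < tail k" using tail_nonneg[of k] by simp
    then show ?thesis using that by (simp add: m.potential_eq mN A_def)
  qed
  \<comment> \<open>The potential decreases, so its zeros persist to the right. Thus the set where
    the differential equation holds is a single interval that reaches down to minus
    infinity.\<close>
  have down: "l \<in> A" if "k \<in> A" "l \<le> k" for k l
  proof (rule ccontr)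
    assume "l \<notin> A"
    then have "?b l = l" using barycenter_ge[of l] by (simp add: A_def)
    then have "m.potential l = 0" by (simp add: m.potential_eq)
    moreover have "0 \<le> (k - l) * m.N k" using m.N_nonneg[of k] that by simp
    ultimately show False using pot[OF that(1)] m.potential_diff(1)[OF that(2)] by simp
  qed
  have "is_interval A" unfolding is_interval_1 using down by blast
  then have "convex A" by (simp add: is_interval_convex_1)
  have D: "((\<lambda>k. n.potential k / m.potential k) has_real_derivative 0) (at k within A)" if k: "k \<in> A" for k
  proof -
    have k': "k < ?b k" using k by (simp add: A_def)
    have "((\<lambda>k. n.potential k / m.potential k) has_real_derivative
        (- n.N k * m.potential k - n.potential k * (- m.N k)) / (m.potential k * m.potential k)) (at k)"
      by (intro DERIV_divide n.potential_deriv m.potential_deriv k') (use pot[OF k] in simp)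
    moreover have "- n.N k * m.potential k - n.potential k * (- m.N k) = 0"
      by (simp add: n.potential_eq m.potential_eq)
    ultimately show ?thesis by (simp add: has_field_derivative_at_within)
  qed
  obtain c where c: "\<And>k. k \<in> A \<Longrightarrow> n.potential k / m.potential k = c"
    using has_field_derivative_zero_constant[OF \<open>convex A\<close> D] by blast
  have A_ne: "eventually (\<lambda>k. k \<in> A) at_bot"
  proof -
    have "eventually (\<lambda>k::real. k < 0) at_bot" by (rule eventually_gt_at_bot)
    then show ?thesis by eventually_elim (use barycenter_nonneg in \<open>auto simp: A_def intro: less_le_trans\<close>)
  qed
  have "((\<lambda>k. (n.potential k / (- k)) / (m.potential k / (- k))) \<longlongrightarrow> 1 / 1) at_bot"
    by (intro tendsto_divide n.potential_ratio_at_bot m.potential_ratio_at_bot) simp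
  moreover have "eventually (\<lambda>k. (n.potential k / (- k)) / (m.potential k / (- k)) = c) at_bot"
    using A_ne eventually_gt_at_bot[of 0] by eventually_elim (use c in auto)
  ultimately have "((\<lambda>k::real. c) \<longlongrightarrow> 1 / 1) at_bot" by (rule Lim_transform_eventually)
  then have "c = 1" by (simp add: tendsto_const_iff)
  have N_A: "n.N k = tail k" if "k \<in> A" for k
  proof -
    have "n.potential k = m.potential k" using c[OF that] \<open>c = 1\<close> pot[OF that] by simp
    then show ?thesis using that by (simp add: n.potential_eq m.potential_eq A_def mN)
  qed
  have N_eq: "n.N k = tail k" for k
  proof (cases "k \<in> A")
    case False
    then have bk: "?b k = k" using barycenter_ge[of k] by (simp add: A_def)
    \<comment> \<open>From \<open>k\<close> on both potentials vanish, and their decrease over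
      \<open>[k, l]\<close> is at least \<open>l - k\<close> times the tail at
      \<open>l\<close>.\<close>
    have z: "n.N l \<le> 0 \<and> tail l \<le> 0" if "k < l" "k \<notin> A" for l k
    proof -
      have "?b j = j" if "k \<le> j" for j
      proof -
        have "j \<notin> A" using that down[of j k] \<open>k \<notin> A\<close> by blast
        then show ?thesis using barycenter_ge[of j] by (simp add: A_def)
      qed
      then have "n.potential j = 0 \<and> m.potential j = 0" if "k \<le> j" for j
        using that by (simp add: n.potential_eq m.potential_eq)
      then have "(l - k) * n.N l \<le> 0" "(l - k) * m.N l \<le> 0"
        using n.potential_diff(1)[of k l] m.potential_diff(1)[of k l] that by auto
      then show ?thesis using that by (simp add: mult_le_0_iff mN)
    qed
    have "(tail \<longlongrightarrow> tail k) (at_right k)"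
      using isCont_tail by (simp add: isCont_def filterlim_at_split)
    moreover have "eventually (\<lambda>l. tail l \<le> 0) (at_right k)"
      using z False by (auto simp: eventually_at_filter)
    ultimately have "tail k \<le> 0" by (rule tendsto_upperbound) simp
    then have t0: "tail k = 0" using tail_nonneg[of k] by simp
    \<comment> \<open>An atom of \<nu> at \<open>k\<close> itself is still to be excluded. If
      \<open>k\<close> is the right end of \<open>A\<close>, the tails of \<nu> and \<mu> agree to
      the left of \<open>k\<close>, and that of \<mu> is continuous with value 0 at
      \<open>k\<close>.\<close>
    have "n.N k \<le> 0"
    proof (cases "\<exists>l<k. l \<notin> A")
      case True
      then show ?thesis using z by blast
    next
      case False
      have "(tail \<longlongrightarrow> tail k) (at_left k)"
        using isCont_tail by (simp add: isCont_def filterlim_at_split)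
      moreover have "n.N k \<le> tail l" if "l < k" for l
        using False that N_A[of l] n.N_antimono[of l k] by auto
      then have "eventually (\<lambda>l. n.N k \<le> tail l) (at_left k)"
        by (auto simp: eventually_at_filter)
      ultimately show ?thesis using t0 tendsto_lowerbound by fastforce
    qed
    then show ?thesis using t0 n.N_nonneg[of k] by simp
  qed (rule N_A)
  show ?thesis
  proof (rule measure_eqI_generator_eq[where E = "range atLeast" and \<Omega> = UNIV and A = "\<lambda>i. {- real i..}"])
    have "{a..} \<inter> {b..} = {max a b..}" for a b :: real by auto
    then show "Int_stable (range (atLeast :: real \<Rightarrow> _))" by (auto simp: Int_stable_def)
    show "sets \<nu> = sigma_sets UNIV (range atLeast)" "sets \<mu> = sigma_sets UNIV (range atLeast)"
      by (simp_all add: n.sets_eq sets_eq borel_Ici)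
    show "emeasure \<nu> X = emeasure \<mu> X" if "X \<in> range atLeast" for X
      using that N_eq by (auto simp: n.nu.emeasure_eq_measure emeasure_eq_measure n.N_def tail_def)
    show "(\<Union>i. {- real i..}) = UNIV"
      by auto (metis minus_le_iff real_arch_simple)
    show "emeasure \<nu> {- real i..} \<noteq> \<infinity>" for i by (simp add: n.nu.emeasure_eq_measure)
  qed auto
qed

end

section \<open>Running maxima and hitting times of paths\<close>

definition path_max :: "(real \<Rightarrow> real) \<Rightarrow> real \<Rightarrow> real" where
  "path_max f t = (SUP u\<in>{0..t}. f u)"

lemma path_max_attained:
  assumes "continuous_on {0..} f" "0 \<le> t"
  shows "\<exists>u\<in>{0..t}. path_max f t = f u \<and> (\<forall>v\<in>{0..t}. f v \<le> f u)"
proof -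
  have "continuous_on {0..t} f" using assms continuous_on_subset by fastforce
  then obtain u where u: "u \<in> {0..t}" "\<forall>v\<in>{0..t}. f v \<le> f u"
    using continuous_attains_sup[of "{0..t}" f] assms by auto
  have "path_max f t = f u"
    unfolding path_max_def by (rule cSup_eq_maximum) (use u in auto)
  then show ?thesis using u by blast
qed

lemma path_max_ge:
  assumes "continuous_on {0..} f" "0 \<le> u" "u \<le> t"
  shows "f u \<le> path_max f t"
  using path_max_attained[OF assms(1), of t] assms by fastforce

lemma path_max_le:
  assumes "continuous_on {0..} f" "0 \<le> t" "\<And>u. 0 \<le> u \<Longrightarrow> u \<le> t \<Longrightarrow> f u \<le> c"
  shows "path_max f t \<le> c"
  using path_max_attained[OF assms(1,2)] assms(3) by fastforce

lemma path_max_mono: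
  assumes "continuous_on {0..} f" "0 \<le> u" "u \<le> t"
  shows "path_max f u \<le> path_max f t"
  using assms by (intro path_max_le path_max_ge) auto

text \<open>A time at which the maximum over \<open>[0, t]\<close> is attained cannot lie in
  \<open>[u, t]\<close>.\<close>

lemma path_max_eq_of_less:
  assumes "continuous_on {0..} f" "0 \<le> u" "u \<le> t"
    and "\<And>v. u \<le> v \<Longrightarrow> v \<le> t \<Longrightarrow> f v < path_max f t"
  shows "path_max f u = path_max f t"
proof -
  obtain w where w: "w \<in> {0..t}" "path_max f t = f w"
    using path_max_attained[OF assms(1), of t] assms by auto
  have "w < u" using assms(4)[of w] w by force
  then have "path_max f t \<le> path_max f u"
    using path_max_ge[OF assms(1), of w u] w by auto
  then show ?thesis using path_max_mono[OF assms(1-3)] by simp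
qed

lemma continuous_on_path_max:
  assumes f: "continuous_on {0..} f"
  shows "continuous_on {0..} (path_max f)"
  unfolding continuous_on_iff
proof safe
  fix t e :: real assume t: "0 \<le> t" and e: "0 < e"
  obtain d where d: "d > 0" "\<And>v. v \<ge> 0 \<Longrightarrow> \<bar>v - t\<bar> < d \<Longrightarrow> \<bar>f v - f t\<bar> < e / 3"
    using f[unfolded continuous_on_iff, rule_format, of t "e/3"] t e
    by (auto simp: dist_real_def)
  have close: "path_max f v2 \<le> path_max f v1 + 2 * e / 3"
    if v: "0 \<le> v1" "v1 \<le> v2" "\<bar>v1 - t\<bar> < d" "\<bar>v2 - t\<bar> < d" for v1 v2
  proof (rule path_max_le[OF f])
    fix u assume u: "0 \<le> u" "u \<le> v2"
    show "f u \<le> path_max f v1 + 2 * e / 3"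
    proof (cases "u \<le> v1")
      case True
      then show ?thesis using path_max_ge[OF f, of u v1] u e by auto
    next
      case False
      then have "\<bar>f u - f t\<bar> < e / 3" "\<bar>f v1 - f t\<bar> < e / 3" using d(2) u v by auto
      moreover have "f v1 \<le> path_max f v1" using path_max_ge[OF f] v by auto
      ultimately show ?thesis by argo
    qed
  qed (use v in auto)
  show "\<exists>d>0. \<forall>x'\<in>{0..}. dist x' t < d \<longrightarrow> dist (path_max f x') (path_max f t) < e"
  proof (intro exI conjI ballI impI)
    show "d > 0" by fact
    fix v :: real assume v: "v \<in> {0..}" "dist v t < d"
    then have v': "\<bar>v - t\<bar> < d" "0 \<le> v" by (auto simp: dist_real_def)
    show "dist (path_max f v) (path_max f t) < e"
    proof (cases "v \<le> t")
      case True
      then show ?thesis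
        using close[of v t] path_max_mono[OF f, of v t] v' t e d(1) by (auto simp: dist_real_def)
    next
      case False
      then show ?thesis
        using close[of t v] path_max_mono[OF f, of t v] v' t e d(1) by (auto simp: dist_real_def)
    qed
  qed
qed

section \<open>Hitting times of closed sets by the pair of path and running maximum\<close>

locale based_path =
  fixes f :: "real \<Rightarrow> real"
  assumes cont: "continuous_on {0..} f" and f_0 [simp]: "f 0 = 0"
begin

definition pos :: "real \<Rightarrow> real \<times> real" where "pos t = (f t, path_max f t)"

lemma path_max_0 [simp]: "path_max f 0 = 0"
  by (simp add: path_max_def)

lemma pos_0 [simp]: "pos 0 = (0, 0)"
  by (simp add: pos_def)

lemma path_max_nonneg: "0 \<le> t \<Longrightarrow> 0 \<le> path_max f t"
  using path_max_ge[OF cont, of 0 t] by simp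

lemma continuous_on_pos: "continuous_on {0..} pos"
  unfolding pos_def by (intro continuous_intros cont continuous_on_path_max)

definition hit_by :: "(real \<times> real) set \<Rightarrow> real \<Rightarrow> bool" where
  "hit_by C t \<longleftrightarrow> (\<exists>v\<in>{0..t}. pos v \<in> C)"

definition hits :: "(real \<times> real) set \<Rightarrow> bool" where
  "hits C \<longleftrightarrow> (\<exists>v\<ge>0. pos v \<in> C)"

text \<open>On a path that never reaches \<open>C\<close> this is the unspecified
  \<open>Inf {}\<close>, so its use is always guarded by \<open>hits\<close> or
  \<open>hit_by\<close>.\<close>

definition hit_time :: "(real \<times> real) set \<Rightarrow> real" where
  "hit_time C = Inf {v. 0 \<le> v \<and> pos v \<in> C}"

text \<open>The minimum of \<open>t\<close> and the hitting time, with the right value also on paths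
  that never reach \<open>C\<close>.\<close>

definition stop_time :: "(real \<times> real) set \<Rightarrow> real \<Rightarrow> real" where
  "stop_time C t = (if hit_by C t then hit_time C else t)"

lemma hit_by_mono: "hit_by C s \<Longrightarrow> s \<le> t \<Longrightarrow> hit_by C t"
  unfolding hit_by_def by fastforce

lemma hits_iff: "hits C \<longleftrightarrow> (\<exists>t. hit_by C t)"
  unfolding hits_def hit_by_def by fastforce

lemma hit_time_props:
  assumes C: "closed C" and h: "hits C"
  shows "0 \<le> hit_time C" "pos (hit_time C) \<in> C"
    "\<And>u. 0 \<le> u \<Longrightarrow> u < hit_time C \<Longrightarrow> pos u \<notin> C"
proof -
  let ?S = "{v. 0 \<le> v \<and> pos v \<in> C}"
  have ne: "?S \<noteq> {}" using h by (auto simp: hits_def)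
  have bd: "bdd_below ?S" by (rule bdd_belowI[of _ 0]) auto
  have "?S = {0..} \<inter> pos -` C" by auto
  then have "closed ?S"
    using continuous_on_closed_vimage[OF closed_atLeast[of "0::real"], of pos] continuous_on_pos C by (metis Int_commute)
  from closed_contains_Inf[OF ne bd this]
  show "0 \<le> hit_time C" "pos (hit_time C) \<in> C" by (auto simp: hit_time_def)
  fix u assume u: "0 \<le> u" "u < hit_time C"
  show "pos u \<notin> C"
  proof
    assume "pos u \<in> C"
    then have "hit_time C \<le> u" unfolding hit_time_def using u by (intro cInf_lower bd) auto
    with u show False by simp
  qed
qed

lemma hit_time_eqI:
  assumes "0 \<le> t" "pos t \<in> C" "\<And>u. 0 \<le> u \<Longrightarrow> u < t \<Longrightarrow> pos u \<notin> C"
  shows "hit_time C = t"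
  unfolding hit_time_def
  by (rule cInf_eq_minimum) (use assms in \<open>auto simp: not_less[symmetric]\<close>)

lemma hit_by_iff:
  assumes "closed C" "hits C" "0 \<le> t"
  shows "hit_by C t \<longleftrightarrow> hit_time C \<le> t"
  using hit_time_props[OF assms(1,2)] unfolding hit_by_def
  by (metis atLeastAtMost_iff not_le order_trans)

lemma stop_time_nonneg: "closed C \<Longrightarrow> 0 \<le> t \<Longrightarrow> 0 \<le> stop_time C t"
  using hit_time_props(1) by (auto simp: stop_time_def hits_iff)

lemma not_hit_before_stop_time:
  assumes "closed C" "0 \<le> t" "0 \<le> u" "u < stop_time C t"
  shows "pos u \<notin> C"
proof (cases "hit_by C t")
  case True
  then have "hits C" using hits_iff by blast
  then show ?thesis using hit_time_props(3)[OF assms(1), of u] True assms by (auto simp: stop_time_def)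
next
  case False
  then show ?thesis using assms by (auto simp: stop_time_def hit_by_def)
qed

lemma not_hit_by_iff:
  assumes "closed C" "hit_by C t" "0 \<le> u"
  shows "\<not> hit_by C u \<longleftrightarrow> u < stop_time C t"
proof -
  have "hits C" using assms(2) hits_iff by blast
  then show ?thesis using hit_by_iff[OF assms(1) _ assms(3)] assms(2) by (auto simp: stop_time_def)
qed

lemma eventually_close_below:
  fixes g :: "real \<Rightarrow> real"
  assumes "continuous_on {0..} g" "0 < t" "P (g t)" "open {x. P x}"
  shows "\<exists>u. 0 \<le> u \<and> u < t \<and> (\<forall>v. u \<le> v \<and> v \<le> t \<longrightarrow> P (g v))"
proof -
  have "continuous (at t within {0..}) g" using assms by (auto simp: continuous_on_eq_continuous_within)
  then have "(g \<longlongrightarrow> g t) (at t within {0..})" by (simp add: continuous_within)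
  then have "eventually (\<lambda>v. g v \<in> {x. P x}) (at t within {0..})"
    using assms(3,4) by (auto simp: tendsto_def)
  then obtain d where d: "d > 0" "\<And>v. v \<ge> 0 \<Longrightarrow> v \<noteq> t \<Longrightarrow> \<bar>v - t\<bar> < d \<Longrightarrow> P (g v)"
    by (auto simp: eventually_at dist_real_def)
  show ?thesis
  proof (intro exI[of _ "max 0 (t - d/2)"] conjI allI impI)
    fix v assume v: "max 0 (t - d/2) \<le> v \<and> v \<le> t"
    show "P (g v)"
    proof (cases "v = t")
      case False
      show ?thesis by (rule d(2)) (use False v d(1) in auto)
    qed (use assms in auto)
  qed (use d assms in auto)
qed

text \<open>A path strictly below its maximum at \<open>t\<close> attained that maximum earlier and
  is still below it shortly before \<open>t\<close>. This produces an earlier hitting time in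
  arguments by contradiction.\<close>

lemma path_max_const_before:
  assumes "0 < t" "f t < path_max f t" "f t < c"
  shows "\<exists>u. 0 \<le> u \<and> u < t \<and> path_max f u = path_max f t \<and> f u < c"
proof -
  have "open {x. x < path_max f t \<and> x < c}"
    by (intro open_Collect_conj open_Collect_less continuous_intros)
  from eventually_close_below[OF cont assms(1), of "\<lambda>x. x < path_max f t \<and> x < c", OF _ this] assms
  obtain u where u: "0 \<le> u" "u < t" "\<And>v. u \<le> v \<Longrightarrow> v \<le> t \<Longrightarrow> f v < path_max f t \<and> f v < c" by auto
  have "path_max f u = path_max f t"
    by (rule path_max_eq_of_less[OF cont]) (use u in auto)
  with u show ?thesis by (metis order_refl less_imp_le)
qed

end

section \<open>The stopping region and its cuts, path by path\<close>

definition ay_region :: "(real \<Rightarrow> real) \<Rightarrow> (real \<times> real) set" where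
  "ay_region b = {(x, y). b x \<le> y}"

text \<open>Hitting this set means stopping at \<tau> or when the maximum first reaches
  \<open>b k\<close>, whichever is earlier. Until then the path stays below
  \<open>b k\<close>.\<close>

definition ay_cut :: "(real \<Rightarrow> real) \<Rightarrow> real \<Rightarrow> (real \<times> real) set" where
  "ay_cut b k = {(x, y). b x \<le> y \<or> b k \<le> y}"

lemma closed_ay_sets:
  assumes "continuous_on UNIV b"
  shows closed_ay_region: "closed (ay_region b)" and closed_ay_cut: "closed (ay_cut b k)"
proof -
  have "continuous_on UNIV (\<lambda>p :: real \<times> real. b (fst p))"
    by (rule continuous_on_compose2[OF assms]) (auto intro!: continuous_intros)
  then have "closed {p :: real \<times> real. b (fst p) \<le> snd p}" "closed {p :: real \<times> real. b k \<le> snd p}"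
    by (auto intro!: closed_Collect_le continuous_intros)
  then show "closed (ay_region b)" "closed (ay_cut b k)"
    unfolding ay_region_def ay_cut_def case_prod_unfold by (auto intro: closed_Collect_disj)
qed

locale azema_yor_path = based_path +
  fixes b :: "real \<Rightarrow> real"
  assumes cont_b: "continuous_on UNIV b" and mono_b: "mono b" and b_ge: "k \<le> b k" and b_0: "0 < b 0"
begin

lemma ay_hit:
  assumes h: "hits (ay_region b)"
  defines "\<tau> \<equiv> hit_time (ay_region b)"
  shows "0 < \<tau>" "path_max f \<tau> = b (f \<tau>)" "f \<tau> < k \<longleftrightarrow> path_max f \<tau> < b k"
proof -
  note hp = hit_time_props[OF closed_ay_region[OF cont_b] h, folded \<tau>_def]
  have "\<tau> \<noteq> 0"
  proof
    assume "\<tau> = 0"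
    then show False using hp(2) b_0 by (auto simp: ay_region_def)
  qed
  then show pos: "0 < \<tau>" using hp(1) by simp
  have le: "b (f \<tau>) \<le> path_max f \<tau>" using hp(2) by (auto simp: ay_region_def pos_def)
  have "\<not> b (f \<tau>) < path_max f \<tau>"
  proof
    assume lt: "b (f \<tau>) < path_max f \<tau>"
    have "continuous_on {0..} (\<lambda>v. b (f v))" by (rule continuous_on_compose2[OF cont_b cont]) auto
    then have "continuous_on {0..} (\<lambda>v. path_max f v - b (f v))"
      by (intro continuous_intros continuous_on_path_max cont)
    from eventually_close_below[OF this pos, of "\<lambda>x. 0 < x"] lt
    obtain u where "0 \<le> u" "u < \<tau>" "0 < path_max f u - b (f u)"
      by (auto simp: greaterThan_def[symmetric])
    then show False using hp(3)[of u] by (auto simp: ay_region_def pos_def)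
  qed
  then show eq: "path_max f \<tau> = b (f \<tau>)" using le by simp
  show "f \<tau> < k \<longleftrightarrow> path_max f \<tau> < b k"
  proof
    assume "path_max f \<tau> < b k"
    then show "f \<tau> < k" using eq mono_b by (metis monoD not_less)
  next
    assume k: "f \<tau> < k"
    show "path_max f \<tau> < b k"
    proof (rule ccontr)
      assume "\<not> path_max f \<tau> < b k"
      moreover have "b (f \<tau>) \<le> b k" using k by (intro monoD[OF mono_b]) auto
      ultimately have e: "path_max f \<tau> = b k" using eq by simp
      \<comment> \<open>Here \<open>b\<close> is constant on the interval from
        \<open>f \<tau>\<close> to \<open>k\<close>. The path is below its maximum, so shortly
        before \<tau> the maximum was already \<open>b k\<close> with the path below
        \<open>k\<close>: the region would have been entered earlier.\<close>
      then have "f \<tau> < path_max f \<tau>" using k b_ge[of k] by simp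
      from path_max_const_before[OF pos this k] obtain u
        where u: "0 \<le> u" "u < \<tau>" "path_max f u = b k" "f u < k" using e by auto
      have "b (f u) \<le> path_max f u" using u by (auto intro: monoD[OF mono_b])
      then show False using hp(3)[of u] u by (auto simp: ay_region_def pos_def)
    qed
  qed
qed

text \<open>If the maximum is below \<open>b k\<close> when the cut is hit, the region itself has
  been hit, and \<open>ay_hit\<close> places the path below \<open>k\<close>. Otherwise the maximum
  has just reached \<open>b k\<close>, which it can do only when the path is at its maximum;
  stopping in the region below \<open>k\<close> would then have come earlier.\<close>

lemma ay_cut_hit:
  assumes k: "0 < b k" and h: "hits (ay_cut b k)"
  shows "f (hit_time (ay_cut b k)) =
    (if hits (ay_region b) \<and> f (hit_time (ay_region b)) < k then f (hit_time (ay_region b)) else b k)"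
proof -
  let ?\<rho> = "hit_time (ay_cut b k)" and ?\<tau> = "hit_time (ay_region b)"
  note hp = hit_time_props[OF closed_ay_cut[OF cont_b] h]
  have "?\<rho> \<noteq> 0"
  proof
    assume "?\<rho> = 0"
    then show False using hp(2) b_0 k by (auto simp: ay_cut_def)
  qed
  then have pos: "0 < ?\<rho>" using hp(1) by simp
  show ?thesis
  proof (cases "path_max f ?\<rho> < b k")
    case True
    then have "pos ?\<rho> \<in> ay_region b" using hp(2) by (auto simp: ay_cut_def ay_region_def pos_def)
    then have hA: "hits (ay_region b)" using hp(1) unfolding hits_def by blast
    have "?\<tau> = ?\<rho>"
    proof (rule hit_time_eqI)
      fix u assume "0 \<le> u" "u < ?\<rho>"
      then show "pos u \<notin> ay_region b" using hp(3)[of u] by (auto simp: ay_region_def ay_cut_def pos_def)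
    qed (use \<open>pos ?\<rho> \<in> ay_region b\<close> hp in auto)
    then show ?thesis using ay_hit(3)[OF hA, of k] hA True by simp
  next
    case False
    have small: "path_max f u < b k" if "0 \<le> u" "u < ?\<rho>" for u
      using hp(3)[OF that] by (auto simp: ay_cut_def pos_def)
    have fr: "f ?\<rho> = path_max f ?\<rho>"
    proof (rule ccontr)
      assume "f ?\<rho> \<noteq> path_max f ?\<rho>"
      then have "f ?\<rho> < path_max f ?\<rho>" using path_max_ge[OF cont, of ?\<rho> ?\<rho>] pos by auto
      from path_max_const_before[OF pos this this] small False show False by fastforce
    qed
    have "path_max f ?\<rho> \<le> b k"
    proof (rule ccontr)
      assume "\<not> ?thesis"
      then show False
        using eventually_close_below[OF continuous_on_path_max[OF cont] pos, of "\<lambda>x. b k < x"] small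
        by (force simp: greaterThan_def[symmetric])
    qed
    then have fb: "f ?\<rho> = b k" using fr False by simp
    have "\<not> (hits (ay_region b) \<and> f ?\<tau> < k)"
    proof
      assume A: "hits (ay_region b) \<and> f ?\<tau> < k"
      then have "path_max f ?\<tau> < b k" using ay_hit(3) by auto
      then have "?\<tau> < ?\<rho>"
        using path_max_mono[OF cont, of ?\<rho> ?\<tau>] pos False by (meson less_le_trans not_less not_le less_imp_le)
      moreover have "pos ?\<tau> \<in> ay_cut b k" "0 \<le> ?\<tau>"
        using hit_time_props[OF closed_ay_region[OF cont_b]] A by (auto simp: ay_region_def ay_cut_def)
      ultimately show False using hp(3) by blast
    qed
    then show ?thesis using fb by auto
  qed
qed

end

section \<open>Optional stopping for Brownian motion\<close>

lemma eventually_nat_ge_real: "eventually (\<lambda>n. t \<le> real n) sequentially"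
  using filterlim_real_sequentially by (simp add: filterlim_at_top)

lemma integrable_indicator_mult:
  fixes f :: "'a \<Rightarrow> real"
  shows "A \<in> sets M \<Longrightarrow> integrable M f \<Longrightarrow> integrable M (\<lambda>\<omega>. indicator A \<omega> * f \<omega>)"
  using integrable_mult_indicator[of A M f] by simp

lemma (in prob_space) AE_of_prob_bound:
  assumes N: "{\<omega> \<in> space M. Q \<omega>} \<in> sets M"
    and le: "\<And>n. prob (space M - {\<omega> \<in> space M. Q \<omega>}) \<le> r n" and r: "r \<longlonglongrightarrow> 0"
  shows "AE \<omega> in M. Q \<omega>"
proof -
  let ?N = "space M - {\<omega> \<in> space M. Q \<omega>}"
  have "prob ?N \<le> 0" using le by (intro tendsto_lowerbound[OF r]) auto
  moreover have "?N \<in> sets M" using N by (rule sets.compl_sets)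
  ultimately have "?N \<in> null_sets M" by (auto simp: null_sets_def emeasure_eq_measure measure_le_0_iff)
  then show ?thesis by (rule AE_I') auto
qed

lemma filterlim_real_Suc: "filterlim (\<lambda>n. real (Suc n)) at_top sequentially"
  by (rule filterlim_compose[OF filterlim_real_sequentially filterlim_Suc])

section \<open>Increments of Brownian motion and the natural filtration\<close>

definition natural_filtration :: "'a measure \<Rightarrow> (real \<Rightarrow> 'a \<Rightarrow> real) \<Rightarrow> real \<Rightarrow> 'a measure" where
  "natural_filtration M X t =
     sigma (space M) {X q -` B \<inter> space M | q B. 0 \<le> q \<and> q \<le> t \<and> B \<in> sets borel}"

lemma space_natural_filtration [simp]: "space (natural_filtration M X t) = space M"
  by (simp add: natural_filtration_def space_measure_of_conv)

lemma sets_natural_filtration: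
  "sets (natural_filtration M X t) =
     sigma_sets (space M) {X q -` B \<inter> space M | q B. 0 \<le> q \<and> q \<le> t \<and> B \<in> sets borel}"
  unfolding natural_filtration_def by (rule sets_measure_of) auto

lemma natural_filtration_mono:
  "s \<le> t \<Longrightarrow> sets (natural_filtration M X s) \<subseteq> sets (natural_filtration M X t)"
  unfolding sets_natural_filtration by (intro sigma_sets_mono') fastforce

lemma natural_filtration_measurable [measurable]:
  assumes "0 \<le> q" "q \<le> t"
  shows "X q \<in> borel_measurable (natural_filtration M X t)"
proof (rule measurableI)
  fix B :: "real set" assume "B \<in> sets borel"
  then show "X q -` B \<inter> space (natural_filtration M X t) \<in> sets (natural_filtration M X t)"
    using assms by (auto simp: sets_natural_filtration intro!: sigma_sets.Basic)
qed simp

lemma subalgebra_natural_filtration: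
  assumes "\<And>q. 0 \<le> q \<Longrightarrow> X q \<in> borel_measurable M"
  shows "subalgebra M (natural_filtration M X t)"
  unfolding subalgebra_def
proof
  show "sets (natural_filtration M X t) \<subseteq> sets M"
    unfolding sets_natural_filtration
    by (rule sets.sigma_sets_subset) (use assms in \<open>auto intro: measurable_sets\<close>)
qed simp

locale brownian = prob_space P for P :: "'a measure" +
  fixes W :: "real \<Rightarrow> 'a \<Rightarrow> real"
  assumes bm: "brownian_motion P W"
begin

lemma measurable_W [measurable (raw)]: "0 \<le> t \<Longrightarrow> W t \<in> borel_measurable P"
  and W_0: "\<omega> \<in> space P \<Longrightarrow> W 0 \<omega> = 0"
  and cont_W: "\<omega> \<in> space P \<Longrightarrow> continuous_on {0..} (\<lambda>t. W t \<omega>)"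
  and increment_distributed: "0 \<le> s \<Longrightarrow> s < t \<Longrightarrow>
        distributed P lborel (\<lambda>\<omega>. W t \<omega> - W s \<omega>) (normal_density 0 (sqrt (t - s)))"
  using bm unfolding brownian_motion_def by blast+

lemma indep_increments:
  fixes n :: nat
  shows "0 \<le> t 0 \<Longrightarrow> (\<And>i. i < n \<Longrightarrow> t i < t (Suc i)) \<Longrightarrow>
    indep_vars (\<lambda>_. borel) (\<lambda>i \<omega>. W (t (Suc i)) \<omega> - W (t i) \<omega>) {..<n}"
  using bm unfolding brownian_motion_def by blast

lemma based_path: "\<omega> \<in> space P \<Longrightarrow> based_path (\<lambda>t. W t \<omega>)"
  by unfold_locales (simp_all add: cont_W W_0)

abbreviation "Fil \<equiv> natural_filtration P W"

lemma subalgebra_Fil: "subalgebra P (Fil t)"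
  by (rule subalgebra_natural_filtration) measurable

lemma Fil_sets: "A \<in> sets (Fil t) \<Longrightarrow> A \<in> sets P"
  using subalgebra_Fil by (auto simp: subalgebra_def)

text \<open>Fourth moments are used because over a grid of \<open>N\<close> steps they add up to a
  multiple of \<open>1 / N\<close>, whereas the variances always add up to the length of the
  interval.\<close>

lemma increment_moments:
  assumes st: "0 \<le> s" "s < t"
  shows integrable_increment: "integrable P (\<lambda>\<omega>. W t \<omega> - W s \<omega>)"
    and mean_increment: "(\<integral>\<omega>. W t \<omega> - W s \<omega> \<partial>P) = 0"
    and integrable_increment4: "integrable P (\<lambda>\<omega>. (W t \<omega> - W s \<omega>) ^ 4)"
    and moment4_increment: "(\<integral>\<omega>. (W t \<omega> - W s \<omega>) ^ 4 \<partial>P) = 3 * (t - s)\<^sup>2"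
proof -
  let ?\<sigma> = "sqrt (t - s)"
  note D = increment_distributed[OF st]
  have \<sigma>: "0 < ?\<sigma>" using st by simp
  have i: "integrable P (\<lambda>\<omega>. (W t \<omega> - W s \<omega>) ^ k)" for k
    using distributed_integrable[OF D, of "\<lambda>x. x ^ k"] integrable_normal_moment[OF \<sigma>, of 0 k]
    by simp
  show "integrable P (\<lambda>\<omega>. W t \<omega> - W s \<omega>)" using i[of 1] by simp
  show "integrable P (\<lambda>\<omega>. (W t \<omega> - W s \<omega>) ^ 4)" by (rule i)
  have e: "(\<integral>\<omega>. (W t \<omega> - W s \<omega>) ^ k \<partial>P) = (\<integral>x. normal_density 0 ?\<sigma> x * x ^ k \<partial>lborel)" for k
    using distributed_integral[OF D, of "\<lambda>x. x ^ k"] by simp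
  show "(\<integral>\<omega>. W t \<omega> - W s \<omega> \<partial>P) = 0"
    using e[of 1] integral_normal_moment_odd[OF \<sigma>, of 0 0] by simp
  show "(\<integral>\<omega>. (W t \<omega> - W s \<omega>) ^ 4 \<partial>P) = 3 * (t - s)\<^sup>2"
    using e[of 4] integral_normal_moment_even[OF \<sigma>, of 0 2] st
    by (simp add: fact_numeral field_simps power2_eq_square)
qed

lemma integrable_W: "0 \<le> t \<Longrightarrow> integrable P (W t)"
proof (cases "t = 0")
  case True
  then show ?thesis using W_0 by (subst Bochner_Integration.integrable_cong[where g = "\<lambda>_. 0"]) auto
next
  case False
  assume "0 \<le> t"
  then have "integrable P (\<lambda>\<omega>. W t \<omega> - W 0 \<omega>)" using False by (intro integrable_increment) auto
  then show ?thesis using W_0 by (subst Bochner_Integration.integrable_cong[where g = "\<lambda>\<omega>. W t \<omega> - W 0 \<omega>"]) auto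
qed

text \<open>Independence is available for the increments along a finite grid. With \<open>0\<close>
  and \<open>u\<close> added to \<open>J\<close>, each \<open>W q\<close> becomes a telescoping sum
  of increments up to \<open>u\<close>, and the one from \<open>u\<close> to \<open>v\<close> comes
  last.\<close>

lemma increment_mean_0_cylinder:
  assumes J: "finite J" "J \<subseteq> {0..u}" and uv: "0 \<le> u" "u < v" and B: "\<And>q. B q \<in> sets borel"
  shows "(\<integral>\<omega>. indicator {\<omega> \<in> space P. \<forall>q\<in>J. W q \<omega> \<in> B q} \<omega> * (W v \<omega> - W u \<omega>) \<partial>P) = 0"
proof -
  define I where "I = insert 0 (insert u J)"
  define ts where "ts = sorted_list_of_set I"
  define n where "n = length ts - 1"
  define t where "t i = (if i \<le> n then ts ! i else v)" for i
  have I: "finite I" "I \<noteq> {}" "I \<subseteq> {0..u}" using J uv by (auto simp: I_def)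
  have ts: "sorted_wrt (<) ts" "set ts = I" "ts \<noteq> []"
    using I by (auto simp: ts_def strict_sorted_list_of_set)
  have len: "length ts = Suc n" using ts(3) by (simp add: n_def)
  have t_I: "t i \<in> I" if "i \<le> n" for i
    using that ts(2) len nth_mem[of i ts] by (simp add: t_def)
  have I_t: "\<exists>i\<le>n. t i = q" if "q \<in> I" for q
    using that ts(2) len in_set_conv_nth[of q ts] by (auto simp: t_def less_Suc_eq_le)
  have t_less: "t i < t j" if "i < j" "j \<le> n" for i j
    using sorted_wrt_nth_less[OF ts(1) that(1)] that len by (simp add: t_def)
  have t_0: "t 0 = 0"
  proof -
    obtain i where i: "i \<le> n" "t i = 0" using I_t[of 0] by (auto simp: I_def)
    have "t 0 \<ge> 0" using t_I[of 0] I by auto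
    then show ?thesis using i t_less[of 0 i] by (cases "i = 0") auto
  qed
  have t_n: "t n = u"
  proof -
    obtain i where i: "i \<le> n" "t i = u" using I_t[of u] by (auto simp: I_def)
    have "t n \<le> u" using t_I[of n] I by auto
    then show ?thesis using i t_less[of i n] by (cases "i = n") auto
  qed
  have t_v: "t (Suc n) = v" by (simp add: t_def)
  have t_nonneg: "0 \<le> t i" if "i \<le> Suc n" for i
    using t_I[of i] I that uv t_v by (cases "i = Suc n") auto
  have inc: "t i < t (Suc i)" if "i < Suc n" for i
    using t_less[of i "Suc i"] that t_v t_n uv by (cases "i = n") auto
  define X where "X i \<omega> = W (t (Suc i)) \<omega> - W (t i) \<omega>" for i \<omega>
  define idx where "idx q = (SOME i. i \<le> n \<and> t i = q)" for q
  have idx: "idx q \<le> n" "t (idx q) = q" if "q \<in> J" for q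
    using someI_ex[of "\<lambda>i. i \<le> n \<and> t i = q"] I_t[of q] that by (auto simp: idx_def I_def)
  have W_sum: "W q \<omega> = (\<Sum>i<idx q. X i \<omega>)" if "q \<in> J" "\<omega> \<in> space P" for q \<omega>
    unfolding X_def using sum_lessThan_telescope[of "\<lambda>i. W (t i) \<omega>" "idx q"] idx[OF that(1)] W_0[OF that(2)] t_0
    by simp
  let ?E = "{\<omega> \<in> space P. \<forall>q\<in>J. W q \<omega> \<in> B q}"
  let ?M1 = "PiM {..<n} (\<lambda>_. borel :: real measure)" and ?M2 = "PiM {n} (\<lambda>_. borel :: real measure)"
  let ?E' = "{y \<in> space ?M1. \<forall>q\<in>J. (\<Sum>i<idx q. y i) \<in> B q}"
  have "indep_vars (\<lambda>_. borel) X {..<Suc n}"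
    unfolding X_def by (intro indep_increments inc) (simp_all add: t_0)
  from indep_var_restrict[OF this, of "{..<n}" "{n}"]
  have 1: "indep_var ?M1 (\<lambda>\<omega>. restrict (\<lambda>i. X i \<omega>) {..<n}) ?M2 (\<lambda>\<omega>. restrict (\<lambda>i. X i \<omega>) {n})"
    by auto
  have "?E' \<in> sets ?M1"
  proof (rule sets.sets_Collect_finite_All[OF _ J(1)])
    fix q assume q: "q \<in> J"
    have "(\<lambda>y. \<Sum>i<idx q. y i) \<in> borel_measurable ?M1"
      using idx(1)[OF q] by (intro borel_measurable_sum measurable_component_singleton) auto
    from measurable_sets_Collect[OF this] B[of q]
    show "{y \<in> space ?M1. (\<Sum>i<idx q. y i) \<in> B q} \<in> sets ?M1" by simp
  qed
  then have Y1: "indicator ?E' \<in> borel_measurable ?M1" by simp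
  have Y2: "(\<lambda>y. y n) \<in> borel_measurable ?M2" by (rule measurable_component_singleton) simp
  have ind: "indep_var borel (indicator ?E' \<circ> (\<lambda>\<omega>. restrict (\<lambda>i. X i \<omega>) {..<n}) :: _ \<Rightarrow> real)
      borel ((\<lambda>y. y n) \<circ> (\<lambda>\<omega>. restrict (\<lambda>i. X i \<omega>) {n}))"
    by (rule indep_var_compose[OF 1 Y1 Y2])
  have eq: "(indicator ?E' \<circ> (\<lambda>\<omega>. restrict (\<lambda>i. X i \<omega>) {..<n})) \<omega> = (indicator ?E \<omega> :: real)"
    if "\<omega> \<in> space P" for \<omega>
  proof -
    have "(\<Sum>i<idx q. restrict (\<lambda>i. X i \<omega>) {..<n} i) = W q \<omega>" if "q \<in> J" for q
      unfolding W_sum[OF that \<open>\<omega> \<in> space P\<close>] using idx(1)[OF that] by (intro sum.cong) auto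
    then show ?thesis using that by (auto simp: indicator_def space_PiM)
  qed
  have E_P: "?E \<in> sets P"
  proof (rule sets.sets_Collect_finite_All[OF _ J(1)])
    fix q assume q: "q \<in> J"
    then show "{\<omega> \<in> space P. W q \<omega> \<in> B q} \<in> sets P"
      using J B by (intro measurable_sets_Collect[OF measurable_W]) auto
  qed
  have D: "((\<lambda>y. y n) \<circ> (\<lambda>\<omega>. restrict (\<lambda>i. X i \<omega>) {n})) = (\<lambda>\<omega>. W v \<omega> - W u \<omega>)"
    by (simp add: X_def comp_def t_n t_v)
  have i1: "integrable P (indicator ?E' \<circ> (\<lambda>\<omega>. restrict (\<lambda>i. X i \<omega>) {..<n}) :: _ \<Rightarrow> real)"
    using eq E_P by (subst Bochner_Integration.integrable_cong[where g = "indicator ?E"]) (auto simp: emeasure_eq_measure)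
  have "(\<integral>\<omega>. indicator ?E \<omega> * (W v \<omega> - W u \<omega>) \<partial>P) =
    (\<integral>\<omega>. (indicator ?E' \<circ> (\<lambda>\<omega>. restrict (\<lambda>i. X i \<omega>) {..<n})) \<omega> * (W v \<omega> - W u \<omega>) \<partial>P)"
    by (intro Bochner_Integration.integral_cong) (simp_all only: eq)
  also have "\<dots> = (\<integral>\<omega>. (indicator ?E' \<circ> (\<lambda>\<omega>. restrict (\<lambda>i. X i \<omega>) {..<n})) \<omega> \<partial>P) * (\<integral>\<omega>. W v \<omega> - W u \<omega> \<partial>P)"
    by (rule indep_var_lebesgue_integral[OF ind[unfolded D] i1 integrable_increment[OF uv]])
  finally show ?thesis using mean_increment[OF uv] by simp
qed

text \<open>Extension from cylinder sets by the \<pi>-\<lambda> theorem. This is the martingale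
  property of \<open>W\<close> in the form that grid sums require.\<close>

lemma increment_mean_0:
  assumes A: "A \<in> sets (Fil u)" and uv: "0 \<le> u" "u < v"
  shows "(\<integral>\<omega>. indicator A \<omega> * (W v \<omega> - W u \<omega>) \<partial>P) = 0"
proof -
  let ?D = "\<lambda>\<omega>. W v \<omega> - W u \<omega>"
  let ?G = "{{\<omega> \<in> space P. \<forall>q\<in>J. W q \<omega> \<in> B q} | J B. finite J \<and> J \<subseteq> {0..u} \<and> (\<forall>q. B q \<in> sets borel)}"
  note [measurable] = integrable_increment[OF uv, THEN borel_measurable_integrable]
  have G_P: "?G \<subseteq> sets P"
  proof safe
    fix J :: "real set" and B :: "real \<Rightarrow> real set"
    assume J: "finite J" "J \<subseteq> {0..u}" and B: "\<forall>q. B q \<in> sets borel"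
    have "{\<omega> \<in> space P. W q \<omega> \<in> B q} \<in> sets P" if "q \<in> J" for q
      using that J B by (intro measurable_sets_Collect[OF measurable_W]) auto
    then show "{\<omega> \<in> space P. \<forall>q\<in>J. W q \<omega> \<in> B q} \<in> sets P"
      by (intro sets.sets_Collect_finite_All J)
  qed
  note sig = sets.sigma_sets_subset[OF G_P]
  have Int: "Int_stable ?G"
  proof (rule Int_stableI)
    fix X Y assume "X \<in> ?G" "Y \<in> ?G"
    then obtain J B J' B' where 1: "X = {\<omega> \<in> space P. \<forall>q\<in>J. W q \<omega> \<in> B q}" "finite J" "J \<subseteq> {0..u}" "\<forall>q. B q \<in> sets borel"
      and 2: "Y = {\<omega> \<in> space P. \<forall>q\<in>J'. W q \<omega> \<in> B' q}" "finite J'" "J' \<subseteq> {0..u}" "\<forall>q. B' q \<in> sets borel"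
      by blast
    define B'' where "B'' q = (if q \<in> J then B q else UNIV) \<inter> (if q \<in> J' then B' q else UNIV)" for q
    have "X \<inter> Y = {\<omega> \<in> space P. \<forall>q\<in>J \<union> J'. W q \<omega> \<in> B'' q}"
      unfolding 1 2 B''_def by auto
    moreover have "\<forall>q. B'' q \<in> sets borel" using 1 2 by (auto simp: B''_def)
    moreover have "finite (J \<union> J')" "J \<union> J' \<subseteq> {0..u}" using 1 2 by auto
    ultimately show "X \<inter> Y \<in> ?G"
      unfolding mem_Collect_eq by (intro exI[of _ "J \<union> J'"] exI[of _ B''] conjI)
  qed
  have S: "sets (Fil u) = sigma_sets (space P) ?G"
    unfolding sets_natural_filtration
  proof (rule sigma_sets_eqI)
    fix X assume "X \<in> {W q -` B \<inter> space P |q B. 0 \<le> q \<and> q \<le> u \<and> B \<in> sets borel}"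
    then obtain q B where q: "X = W q -` B \<inter> space P" "0 \<le> q" "q \<le> u" "B \<in> sets borel" by blast
    then have "X = {\<omega> \<in> space P. \<forall>q'\<in>{q}. W q' \<omega> \<in> B}" by auto
    then have "X \<in> ?G"
      unfolding mem_Collect_eq using q by (intro exI[of _ "{q}"] exI[of _ "\<lambda>_. B"] conjI) auto
    then show "X \<in> sigma_sets (space P) ?G" by blast
  next
    fix X assume "X \<in> ?G"
    then obtain J B where 1: "X = {\<omega> \<in> space P. \<forall>q\<in>J. W q \<omega> \<in> B q}" "finite J" "J \<subseteq> {0..u}" "\<forall>q. B q \<in> sets borel"
      by blast
    have "{\<omega> \<in> space (Fil u). W q \<omega> \<in> B q} \<in> sets (Fil u)" if "q \<in> J" for q
      using that 1 by (intro measurable_sets_Collect[OF natural_filtration_measurable]) auto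
    then have "{\<omega> \<in> space (Fil u). \<forall>q\<in>J. W q \<omega> \<in> B q} \<in> sets (Fil u)"
      by (intro sets.sets_Collect_finite_All 1)
    then show "X \<in> sigma_sets (space P) {W q -` B \<inter> space P |q B. 0 \<le> q \<and> q \<le> u \<and> B \<in> sets borel}"
      unfolding sets_natural_filtration 1 by simp
  qed
  have "?G \<subseteq> Pow (space P)" by auto
  from Int this A[unfolded S] show ?thesis
  proof (induction rule: sigma_sets_induct_disjoint)
    case (basic X)
    then obtain J B where 1: "X = {\<omega> \<in> space P. \<forall>q\<in>J. W q \<omega> \<in> B q}" "finite J" "J \<subseteq> {0..u}" "\<forall>q. B q \<in> sets borel"
      by blast
    then show ?case using increment_mean_0_cylinder[OF 1(2,3) uv, of B] by auto
  next
    case empty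
    then show ?case by simp
  next
    case (compl X)
    have X: "X \<in> sets P" using compl(1) sig by (rule subsetD[rotated])
    have "(\<integral>\<omega>. indicator (space P - X) \<omega> * ?D \<omega> \<partial>P) = (\<integral>\<omega>. ?D \<omega> - indicator X \<omega> * ?D \<omega> \<partial>P)"
      by (intro Bochner_Integration.integral_cong) (auto simp: indicator_def)
    also have "\<dots> = (\<integral>\<omega>. ?D \<omega> \<partial>P) - (\<integral>\<omega>. indicator X \<omega> * ?D \<omega> \<partial>P)"
      using integrable_increment[OF uv] integrable_real_mult_indicator[OF X integrable_increment[OF uv]]
      by (intro Bochner_Integration.integral_diff) (auto simp: mult.commute)
    finally show ?case using compl mean_increment[OF uv] by simp
  next
    case (union X)
    have X: "X i \<in> sets P" for i using union(2) sig by (meson rangeI subsetD)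
    have i: "integrable P (\<lambda>\<omega>. indicator Y \<omega> * ?D \<omega>)" if "Y \<in> sets P" for Y
      using integrable_real_mult_indicator[OF that integrable_increment[OF uv]] by (simp add: mult.commute)
    have "(\<lambda>n. \<integral>\<omega>. indicator (\<Union>i<n. X i) \<omega> * ?D \<omega> \<partial>P) \<longlonglongrightarrow> (\<integral>\<omega>. indicator (\<Union>i. X i) \<omega> * ?D \<omega> \<partial>P)"
    proof (rule integral_dominated_convergence[where w = "\<lambda>\<omega>. \<bar>?D \<omega>\<bar>"])
      show "AE \<omega> in P. (\<lambda>n. indicator (\<Union>i<n. X i) \<omega> * ?D \<omega>) \<longlonglongrightarrow> indicator (\<Union>i. X i) \<omega> * ?D \<omega>"
        by (intro AE_I2 tendsto_intros LIMSEQ_indicator_UN)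
    qed (use X integrable_increment[OF uv] in \<open>auto simp: indicator_def\<close>)
    moreover have "(\<integral>\<omega>. indicator (\<Union>i<n. X i) \<omega> * ?D \<omega> \<partial>P) = 0" for n
    proof -
      have "indicator (\<Union>i<n. X i) \<omega> = (\<Sum>i<n. indicator (X i) \<omega> :: real)" for \<omega>
        using union(1) by (intro indicator_UN_disjoint) (auto intro: disjoint_family_on_mono)
      then have "(\<integral>\<omega>. indicator (\<Union>i<n. X i) \<omega> * ?D \<omega> \<partial>P) = (\<Sum>i<n. \<integral>\<omega>. indicator (X i) \<omega> * ?D \<omega> \<partial>P)"
        using i[OF X] by (simp only: sum_distrib_right Bochner_Integration.integral_sum)
      then show ?thesis using union by simp
    qed
    ultimately show ?case by (simp add: LIMSEQ_const_iff)
  qed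
qed

end

section \<open>Rational times for measurability, equidistant grids for stopping\<close>

lemma rational_grid:
  fixes g :: "real \<Rightarrow> 'b::topological_space"
  assumes g: "continuous_on {0..t} g" and U: "open U" and v: "0 \<le> v" "v \<le> t" "g v \<in> U"
  shows "\<exists>x\<in>\<rat> \<inter> {0..1}. g (t * x) \<in> U"
proof (cases "t = 0")
  case True
  then show ?thesis using v by (intro bexI[of _ 0]) auto
next
  case False
  then have t: "0 < t" using v by simp
  have "(g \<longlongrightarrow> g v) (at v within {0..t})"
    using g v by (auto simp: continuous_on_def)
  then have "eventually (\<lambda>u. g u \<in> U) (at v within {0..t})"
    using U v by (auto simp: tendsto_def)
  then obtain d where d: "d > 0" "\<And>u. u \<in> {0..t} \<Longrightarrow> u \<noteq> v \<Longrightarrow> \<bar>u - v\<bar> < d \<Longrightarrow> g u \<in> U"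
    by (auto simp: eventually_at dist_real_def)
  have "max 0 (v - d) / t < min t (v + d) / t"
    using t v d by (intro divide_strict_right_mono) auto
  then obtain x where x: "x \<in> \<rat>" "max 0 (v - d) / t < x" "x < min t (v + d) / t"
    using Rats_dense_in_real by blast
  then have "max 0 (v - d) < t * x" "t * x < min t (v + d)"
    using t by (simp_all add: field_simps)
  then have tx: "0 < t * x" "t * x < t" "\<bar>t * x - v\<bar> < d" by auto
  then have "x < 1" using t by simp
  moreover have "0 < x" using tx(1) t by (simp add: zero_less_mult_iff)
  ultimately have "x \<in> {0..1}" by simp
  moreover have "t * x \<in> {0..t}" using tx(1,2) by (simp only: atLeastAtMost_iff less_imp_le)
  then have "g (t * x) \<in> U" using d(2)[of "t * x"] v tx(3) by (cases "t * x = v") blast+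
  ultimately show ?thesis using x by blast
qed

context based_path
begin

lemma path_max_le_iff_rational:
  assumes "0 \<le> t"
  shows "path_max f t \<le> a \<longleftrightarrow> (\<forall>x\<in>\<rat> \<inter> {0..1}. f (t * x) \<le> a)"
proof
  assume L: "path_max f t \<le> a"
  show "\<forall>x\<in>\<rat> \<inter> {0..1}. f (t * x) \<le> a"
  proof
    fix x :: real assume "x \<in> \<rat> \<inter> {0..1}"
    then have "f (t * x) \<le> path_max f t"
      using assms by (intro path_max_ge cont) (auto simp: mult_left_le)
    then show "f (t * x) \<le> a" using L by simp
  qed
next
  assume R: "\<forall>x\<in>\<rat> \<inter> {0..1}. f (t * x) \<le> a"
  show "path_max f t \<le> a"
  proof (rule path_max_le[OF cont assms], rule ccontr)
    fix u assume "0 \<le> u" "u \<le> t" "\<not> f u \<le> a"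
    then have "\<exists>x\<in>\<rat> \<inter> {0..1}. f (t * x) \<in> {a<..}"
      by (intro rational_grid[of t f _ u] continuous_on_subset[OF cont]) auto
    then show False using R by force
  qed
qed

text \<open>By compactness the distance to \<open>C\<close> attains its minimum on
  \<open>[0, t]\<close>, so a closed set is hit as soon as the infimum of the distance is 0, and
  countably many times detect that infimum. The empty set is excluded because \<open>infdist\<close>
  to it is 0.\<close>

lemma hit_by_iff_rational:
  assumes C: "closed C" "C \<noteq> {}" and t: "0 \<le> t"
  shows "hit_by C t \<longleftrightarrow> (\<forall>n. \<exists>x\<in>\<rat> \<inter> {0..1}. infdist (pos (t * x)) C < 1 / real (Suc n))"
proof -
  have cp: "continuous_on {0..t} (\<lambda>v. infdist (pos v) C)"
    by (intro continuous_on_infdist continuous_on_subset[OF continuous_on_pos]) auto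
  show ?thesis
  proof
    assume "hit_by C t"
    then obtain v where v: "0 \<le> v" "v \<le> t" "pos v \<in> C" by (auto simp: hit_by_def)
    then have "infdist (pos v) C = 0" by simp
    then have "\<exists>x\<in>\<rat> \<inter> {0..1}. infdist (pos (t * x)) C \<in> {..<1 / real (Suc n)}" for n
      using v by (intro rational_grid[OF cp]) auto
    then show "\<forall>n. \<exists>x\<in>\<rat> \<inter> {0..1}. infdist (pos (t * x)) C < 1 / real (Suc n)" by simp
  next
    assume R: "\<forall>n. \<exists>x\<in>\<rat> \<inter> {0..1}. infdist (pos (t * x)) C < 1 / real (Suc n)"
    obtain v where v: "v \<in> {0..t}" "\<And>u. u \<in> {0..t} \<Longrightarrow> infdist (pos v) C \<le> infdist (pos u) C"
      using continuous_attains_inf[OF _ _ cp] t by auto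
    have "infdist (pos v) C < 1 / real (Suc n)" for n
    proof -
      obtain x where "x \<in> {0..1}" "infdist (pos (t * x)) C < 1 / real (Suc n)" using R by blast
      moreover have "t * x \<in> {0..t}" using \<open>x \<in> {0..1}\<close> t by (auto simp: mult_left_le)
      ultimately show ?thesis using v(2)[of "t * x"] by linarith
    qed
    then have "infdist (pos v) C \<le> 0"
      by (metis not_le nat_approx_posE less_asym)
    then have "pos v \<in> C" using C in_closed_iff_infdist_zero infdist_nonneg
      by (metis order_antisym)
    then show "hit_by C t" using v by (auto simp: hit_by_def)
  qed
qed

text \<open>A discrete stochastic integral that approximates the stopped path. Testing for a hit at
  the left end of each step makes the factor known before the increment, so that every summand has
  mean 0.\<close>

definition grid_sum :: "(real \<times> real) set \<Rightarrow> real \<Rightarrow> real \<Rightarrow> nat \<Rightarrow> real" where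
  "grid_sum C t0 t N = (\<Sum>j<N. if hit_by C (t0 + real j * ((t - t0) / real N)) then 0
     else f (t0 + real (Suc j) * ((t - t0) / real N)) - f (t0 + real j * ((t - t0) / real N)))"

text \<open>The sum telescopes up to the first grid time at or after the hit, which is at most one
  mesh late. The maximum with \<open>t0\<close> accounts for paths stopped before \<open>t0\<close>,
  whose sum is 0.\<close>

lemma grid_sum_eq:
  assumes C: "closed C" and t: "0 \<le> t0" "t0 \<le> t" and N: "0 < N"
  defines "g \<equiv> \<lambda>j. t0 + real j * ((t - t0) / real N)"
  obtains J where "J \<le> N" "grid_sum C t0 t N = f (g J) - f t0"
    "\<And>j. j < J \<Longrightarrow> \<not> hit_by C (g j)" "\<bar>g J - max t0 (stop_time C t)\<bar> \<le> (t - t0) / real N"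
proof -
  define d where "d = (t - t0) / real N"
  have d: "0 \<le> d" using t by (simp add: d_def)
  have g: "g j = t0 + real j * d" for j by (simp add: g_def d_def)
  have gN: "g N = t" using N by (simp add: g_def)
  have g0: "g 0 = t0" by (simp add: g_def)
  have gm: "g i \<le> g j" if "i \<le> j" for i j
    using that d unfolding g by (intro add_left_mono mult_right_mono) auto
  have g_nonneg: "0 \<le> g j" for j using gm[of 0 j] g0 t by simp
  \<comment> \<open>All summands before \<open>J\<close> are increments and all later ones vanish.
    Without a hit by time \<open>t\<close> the whole grid is traversed.\<close>
  define J where "J = (if hit_by C t then LEAST j. hit_by C (g j) else N)"
  have ex: "hit_by C (g N)" if "hit_by C t" using that gN by simp
  have J: "J \<le> N" using ex Least_le[of "\<lambda>j. hit_by C (g j)" N] by (auto simp: J_def)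
  have before: "\<not> hit_by C (g j)" if "j < J" for j
  proof (cases "hit_by C t")
    case True
    then show ?thesis using that not_less_Least by (auto simp: J_def)
  next
    case False
    then have "\<not> hit_by C (g N)" using gN by simp
    then show ?thesis using hit_by_mono gm[of j N] that False by (auto simp: J_def)
  qed
  have after: "hit_by C (g j)" if "J \<le> j" "j < N" for j
  proof (cases "hit_by C t")
    case True
    then have "hit_by C (g J)" using LeastI[of "\<lambda>j. hit_by C (g j)" N] ex by (auto simp: J_def)
    then show ?thesis using hit_by_mono gm[OF that(1)] by blast
  next
    case False
    then show ?thesis using that by (simp add: J_def)
  qed
  have "grid_sum C t0 t N = (\<Sum>j<N. if hit_by C (g j) then 0 else f (g (Suc j)) - f (g j))"
    by (simp only: grid_sum_def g_def)
  also have "\<dots> = (\<Sum>j<J. f (g (Suc j)) - f (g j))"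
    by (rule sum.mono_neutral_cong_right) (use J before after in \<open>auto simp: not_less\<close>)
  also have "\<dots> = f (g J) - f t0" using sum_lessThan_telescope[of "\<lambda>j. f (g j)" J] g0 by simp
  finally have eq: "grid_sum C t0 t N = f (g J) - f t0" .
  have "\<bar>g J - max t0 (stop_time C t)\<bar> \<le> d"
  proof (cases "hit_by C t")
    case False
    then show ?thesis using gN t d by (simp add: J_def stop_time_def)
  next
    case True
    then have "hit_by C (g J)" using LeastI[of "\<lambda>j. hit_by C (g j)" N] ex by (auto simp: J_def)
    then have le: "stop_time C t \<le> g J" using not_hit_by_iff[OF C True g_nonneg] by (meson not_le)
    show ?thesis
    proof (cases J)
      case 0
      then show ?thesis using le g0 d by simp
    next
      case (Suc i)
      then have "g i < stop_time C t" using before[of i] not_hit_by_iff[OF C True g_nonneg] by simp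
      moreover have "g J = g i + d" using Suc by (simp add: g algebra_simps)
      moreover have "t0 \<le> g i" using gm[of 0 i] g0 by simp
      ultimately show ?thesis using le by auto
    qed
  qed
  with that[OF J eq before] show ?thesis by (simp add: d_def)
qed

lemma grid_sum_tendsto:
  assumes C: "closed C" and t: "0 \<le> t0" "t0 \<le> t"
  shows "(\<lambda>N. grid_sum C t0 t (Suc N)) \<longlonglongrightarrow> f (max t0 (stop_time C t)) - f t0"
proof -
  have "\<exists>u. 0 \<le> u \<and> grid_sum C t0 t (Suc N) = f u - f t0 \<and>
      \<bar>u - max t0 (stop_time C t)\<bar> \<le> (t - t0) / real (Suc N)" for N
  proof -
    obtain J where "grid_sum C t0 t (Suc N) = f (t0 + real J * ((t - t0) / real (Suc N))) - f t0"
      "\<bar>t0 + real J * ((t - t0) / real (Suc N)) - max t0 (stop_time C t)\<bar> \<le> (t - t0) / real (Suc N)"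
      using grid_sum_eq[OF C t, of "Suc N"] by (metis zero_less_Suc)
    moreover have "0 \<le> t0 + real J * ((t - t0) / real (Suc N))" using t by simp
    ultimately show ?thesis by blast
  qed
  then obtain u where u: "\<And>N. 0 \<le> u N" "\<And>N. grid_sum C t0 t (Suc N) = f (u N) - f t0"
    "\<And>N. \<bar>u N - max t0 (stop_time C t)\<bar> \<le> (t - t0) / real (Suc N)" by metis
  have "(\<lambda>N. u N - max t0 (stop_time C t)) \<longlonglongrightarrow> 0"
  proof (rule Lim_null_comparison)
    show "eventually (\<lambda>N. norm (u N - max t0 (stop_time C t)) \<le> (t - t0) / real (Suc N)) sequentially"
      using u(3) by simp
    show "(\<lambda>N. (t - t0) / real (Suc N)) \<longlonglongrightarrow> 0"
      by (rule LIMSEQ_Suc) (rule lim_const_over_n)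
  qed
  then have "u \<longlonglongrightarrow> max t0 (stop_time C t)" by (rule LIM_zero_cancel)
  then have "(\<lambda>N. f (u N)) \<longlonglongrightarrow> f (max t0 (stop_time C t))"
    using cont u(1) t by (intro continuous_on_tendsto_compose[of "{0..}" f]) auto
  then show ?thesis unfolding u(2) by (intro tendsto_intros)
qed

text \<open>Before stopping, the pair is outside \<open>C\<close> and hence the path is in
  \<open>V\<close>; closedness of \<open>V\<close> passes this on to the stopping time. Only pairs
  with \<open>w \<le> s\<close> are constrained, since a path never exceeds its maximum.\<close>

lemma stop_in_closed:
  assumes C: "closed C" and V: "closed V" "\<And>w s. w \<le> s \<Longrightarrow> (w, s) \<notin> C \<Longrightarrow> w \<in> V"
    and t: "0 \<le> t" "0 < stop_time C t"
  shows "f (stop_time C t) \<in> V"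
proof (rule ccontr)
  assume "\<not> ?thesis"
  moreover have "open {x. x \<notin> V}" using V(1) by (simp add: closed_def Compl_eq)
  ultimately obtain u where u: "0 \<le> u" "u < stop_time C t" "f u \<notin> V"
    using eventually_close_below[OF cont t(2), of "\<lambda>x. x \<notin> V"] by auto
  have "pos u \<notin> C" by (rule not_hit_before_stop_time[OF C t(1) u(1,2)])
  then show False using V(2)[of "f u" "path_max f u"] path_max_ge[OF cont, of u u] u by (auto simp: pos_def)
qed

lemma hit_in_closed:
  assumes C: "closed C" and V: "closed V" "\<And>w s. w \<le> s \<Longrightarrow> (w, s) \<notin> C \<Longrightarrow> w \<in> V"
    and h: "hits C" "0 < hit_time C"
  shows "f (hit_time C) \<in> V"
proof -
  have "stop_time C (hit_time C) = hit_time C" by (simp add: stop_time_def)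
  then show ?thesis using stop_in_closed[OF C V, where t = "hit_time C"] h(2) by simp
qed

text \<open>All grid values before the last counted step lie in \<open>[- K, K]\<close>, so the sum
  is at most \<open>2 * K\<close> plus the last increment in absolute value. The additional 1 in the
  truncation level keeps it inactive unless that increment exceeds 1, and then its modulus is at
  most its fourth power.\<close>

lemma grid_sum_bound:
  assumes C: "closed C" and K: "\<And>w s. w \<le> s \<Longrightarrow> (w, s) \<notin> C \<Longrightarrow> \<bar>w\<bar> \<le> K"
    and t: "0 \<le> t0" "t0 \<le> t" and N: "0 < N" and K0: "0 \<le> K"
  shows "\<bar>grid_sum C t0 t N - max (- (2 * K + 1)) (min (2 * K + 1) (grid_sum C t0 t N))\<bar> \<le>
    (\<Sum>j<N. (f (t0 + real (Suc j) * ((t - t0) / real N)) - f (t0 + real j * ((t - t0) / real N))) ^ 4)"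
    (is "_ \<le> (\<Sum>j<N. ?D j ^ 4)")
proof -
  let ?g = "\<lambda>j. t0 + real j * ((t - t0) / real N)"
  obtain J where J: "J \<le> N" "grid_sum C t0 t N = f (?g J) - f t0" "\<And>j. j < J \<Longrightarrow> \<not> hit_by C (?g j)"
    using grid_sum_eq[OF C t N] by metis
  have nonneg: "0 \<le> (\<Sum>j<N. ?D j ^ 4)" by (intro sum_nonneg) (auto intro: zero_le_even_power)
  show ?thesis
  proof (cases J)
    case 0
    then show ?thesis using J(2) nonneg K0 by simp
  next
    case (Suc i)
    have b: "\<bar>f (?g j)\<bar> \<le> K" if "j < J" for j
    proof -
      have "0 \<le> ?g j" using t by simp
      moreover from this have "pos (?g j) \<notin> C" using J(3)[OF that] by (auto simp: hit_by_def)
      ultimately show ?thesis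
        using K[of "f (?g j)" "path_max f (?g j)"] path_max_ge[OF cont, of "?g j" "?g j"] by (auto simp: pos_def)
    qed
    have "grid_sum C t0 t N = ?D i + f (?g i) - f (?g 0)" using J(2) Suc by simp
    moreover have "\<bar>f (?g i)\<bar> \<le> K" "\<bar>f (?g 0)\<bar> \<le> K" using b[of i] b[of 0] Suc by auto
    ultimately have R: "\<bar>grid_sum C t0 t N\<bar> \<le> \<bar>?D i\<bar> + 2 * K" by linarith
    have le: "?D i ^ 4 \<le> (\<Sum>j<N. ?D j ^ 4)"
      using J(1) Suc by (intro member_le_sum) (auto intro: zero_le_even_power)
    show ?thesis
    proof (cases "\<bar>?D i\<bar> \<le> 1")
      case True
      then show ?thesis using R nonneg by (simp add: max_def min_def abs_if split: if_splits)
    next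
      case False
      then have "\<bar>?D i\<bar> \<le> \<bar>?D i\<bar> ^ 4" using power_increasing[of 1 4 "\<bar>?D i\<bar>"] by simp
      then have "\<bar>?D i\<bar> \<le> ?D i ^ 4" by simp
      then show ?thesis using R le K0 by (simp add: max_def min_def abs_if split: if_splits)
    qed
  qed
qed

end


context brownian
begin

abbreviation "running \<equiv> \<lambda>t \<omega>. path_max (\<lambda>u. W u \<omega>) t"
abbreviation "hit_by C t \<omega> \<equiv> based_path.hit_by (\<lambda>u. W u \<omega>) C t"
abbreviation "stop_time C t \<omega> \<equiv> based_path.stop_time (\<lambda>u. W u \<omega>) C t"
abbreviation "stopped C t \<omega> \<equiv> W (based_path.stop_time (\<lambda>u. W u \<omega>) C t) \<omega>"
abbreviation "hits C \<omega> \<equiv> based_path.hits (\<lambda>u. W u \<omega>) C"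
abbreviation "hit_value C \<omega> \<equiv> W (based_path.hit_time (\<lambda>u. W u \<omega>) C) \<omega>"

lemma measurable_running:
  assumes "0 \<le> q" "q \<le> t"
  shows "running q \<in> borel_measurable (Fil t)"
  unfolding borel_measurable_iff_le
proof
  fix a
  have "{\<omega> \<in> space (Fil t). running q \<omega> \<le> a} = {\<omega> \<in> space (Fil t). \<forall>x\<in>\<rat> \<inter> {0..1}. W (q * x) \<omega> \<le> a}"
    using based_path.path_max_le_iff_rational[OF based_path assms(1)] by auto
  also have "\<dots> \<in> sets (Fil t)"
  proof (rule sets.sets_Collect_countable_All')
    fix x :: real assume "x \<in> \<rat> \<inter> {0..1}"
    then have "0 \<le> q * x" "q * x \<le> t" using assms mult_left_le[of x q] by auto
    from natural_filtration_measurable[OF this, of W P]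
    show "{\<omega> \<in> space (Fil t). W (q * x) \<omega> \<le> a} \<in> sets (Fil t)" by measurable
  qed (simp add: countable_rat)
  finally show "{\<omega> \<in> space (Fil t). running q \<omega> \<le> a} \<in> sets (Fil t)" .
qed

lemma sets_hit_by:
  assumes C: "closed C" "C \<noteq> {}" and t: "0 \<le> q" "q \<le> t"
  shows "{\<omega> \<in> space P. hit_by C q \<omega>} \<in> sets (Fil t)"
proof -
  have eq: "{\<omega> \<in> space P. hit_by C q \<omega>} = {\<omega> \<in> space (Fil t).
      \<forall>n. \<exists>x\<in>\<rat> \<inter> {0..1}. infdist (W (q * x) \<omega>, running (q * x) \<omega>) C < 1 / real (Suc n)}"
    using based_path.hit_by_iff_rational[OF based_path C t(1)] based_path.pos_def[OF based_path] by auto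
  show ?thesis unfolding eq
  proof (intro sets.sets_Collect_countable_All sets.sets_Collect_countable_Ex')
    fix x :: real and n :: nat assume "x \<in> \<rat> \<inter> {0..1}"
    then have x: "0 \<le> q * x" "q * x \<le> t" using t mult_left_le[of x q] by auto
    note [measurable] = natural_filtration_measurable[OF x, of W P] measurable_running[OF x]
    have "(\<lambda>\<omega>. infdist (W (q * x) \<omega>, running (q * x) \<omega>) C) \<in> borel_measurable (Fil t)"
      by (rule borel_measurable_continuous_on[where f = "\<lambda>p. infdist p C"])
        (auto intro!: continuous_intros)
    then show "{\<omega> \<in> space (Fil t). infdist (W (q * x) \<omega>, running (q * x) \<omega>) C < 1 / real (Suc n)} \<in> sets (Fil t)"
      by measurable
  qed (simp add: countable_rat)
qed

lemma integrable_increment': "0 \<le> s \<Longrightarrow> 0 \<le> t \<Longrightarrow> integrable P (\<lambda>\<omega>. W t \<omega> - W s \<omega>)"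
  by (intro Bochner_Integration.integrable_diff integrable_W)

lemma grid_sum_indicator:
  "\<omega> \<in> space P \<Longrightarrow> based_path.grid_sum (\<lambda>u. W u \<omega>) C t0 t N =
    (\<Sum>j<N. indicator {\<omega> \<in> space P. \<not> hit_by C (t0 + real j * ((t - t0) / real N)) \<omega>} \<omega> *
      (W (t0 + real (Suc j) * ((t - t0) / real N)) \<omega> - W (t0 + real j * ((t - t0) / real N)) \<omega>))"
  unfolding based_path.grid_sum_def[OF based_path] by (intro sum.cong) auto

lemma measurable_grid_sum:
  assumes C: "closed C" "C \<noteq> {}" and t: "0 \<le> t0" "t0 \<le> t"
  shows "(\<lambda>\<omega>. based_path.grid_sum (\<lambda>u. W u \<omega>) C t0 t N) \<in> borel_measurable (Fil t)"
proof -
  have le: "0 \<le> t0 + real j * ((t - t0) / real N) \<and> t0 + real j * ((t - t0) / real N) \<le> t"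
    if "j \<le> N" "0 < N" for j
  proof -
    have "real j * (t - t0) \<le> real N * (t - t0)" using that t by (intro mult_right_mono) auto
    then have "real j * ((t - t0) / real N) \<le> t - t0" using that by (simp add: field_simps)
    then show ?thesis using t by simp
  qed
  show ?thesis
  proof (subst measurable_cong[OF grid_sum_indicator])
    show "(\<lambda>\<omega>. \<Sum>j<N. indicator {\<omega> \<in> space P. \<not> hit_by C (t0 + real j * ((t - t0) / real N)) \<omega>} \<omega> *
      (W (t0 + real (Suc j) * ((t - t0) / real N)) \<omega> - W (t0 + real j * ((t - t0) / real N)) \<omega>)) \<in> borel_measurable (Fil t)"
    proof (rule borel_measurable_sum)
      fix j assume "j \<in> {..<N}"
      then have j: "j \<le> N" "Suc j \<le> N" "0 < N" by auto
      note l1 = le[OF j(1,3)] and l2 = le[OF j(2,3)]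
      have "space (Fil t) - {\<omega> \<in> space P. hit_by C (t0 + real j * ((t - t0) / real N)) \<omega>} \<in> sets (Fil t)"
        using sets_hit_by[OF C, of "t0 + real j * ((t - t0) / real N)" t] l1 by blast
      moreover have "space (Fil t) - {\<omega> \<in> space P. hit_by C (t0 + real j * ((t - t0) / real N)) \<omega>} =
        {\<omega> \<in> space P. \<not> hit_by C (t0 + real j * ((t - t0) / real N)) \<omega>}" by auto
      ultimately have "{\<omega> \<in> space P. \<not> hit_by C (t0 + real j * ((t - t0) / real N)) \<omega>} \<in> sets (Fil t)" by simp
      then show "(\<lambda>\<omega>. indicator {\<omega> \<in> space P. \<not> hit_by C (t0 + real j * ((t - t0) / real N)) \<omega>} \<omega> *
      (W (t0 + real (Suc j) * ((t - t0) / real N)) \<omega> - W (t0 + real j * ((t - t0) / real N)) \<omega>)) \<in> borel_measurable (Fil t)"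
        using l1 l2
        by (intro borel_measurable_times borel_measurable_diff natural_filtration_measurable borel_measurable_indicator) auto
    qed
  qed simp
qed

text \<open>The stopped value is the pointwise limit of grid sums, which are all measurable at time
  \<open>t\<close>.\<close>

lemma measurable_stopped:
  assumes C: "closed C" "C \<noteq> {}" and t: "0 \<le> t0" "t0 \<le> t"
  shows "(\<lambda>\<omega>. W (max t0 (stop_time C t \<omega>)) \<omega> - W t0 \<omega>) \<in> borel_measurable (Fil t)"
proof (rule borel_measurable_LIMSEQ_real)
  show "(\<lambda>N. based_path.grid_sum (\<lambda>u. W u \<omega>) C t0 t (Suc N)) \<longlonglongrightarrow> W (max t0 (stop_time C t \<omega>)) \<omega> - W t0 \<omega>"
    if "\<omega> \<in> space (Fil t)" for \<omega>
    using based_path.grid_sum_tendsto[OF based_path C(1) t] that by simp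
qed (rule measurable_grid_sum[OF C t])

lemma measurable_stopped_0:
  assumes C: "closed C" "C \<noteq> {}" and t: "0 \<le> t"
  shows "stopped C t \<in> borel_measurable (Fil t)"
proof (subst measurable_cong)
  show "stopped C t \<omega> = W (max 0 (stop_time C t \<omega>)) \<omega> - W 0 \<omega>" if "\<omega> \<in> space (Fil t)" for \<omega>
    using based_path.stop_time_nonneg[OF based_path C(1) t] that W_0 by (simp add: max_absorb2)
qed (rule measurable_stopped[OF C order_refl t])

lemma grid_step:
  fixes d :: real
  assumes "0 < d"
  shows "a \<le> a + real j * d \<and> a + real j * d < a + real (Suc j) * d"
  using assms by (simp add: distrib_right)

text \<open>The event that \<open>A\<close> occurs and \<open>C\<close> has not been hit by a grid
  time belongs to the past of that time, so the next increment has mean 0 on it.\<close>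

lemma grid_sum_mean_0:
  assumes C: "closed C" "C \<noteq> {}" and t: "0 \<le> t0" "t0 < t" and A: "A \<in> sets (Fil t0)" and N: "0 < N"
  shows "integrable P (\<lambda>\<omega>. indicator A \<omega> * based_path.grid_sum (\<lambda>u. W u \<omega>) C t0 t N)"
    "(\<integral>\<omega>. indicator A \<omega> * based_path.grid_sum (\<lambda>u. W u \<omega>) C t0 t N \<partial>P) = 0"
proof -
  let ?g = "\<lambda>j. t0 + real j * ((t - t0) / real N)"
  have d: "0 < (t - t0) / real N" using t N by simp
  define A' where "A' j = A \<inter> {\<omega> \<in> space P. \<not> hit_by C (?g j) \<omega>}" for j
  have g: "t0 \<le> ?g j" "?g j < ?g (Suc j)" for j
    using grid_step[OF d, of t0 j] by blast+
  have A': "A' j \<in> sets (Fil (?g j))" for j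
  proof -
    have "space (Fil (?g j)) - {\<omega> \<in> space P. hit_by C (?g j) \<omega>} \<in> sets (Fil (?g j))"
    proof -
      have "0 \<le> ?g j" using g(1)[of j] t by linarith
      then show ?thesis using sets.compl_sets[OF sets_hit_by[OF C _ order_refl]] by blast
    qed
    moreover have "space (Fil (?g j)) - {\<omega> \<in> space P. hit_by C (?g j) \<omega>} = {\<omega> \<in> space P. \<not> hit_by C (?g j) \<omega>}"
      by auto
    moreover have "A \<in> sets (Fil (?g j))" using A natural_filtration_mono[OF g(1)] by blast
    ultimately show ?thesis by (auto simp: A'_def)
  qed
  have eq: "indicator A \<omega> * based_path.grid_sum (\<lambda>u. W u \<omega>) C t0 t N =
      (\<Sum>j<N. indicator (A' j) \<omega> * (W (?g (Suc j)) \<omega> - W (?g j) \<omega>))" if "\<omega> \<in> space P" for \<omega>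
    unfolding grid_sum_indicator[OF that] sum_distrib_left A'_def
    by (intro sum.cong) (auto simp: indicator_def)
  have i: "integrable P (\<lambda>\<omega>. indicator (A' j) \<omega> * (W (?g (Suc j)) \<omega> - W (?g j) \<omega>))" for j
    using integrable_real_mult_indicator[OF Fil_sets[OF A'] integrable_increment'] g t
    by (simp add: mult.commute)
  show "integrable P (\<lambda>\<omega>. indicator A \<omega> * based_path.grid_sum (\<lambda>u. W u \<omega>) C t0 t N)"
    by (subst Bochner_Integration.integrable_cong[OF refl eq])
      (assumption, rule Bochner_Integration.integrable_sum[OF i])
  have "(\<integral>\<omega>. indicator A \<omega> * based_path.grid_sum (\<lambda>u. W u \<omega>) C t0 t N \<partial>P) =
      (\<Sum>j<N. \<integral>\<omega>. indicator (A' j) \<omega> * (W (?g (Suc j)) \<omega> - W (?g j) \<omega>) \<partial>P)"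
    by (subst Bochner_Integration.integral_cong[OF refl eq])
      (auto simp only: Bochner_Integration.integral_sum i)
  also have "\<dots> = 0"
    using increment_mean_0[OF A' _ g(2)] g(1) t by (intro sum.neutral) (auto intro: order_trans)
  finally show "(\<integral>\<omega>. indicator A \<omega> * based_path.grid_sum (\<lambda>u. W u \<omega>) C t0 t N \<partial>P) = 0" .
qed

text \<open>The overshoot of the discretely stopped path is at most one increment, hence bounded by the
  sum of the fourth powers of all increments as soon as it exceeds 1. These sums tend to 0 in
  \<open>L\<^sup>1\<close>.\<close>

lemma optional_stopping_bounded:
  assumes C: "closed C" "C \<noteq> {}" and K: "\<And>w s. w \<le> s \<Longrightarrow> (w, s) \<notin> C \<Longrightarrow> \<bar>w\<bar> \<le> K" "0 \<le> K"
    and t: "0 \<le> t0" "t0 < t" and A: "A \<in> sets (Fil t0)"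
  shows "(\<integral>\<omega>. indicator A \<omega> * (W (max t0 (stop_time C t \<omega>)) \<omega> - W t0 \<omega>) \<partial>P) = 0"
proof -
  let ?G = "\<lambda>N \<omega>. based_path.grid_sum (\<lambda>u. W u \<omega>) C t0 t (Suc N)"
  let ?c = "\<lambda>x. max (- (2 * K + 1)) (min (2 * K + 1) x)"
  let ?Y = "\<lambda>\<omega>. W (max t0 (stop_time C t \<omega>)) \<omega> - W t0 \<omega>"
  have t': "t0 \<le> t" using t by simp
  note meas = measurable_from_subalg[OF subalgebra_Fil]
  have [measurable]: "?G N \<in> borel_measurable P" for N
    by (rule meas[OF measurable_grid_sum[OF C t(1) t']])
  have [measurable]: "?Y \<in> borel_measurable P"
    by (rule meas[OF measurable_stopped[OF C t(1) t']])
  have [measurable]: "A \<in> sets P" by (rule Fil_sets[OF A])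
  have Y_le: "\<bar>?Y \<omega>\<bar> \<le> 2 * K" if \<omega>: "\<omega> \<in> space P" for \<omega>
  proof -
    interpret f: based_path "\<lambda>u. W u \<omega>" by (rule based_path[OF \<omega>])
    show ?thesis
    proof (cases "t0 < f.stop_time C t")
      case True
      have "w \<in> {- K..K}" if "w \<le> s" "(w, s) \<notin> C" for w s using K(1)[OF that] by auto
      then have "W (f.stop_time C t) \<omega> \<in> {- K..K}"
        using t True by (intro f.stop_in_closed[OF C(1)]) auto
      then have "\<bar>W (f.stop_time C t) \<omega>\<bar> \<le> K" by auto
      moreover have "f.pos t0 \<notin> C" using t True by (intro f.not_hit_before_stop_time[OF C(1), of t]) auto
      then have "\<bar>W t0 \<omega>\<bar> \<le> K"
        using K(1)[of "W t0 \<omega>" "path_max (\<lambda>u. W u \<omega>) t0"] path_max_ge[OF f.cont, of t0 t0] t by (auto simp: f.pos_def)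
      ultimately show ?thesis using True by (auto simp: max_def)
    next
      case False
      then show ?thesis using K by (simp add: max_def)
    qed
  qed
  have "(\<lambda>N. \<integral>\<omega>. indicator A \<omega> * ?c (?G N \<omega>) \<partial>P) \<longlonglongrightarrow> (\<integral>\<omega>. indicator A \<omega> * ?Y \<omega> \<partial>P)"
  proof (rule integral_dominated_convergence[where w = "\<lambda>_. 2 * K + 1"])
    show "AE \<omega> in P. (\<lambda>N. indicator A \<omega> * ?c (?G N \<omega>)) \<longlonglongrightarrow> indicator A \<omega> * ?Y \<omega>"
    proof (rule AE_I2)
      fix \<omega> assume \<omega>: "\<omega> \<in> space P"
      have "(\<lambda>N. ?c (?G N \<omega>)) \<longlonglongrightarrow> ?c (?Y \<omega>)"
        by (intro tendsto_intros based_path.grid_sum_tendsto[OF based_path[OF \<omega>] C(1) t(1) t'])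
      moreover have "?c (?Y \<omega>) = ?Y \<omega>" using Y_le[OF \<omega>] K by (auto simp: abs_le_iff)
      ultimately show "(\<lambda>N. indicator A \<omega> * ?c (?G N \<omega>)) \<longlonglongrightarrow> indicator A \<omega> * ?Y \<omega>"
        by (auto intro: tendsto_intros)
    qed
    show "AE \<omega> in P. norm (indicator A \<omega> * ?c (?G N \<omega>)) \<le> 2 * K + 1" for N
      using K by (intro AE_I2) (auto simp: indicator_def)
  qed auto
  moreover have "(\<lambda>N. \<integral>\<omega>. indicator A \<omega> * ?c (?G N \<omega>) \<partial>P) \<longlonglongrightarrow> 0"
  proof (rule Lim_null_comparison)
    show "(\<lambda>N. 3 * (t - t0)\<^sup>2 / real (Suc N)) \<longlonglongrightarrow> 0"
      by (rule LIMSEQ_Suc) (rule lim_const_over_n)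
    have "norm (\<integral>\<omega>. indicator A \<omega> * ?c (?G N \<omega>) \<partial>P) \<le> 3 * (t - t0)\<^sup>2 / real (Suc N)" for N
    proof -
      let ?g = "\<lambda>j. t0 + real j * ((t - t0) / real (Suc N))"
      let ?S = "\<lambda>\<omega>. \<Sum>j<Suc N. (W (?g (Suc j)) \<omega> - W (?g j) \<omega>) ^ 4"
      have d: "0 < (t - t0) / real (Suc N)" using t by simp
      have g: "0 \<le> ?g j" "?g j < ?g (Suc j)" for j
        using grid_step[OF d, of t0 j] t by linarith+
      have gd: "?g (Suc j) - ?g j = (t - t0) / real (Suc N)" for j by (simp add: algebra_simps add_divide_distrib diff_divide_distrib)
      have iS: "integrable P ?S"
        by (rule Bochner_Integration.integrable_sum) (rule integrable_increment4[OF g])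
      have iG: "integrable P (\<lambda>\<omega>. indicator A \<omega> * ?G N \<omega>)"
        by (rule grid_sum_mean_0[OF C t A]) simp
      have ic: "integrable P (\<lambda>\<omega>. indicator A \<omega> * ?c (?G N \<omega>))"
        by (rule integrable_const_bound[where B = "2 * K + 1"])
          (use K in \<open>auto simp: indicator_def\<close>)
      \<comment> \<open>The untruncated grid sum has mean 0 on \<open>A\<close>, so up to sign the
        mean of the truncated one is that of the truncation error.\<close>
      have "norm (\<integral>\<omega>. indicator A \<omega> * ?c (?G N \<omega>) \<partial>P) =
          norm (\<integral>\<omega>. indicator A \<omega> * ?G N \<omega> - indicator A \<omega> * ?c (?G N \<omega>) \<partial>P)"
        using grid_sum_mean_0(2)[OF C t A, of "Suc N"] iG ic by (simp del: of_nat_Suc)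
      also have "\<dots> \<le> (\<integral>\<omega>. norm (indicator A \<omega> * ?G N \<omega> - indicator A \<omega> * ?c (?G N \<omega>)) \<partial>P)"
        by (rule integral_norm_bound)
      also have "\<dots> \<le> (\<integral>\<omega>. ?S \<omega> \<partial>P)"
      proof (rule integral_mono)
        fix \<omega> assume \<omega>: "\<omega> \<in> space P"
        have "norm (indicator A \<omega> * ?G N \<omega> - indicator A \<omega> * ?c (?G N \<omega>)) \<le> \<bar>?G N \<omega> - ?c (?G N \<omega>)\<bar>"
          by (auto simp: indicator_def)
        also have "\<dots> \<le> ?S \<omega>"
          by (rule based_path.grid_sum_bound[OF based_path[OF \<omega>] C(1) K(1) t(1) t' _ K(2)]) auto
        finally show "norm (indicator A \<omega> * ?G N \<omega> - indicator A \<omega> * ?c (?G N \<omega>)) \<le> ?S \<omega>" .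
      qed (intro integrable_norm Bochner_Integration.integrable_diff iG ic iS)+
      also have "\<dots> = (\<Sum>j<Suc N. 3 * ((t - t0) / real (Suc N))\<^sup>2)"
        using integrable_increment4[OF g] moment4_increment[OF g] gd
        by (simp only: Bochner_Integration.integral_sum)
      also have "\<dots> = 3 * (t - t0)\<^sup>2 / real (Suc N)"
        by (simp add: power2_eq_square)
      finally show ?thesis .
    qed
    then show "eventually (\<lambda>N. norm (\<integral>\<omega>. indicator A \<omega> * ?c (?G N \<omega>) \<partial>P) \<le> 3 * (t - t0)\<^sup>2 / real (Suc N)) sequentially"
      by simp
  qed
  ultimately show ?thesis by (rule LIMSEQ_unique)
qed

end

section \<open>Hitting times of sets that confine the path to a bounded interval\<close>

context brownian
begin

text \<open>The density of \<open>W t\<close> is at most \<open>1 / sqrt t\<close>. Letting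
  \<open>t\<close> grow shows that bounded intervals are left almost surely.\<close>

lemma prob_bounded_le:
  assumes t: "0 < t" and K: "0 \<le> K"
  shows "prob {\<omega> \<in> space P. \<bar>W t \<omega>\<bar> \<le> K} \<le> 2 * K / sqrt t"
proof -
  have D: "distributed P lborel (\<lambda>\<omega>. W t \<omega> - W 0 \<omega>) (normal_density 0 (sqrt (t - 0)))"
    using t by (intro increment_distributed) auto
  have "{\<omega> \<in> space P. \<bar>W t \<omega>\<bar> \<le> K} = (\<lambda>\<omega>. W t \<omega> - W 0 \<omega>) -` {- K..K} \<inter> space P"
    using W_0 by auto
  then have "emeasure P {\<omega> \<in> space P. \<bar>W t \<omega>\<bar> \<le> K} =
      (\<integral>\<^sup>+x. ennreal (normal_density 0 (sqrt (t - 0)) x) * indicator {- K..K} x \<partial>lborel)"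
    using distributed_emeasure[OF D, of "{- K..K}"] by simp
  also have "\<dots> \<le> (\<integral>\<^sup>+x. ennreal (1 / sqrt t) * indicator {- K..K} x \<partial>lborel)"
  proof (intro nn_integral_mono mult_right_mono ennreal_leI)
    fix x
    have "t \<le> 2 * pi * t" using pi_ge_two t mult_right_mono[of 1 "2 * pi" t] by simp
    then have "1 / sqrt (2 * pi * (sqrt (t - 0))\<^sup>2) \<le> 1 / sqrt t"
      using t by (intro divide_left_mono) auto
    moreover have "exp (- (x - 0)\<^sup>2 / (2 * (sqrt (t - 0))\<^sup>2)) \<le> 1" by simp
    ultimately have "1 / sqrt (2 * pi * (sqrt (t - 0))\<^sup>2) * exp (- (x - 0)\<^sup>2 / (2 * (sqrt (t - 0))\<^sup>2)) \<le> 1 / sqrt t * 1"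
      using t by (intro mult_mono) auto
    then show "normal_density 0 (sqrt (t - 0)) x \<le> 1 / sqrt t" by (simp add: normal_density_def)
  qed auto
  also have "\<dots> = ennreal (1 / sqrt t) * ennreal (2 * K)"
    using K by (simp add: nn_integral_cmult_indicator emeasure_lborel_Icc_eq)
  also have "\<dots> = ennreal (2 * K / sqrt t)"
    using K t by (simp add: ennreal_mult[symmetric])
  finally show ?thesis using K t by (simp add: emeasure_eq_measure)
qed

lemma sets_hits:
  assumes C: "closed C" "C \<noteq> {}"
  shows "{\<omega> \<in> space P. hits C \<omega>} \<in> sets P"
proof -
  have eq: "{\<omega> \<in> space P. hits C \<omega>} = (\<Union>n. {\<omega> \<in> space P. hit_by C (real n) \<omega>})"
  proof safe
    fix \<omega> assume \<omega>: "\<omega> \<in> space P" "hits C \<omega>"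
    interpret f: based_path "\<lambda>u. W u \<omega>" by (rule based_path[OF \<omega>(1)])
    obtain t where t: "f.hit_by C t" using \<omega> f.hits_iff by blast
    obtain n where "t \<le> real n" using real_arch_simple by blast
    then show "\<omega> \<in> (\<Union>n. {\<omega> \<in> space P. hit_by C (real n) \<omega>})"
      using f.hit_by_mono[OF t] \<omega> by blast
  qed (use based_path.hits_iff[OF based_path] in blast)
  show ?thesis unfolding eq
    using sets_hit_by[OF C _ order_refl, THEN Fil_sets] by (intro sets.countable_UN) auto
qed

text \<open>The value 0 on paths that never hit agrees with the default \<open>W 0 \<omega>\<close>
  of \<open>azema_yor_process\<close> at time \<open>T\<close>.\<close>

definition stop_value :: "(real \<times> real) set \<Rightarrow> 'a \<Rightarrow> real" where
  "stop_value C \<omega> = (if hits C \<omega> then hit_value C \<omega> else 0)"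

lemma stopped_eventually:
  assumes C: "closed C" and \<omega>: "\<omega> \<in> space P" "hits C \<omega>"
  shows "eventually (\<lambda>n. hit_by C (real n) \<omega> \<and> stop_time C (real n) \<omega> = based_path.hit_time (\<lambda>u. W u \<omega>) C) sequentially"
proof -
  interpret f: based_path "\<lambda>u. W u \<omega>" by (rule based_path[OF \<omega>(1)])
  obtain t where t: "f.hit_by C t" using \<omega> f.hits_iff by blast
  have "eventually (\<lambda>n. t \<le> real n) sequentially" by (rule eventually_nat_ge_real)
  then show ?thesis
    by eventually_elim (use t f.hit_by_mono in \<open>auto simp: f.stop_time_def\<close>)
qed

lemma measurable_stop_value:
  assumes C: "closed C" "C \<noteq> {}"
  shows "stop_value C \<in> borel_measurable P"
proof (rule borel_measurable_LIMSEQ_real)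
  show "(\<lambda>n. stopped C (real n) \<omega> * indicator {\<omega> \<in> space P. hits C \<omega>} \<omega>) \<longlonglongrightarrow> stop_value C \<omega>" if "\<omega> \<in> space P" for \<omega>
  proof (cases "hits C \<omega>")
    case True
    then have "eventually (\<lambda>n. stopped C (real n) \<omega> * indicator {\<omega> \<in> space P. hits C \<omega>} \<omega> = stop_value C \<omega>) sequentially"
      using stopped_eventually[OF C(1) that] that by (auto elim!: eventually_mono simp: stop_value_def)
    then show ?thesis by (rule tendsto_eventually)
  qed (simp add: stop_value_def)
  show "(\<lambda>\<omega>. stopped C (real n) \<omega> * indicator {\<omega> \<in> space P. hits C \<omega>} \<omega>) \<in> borel_measurable P" for n
    by (intro borel_measurable_times borel_measurable_indicator sets_hits[OF C]
        measurable_from_subalg[OF subalgebra_Fil measurable_stopped_0[OF C]]) simp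
qed

lemma AE_hits_bounded:
  assumes C: "closed C" "C \<noteq> {}" and K: "\<And>w s. w \<le> s \<Longrightarrow> (w, s) \<notin> C \<Longrightarrow> \<bar>w\<bar> \<le> K" "0 \<le> K"
  shows "AE \<omega> in P. hits C \<omega>"
proof -
  let ?N = "space P - {\<omega> \<in> space P. hits C \<omega>}"
  have "prob ?N \<le> 2 * K / sqrt (real (Suc n))" for n
  proof -
    have "\<bar>W (real (Suc n)) \<omega>\<bar> \<le> K" if "\<omega> \<in> ?N" for \<omega>
    proof -
      interpret f: based_path "\<lambda>u. W u \<omega>" using that by (intro based_path) auto
      have "\<not> f.hits C" using that by simp
      then have "f.pos (real (Suc n)) \<notin> C" unfolding f.hits_def by (metis of_nat_0_le_iff)
      then show ?thesis using K(1)[OF path_max_ge[OF f.cont, of "real (Suc n)" "real (Suc n)"]] by (simp add: f.pos_def)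
    qed
    then have "prob ?N \<le> prob {\<omega> \<in> space P. \<bar>W (real (Suc n)) \<omega>\<bar> \<le> K}"
      by (intro finite_measure_mono) (auto intro!: measurable_sets_Collect[OF measurable_W])
    also have "\<dots> \<le> 2 * K / sqrt (real (Suc n))" using K by (intro prob_bounded_le) auto
    finally show ?thesis .
  qed
  moreover have "(\<lambda>n. 2 * K / sqrt (real (Suc n))) \<longlonglongrightarrow> 0" 
  proof (rule tendsto_divide_0[OF tendsto_const filterlim_at_top_imp_at_infinity])
    show "filterlim (\<lambda>n. sqrt (real (Suc n))) at_top sequentially"
      by (rule filterlim_compose[OF sqrt_at_top filterlim_real_Suc])
  qed
  ultimately show ?thesis by (rule AE_of_prob_bound[OF sets_hits[OF C]])
qed

lemma not_hit_sets:
  assumes C: "closed C" "C \<noteq> {}" and t: "0 \<le> t0" and A: "A \<in> sets (Fil t0)"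
  shows "{\<omega> \<in> A. \<not> hit_by C t0 \<omega>} \<in> sets (Fil t0)"
proof -
  have "{\<omega> \<in> A. \<not> hit_by C t0 \<omega>} = A - {\<omega> \<in> space P. hit_by C t0 \<omega>}"
    using sets.sets_into_space[OF A] by auto
  then show ?thesis using A sets_hit_by[OF C t order_refl] by auto
qed

text \<open>The limit of \<open>optional_stopping_bounded\<close> for large times, dominated by
  \<open>2 * K\<close>. Restricting to paths not stopped by \<open>t0\<close> gives the conditional
  form from which the martingale property of the stopped path is obtained.\<close>

lemma optional_stopping_hit:
  assumes C: "closed C" "C \<noteq> {}" and K: "\<And>w s. w \<le> s \<Longrightarrow> (w, s) \<notin> C \<Longrightarrow> \<bar>w\<bar> \<le> K" "0 \<le> K"
    and t: "0 \<le> t0" and A: "A \<in> sets (Fil t0)"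
  shows "(\<integral>\<omega>. indicator {\<omega> \<in> A. \<not> hit_by C t0 \<omega>} \<omega> * (stop_value C \<omega> - W t0 \<omega>) \<partial>P) = 0"
proof -
  let ?A = "{\<omega> \<in> A. \<not> hit_by C t0 \<omega>}"
  have A': "?A \<in> sets (Fil t0)" by (rule not_hit_sets[OF C t A])
  note [measurable] = Fil_sets[OF A'] measurable_stop_value[OF C] measurable_W[OF t]
  have AE_hits: "AE \<omega> in P. hits C \<omega>" by (rule AE_hits_bounded[OF C]) (use K in auto)
  let ?t = "\<lambda>n. t0 + real (Suc n)"
  let ?Y = "\<lambda>n \<omega>. W (max t0 (stop_time C (?t n) \<omega>)) \<omega> - W t0 \<omega>"
  have "(\<lambda>n. \<integral>\<omega>. indicator ?A \<omega> * ?Y n \<omega> \<partial>P) \<longlonglongrightarrow> (\<integral>\<omega>. indicator ?A \<omega> * (stop_value C \<omega> - W t0 \<omega>) \<partial>P)"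
  proof (rule integral_dominated_convergence[where w = "\<lambda>_. 2 * K"])
    show "AE \<omega> in P. (\<lambda>n. indicator ?A \<omega> * ?Y n \<omega>) \<longlonglongrightarrow> indicator ?A \<omega> * (stop_value C \<omega> - W t0 \<omega>)"
      using AE_hits AE_space
    proof eventually_elim
      case (elim \<omega>)
      interpret f: based_path "\<lambda>u. W u \<omega>" using elim by (intro based_path) auto
      obtain s where s: "f.hit_by C s" using elim f.hits_iff by blast
      have "eventually (\<lambda>n. s \<le> real n) sequentially" by (rule eventually_nat_ge_real)
      then have "eventually (\<lambda>n. indicator ?A \<omega> * ?Y n \<omega> = indicator ?A \<omega> * (stop_value C \<omega> - W t0 \<omega>)) sequentially"
      proof eventually_elim
        case (elim n)
        have hn: "f.hit_by C (?t n)" using f.hit_by_mono[OF s] elim t by simp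
        show ?case
        proof (cases "\<omega> \<in> ?A")
          case True
          then have "t0 < f.stop_time C (?t n)" using f.not_hit_by_iff[OF C(1) hn t] by auto
          then show ?thesis using hn \<open>f.hits C\<close> by (simp add: stop_value_def f.stop_time_def)
        qed simp
      qed
      then show ?case by (rule tendsto_eventually)
    qed
    show "AE \<omega> in P. norm (indicator ?A \<omega> * ?Y n \<omega>) \<le> 2 * K" for n
    proof (rule AE_I2)
      fix \<omega> assume \<omega>: "\<omega> \<in> space P"
      interpret f: based_path "\<lambda>u. W u \<omega>" by (rule based_path[OF \<omega>])
      show "norm (indicator ?A \<omega> * ?Y n \<omega>) \<le> 2 * K"
      proof (cases "\<omega> \<in> ?A")
        case True
        then have nh: "\<not> f.hit_by C t0" by simp
        have "t0 < f.stop_time C (?t n)"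
          using f.not_hit_by_iff[OF C(1) _ t, of "?t n"] nh by (cases "f.hit_by C (?t n)") (auto simp: f.stop_time_def)
        moreover have "w \<in> {- K..K}" if "w \<le> s" "(w, s) \<notin> C" for w s using K(1)[OF that] by auto
        ultimately have "W (f.stop_time C (?t n)) \<omega> \<in> {- K..K}"
          using t by (intro f.stop_in_closed[OF C(1)]) auto
        moreover have "f.pos t0 \<notin> C" using nh t by (auto simp: f.hit_by_def)
        then have "\<bar>W t0 \<omega>\<bar> \<le> K" using K(1)[OF path_max_ge[OF f.cont t order_refl]] by (simp add: f.pos_def)
        ultimately show ?thesis using True \<open>t0 < _\<close> by (auto simp: max_def)
      qed (use K in simp)
    qed
    show "(\<lambda>\<omega>. indicator ?A \<omega> * ?Y n \<omega>) \<in> borel_measurable P" for n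
      by (intro borel_measurable_times borel_measurable_indicator Fil_sets[OF A']
          measurable_from_subalg[OF subalgebra_Fil measurable_stopped[OF C t]]) simp
  qed (use K in auto)
  moreover have "(\<integral>\<omega>. indicator ?A \<omega> * ?Y n \<omega> \<partial>P) = 0" for n
    using t by (intro optional_stopping_bounded[OF C K _ _ A']) auto
  ultimately show ?thesis by (simp add: LIMSEQ_const_iff)
qed

text \<open>As \<open>(0, 0)\<close> is outside \<open>C\<close>, a hitting time is positive and
  there are earlier times at which the path lies in \<open>V\<close>. The same assumption puts the
  default value 0 into \<open>V\<close>.\<close>

lemma stop_value_in_closed:
  assumes C: "closed C" and V: "closed V" "\<And>w s. w \<le> s \<Longrightarrow> (w, s) \<notin> C \<Longrightarrow> w \<in> V" and 0: "(0, 0) \<notin> C"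
    and \<omega>: "\<omega> \<in> space P"
  shows "stop_value C \<omega> \<in> V"
proof -
  interpret f: based_path "\<lambda>u. W u \<omega>" by (rule based_path[OF \<omega>])
  show ?thesis
  proof (cases "f.hits C")
    case True
    have "f.hit_time C \<noteq> 0" using f.hit_time_props(2)[OF C True] 0 by auto
    then have "0 < f.hit_time C" using f.hit_time_props(1)[OF C True] by simp
    from f.hit_in_closed[OF C V True this] show ?thesis using True by (simp add: stop_value_def)
  qed (use V(2)[of 0 0] 0 in \<open>simp add: stop_value_def\<close>)
qed

lemma stop_value_bounded:
  assumes C: "closed C" "C \<noteq> {}" and K: "\<And>w s. w \<le> s \<Longrightarrow> (w, s) \<notin> C \<Longrightarrow> \<bar>w\<bar> \<le> K" "0 \<le> K" and 0: "(0, 0) \<notin> C"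
  shows "integrable P (stop_value C)" "(\<integral>\<omega>. stop_value C \<omega> \<partial>P) = 0"
proof -
  have "\<bar>stop_value C \<omega>\<bar> \<le> K" if "\<omega> \<in> space P" for \<omega>
  proof -
    have "w \<in> {- K..K}" if "w \<le> s" "(w, s) \<notin> C" for w s using K(1)[OF that] by auto
    then have "stop_value C \<omega> \<in> {- K..K}" by (intro stop_value_in_closed[OF C(1) _ _ 0 that]) auto
    then show ?thesis by auto
  qed
  then show i: "integrable P (stop_value C)"
    by (intro integrable_const_bound[where B = K] measurable_stop_value[OF C] AE_I2) auto
  have "\<not> hit_by C 0 \<omega>" if "\<omega> \<in> space P" for \<omega>
    using based_path.hit_by_def[OF based_path[OF that]] based_path.pos_0[OF based_path[OF that]] 0 by auto
  then have "(\<integral>\<omega>. stop_value C \<omega> \<partial>P) = (\<integral>\<omega>. indicator {\<omega> \<in> space P. \<not> hit_by C 0 \<omega>} \<omega> * (stop_value C \<omega> - W 0 \<omega>) \<partial>P)"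
    using W_0 by (intro Bochner_Integration.integral_cong) auto
  also have "\<dots> = 0"
    using sets.top[of "Fil 0"] by (intro optional_stopping_hit[OF C K]) auto
  finally show "(\<integral>\<omega>. stop_value C \<omega> \<partial>P) = 0" .
qed

end

section \<open>Stopping sets that confine the path from above only\<close>

context azema_yor_path
begin

text \<open>Just before the path drops to \<open>- a\<close> it has not been stopped, so its maximum is then at most
  \<open>b (- a) < c\<close>: the level \<open>- a\<close> is reached before \<open>c\<close>.\<close>

lemma lower_exit:
  assumes C: "closed C" "ay_region b \<subseteq> C" and a: "0 < a" and c: "b (- a) < c"
  defines "Ca \<equiv> C \<union> {(x, y). x \<le> - a}" and "D \<equiv> {(x, y). x \<le> - a \<or> c \<le> y}"
  assumes h: "hits Ca" and low: "f (hit_time Ca) \<le> - a"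
  shows "hits D" "hit_time D = hit_time Ca"
proof -
  let ?\<rho> = "hit_time Ca"
  have "closed ({..- a} \<times> (UNIV :: real set))" by (intro closed_Times) auto
  moreover have "{(x, y). x \<le> - a} = {..- a} \<times> (UNIV :: real set)" by auto
  ultimately have Ca: "closed Ca" using C unfolding Ca_def by (simp add: closed_Un)
  note hp = hit_time_props[OF Ca h]
  have D\<rho>: "pos ?\<rho> \<in> D" using low by (simp add: D_def pos_def)
  then show "hits D" using hp(1) unfolding hits_def by blast
  have "?\<rho> \<noteq> 0" using low a by auto
  then have pos: "0 < ?\<rho>" using hp(1) by simp
  have "b (f ?\<rho>) < c" using c monoD[OF mono_b low] by simp
  then have "eventually (\<lambda>x. b x < c) (at (f ?\<rho>))"
    using cont_b by (intro order_tendstoD) (auto simp: continuous_on_eq_continuous_at isCont_def)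
  \<comment> \<open>The time \<open>u\<close> chosen next is only close to the stopping time, so the
    path may be slightly higher there; the margin \<open>e\<close> keeps \<open>b\<close> below
    \<open>c\<close> all the same.\<close>
  then obtain e where e: "e > 0" "\<And>x. x \<noteq> f ?\<rho> \<Longrightarrow> \<bar>x - f ?\<rho>\<bar> < e \<Longrightarrow> b x < c"
    by (auto simp: eventually_at dist_real_def)
  have "f ?\<rho> < path_max f ?\<rho>" using low a path_max_nonneg[OF hp(1)] by simp
  from path_max_const_before[OF pos this, of "f ?\<rho> + e / 2"] e(1)
  obtain u where u: "0 \<le> u" "u < ?\<rho>" "path_max f u = path_max f ?\<rho>" "f u < f ?\<rho> + e / 2" by auto
  have "pos u \<notin> C" using hp(3)[OF u(1,2)] by (simp add: Ca_def)
  then have "pos u \<notin> ay_region b" using C(2) by blast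
  then have "path_max f u < b (f u)" by (simp add: ay_region_def pos_def)
  also have "\<dots> \<le> b (f ?\<rho> + e / 2)" using u(4) by (intro monoD[OF mono_b]) simp
  also have "\<dots> < c" using e by simp
  finally have small: "path_max f ?\<rho> < c" using u(3) by simp
  show "hit_time D = ?\<rho>"
  proof (rule hit_time_eqI[OF hp(1) D\<rho>])
    fix v assume v: "0 \<le> v" "v < ?\<rho>"
    have "path_max f v \<le> path_max f ?\<rho>" using v by (intro path_max_mono[OF cont]) auto
    then show "pos v \<notin> D" using hp(3)[OF v] small by (auto simp: D_def Ca_def pos_def)
  qed
qed

end

locale ay_brownian = brownian P W for P :: "'a measure" and W +
  fixes b :: "real \<Rightarrow> real"
  assumes cont_b: "continuous_on UNIV b" and mono_b: "mono b" and b_ge: "k \<le> b k" and b_0: "0 < b 0"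
    and b_nonneg: "0 \<le> b k" and b_at_bot: "(b \<longlongrightarrow> 0) at_bot"
begin

lemma ay_path: "\<omega> \<in> space P \<Longrightarrow> azema_yor_path (\<lambda>u. W u \<omega>) b"
  by (auto simp: azema_yor_path_def azema_yor_path_axioms_def based_path cont_b mono_b b_ge b_0)

context
  fixes C :: "(real \<times> real) set" and s :: real
  assumes C: "closed C" "ay_region b \<subseteq> C" and C_0: "(0, 0) \<notin> C"
    and upper: "\<And>x y. x \<le> y \<Longrightarrow> (x, y) \<notin> C \<Longrightarrow> x \<le> s" and s: "0 \<le> s"
begin

text \<open>A barrier at \<open>- a\<close> confines the path to a bounded interval until stopping.
  It is removed by letting \<open>a\<close> tend to infinity.\<close>

definition lower :: "real \<Rightarrow> (real \<times> real) set" where "lower a = C \<union> {(x, y). x \<le> - a}"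

lemma closed_left: "closed {(x, y :: real). x \<le> - (a :: real)}"
proof -
  have "{(x, y). x \<le> - a} = {..- a} \<times> (UNIV :: real set)" by auto
  then show ?thesis by (simp add: closed_Times)
qed

lemma C_ne: "C \<noteq> {}"
  using C(2) by (auto simp: ay_region_def)

lemma lower: "closed (lower a)" "lower a \<noteq> {}" "0 < a \<Longrightarrow> (0, 0) \<notin> lower a"
  using C C_0 C_ne closed_left by (auto simp: lower_def intro: closed_Un)

lemma lower_bound:
  assumes "0 < a" "x \<le> y" "(x, y) \<notin> lower a"
  shows "\<bar>x\<bar> \<le> max a s"
  using assms upper[of x y] by (auto simp: lower_def)

lemma stop_value_lower:
  assumes a: "0 < a"
  shows "integrable P (stop_value (lower a))" "(\<integral>\<omega>. stop_value (lower a) \<omega> \<partial>P) = 0" "AE \<omega> in P. hits (lower a) \<omega>"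
    "\<And>\<omega>. \<omega> \<in> space P \<Longrightarrow> - a \<le> stop_value (lower a) \<omega> \<and> stop_value (lower a) \<omega> \<le> s"
proof -
  have K: "0 \<le> max a s" using a by simp
  show "integrable P (stop_value (lower a))" "(\<integral>\<omega>. stop_value (lower a) \<omega> \<partial>P) = 0"
    by (rule stop_value_bounded[OF lower(1,2) lower_bound[OF a] K lower(3)[OF a]]; assumption)+
  show "AE \<omega> in P. hits (lower a) \<omega>"
    by (rule AE_hits_bounded[OF lower(1,2) lower_bound[OF a] K]; assumption)
  fix \<omega> assume \<omega>: "\<omega> \<in> space P"
  have "w \<in> {- a..s}" if "w \<le> y" "(w, y) \<notin> lower a" for w y
    using that upper[of w y] by (auto simp: lower_def)
  then have "stop_value (lower a) \<omega> \<in> {- a..s}"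
    by (intro stop_value_in_closed[OF lower(1) _ _ lower(3)[OF a] \<omega>]) auto
  then show "- a \<le> stop_value (lower a) \<omega> \<and> stop_value (lower a) \<omega> \<le> s" by simp
qed

text \<open>By \<open>lower_exit\<close>, reaching the barrier means reaching \<open>- a\<close>
  before \<open>c\<close>; the value at this two-sided exit is at most \<open>c\<close> and has mean
  0. With \<open>c\<close> just above \<open>b (- a)\<close>, which tends to 0, even
  \<open>a\<close> times the probability vanishes in the limit.\<close>

lemma lower_prob:
  assumes a: "0 < a" and c: "b (- a) < c"
  shows "a * prob {\<omega> \<in> space P. hits (lower a) \<omega> \<and> stop_value (lower a) \<omega> \<le> - a} \<le> c"
proof -
  let ?D = "{(x, y). x \<le> - a \<or> c \<le> y}"
  let ?B = "{\<omega> \<in> space P. hits (lower a) \<omega> \<and> stop_value (lower a) \<omega> \<le> - a}"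
  have c0: "0 < c" using c b_nonneg[of "- a"] by simp
  have "closed {(x :: real, y). c \<le> y}"
  proof -
    have "{(x :: real, y). c \<le> y} = UNIV \<times> {c..}" by auto
    then show ?thesis by (simp add: closed_Times)
  qed
  moreover have "?D = {(x, y). x \<le> - a} \<union> {(x, y). c \<le> y}" by auto
  ultimately have D: "closed ?D" using closed_left by (simp only: closed_Un)
  have D_ne: "?D \<noteq> {}" by (auto intro: exI[of _ "- a"])
  have D0: "(0, 0) \<notin> ?D" using a c0 by simp
  have fin: "integrable P (stop_value ?D)" "(\<integral>\<omega>. stop_value ?D \<omega> \<partial>P) = 0"
    using a c0 by (rule_tac stop_value_bounded[OF D D_ne _ _ D0, where K = "max a c"]; force)+
  have le: "stop_value ?D \<omega> \<le> c" if "\<omega> \<in> space P" for \<omega>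
  proof -
    have "stop_value ?D \<omega> \<in> {..c}" by (rule stop_value_in_closed[OF D _ _ D0 that]) auto
    then show ?thesis by simp
  qed
  have [measurable]: "?B \<in> sets P"
    using sets_hits[OF lower(1,2)] measurable_stop_value[OF lower(1,2)] by measurable
  have B: "stop_value ?D \<omega> \<le> - a" if "\<omega> \<in> ?B" for \<omega>
  proof -
    have \<omega>: "\<omega> \<in> space P" using that by simp
    interpret f: azema_yor_path "\<lambda>u. W u \<omega>" b by (rule ay_path[OF \<omega>])
    have "f.hits (lower a)" "W (f.hit_time (lower a)) \<omega> \<le> - a" using that by (auto simp: stop_value_def)
    from f.lower_exit[OF C a c, folded lower_def, OF this]
    show ?thesis using \<open>W (f.hit_time (lower a)) \<omega> \<le> - a\<close> by (simp add: stop_value_def)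
  qed
  have "0 = (\<integral>\<omega>. stop_value ?D \<omega> \<partial>P)" using fin by simp
  also have "\<dots> \<le> (\<integral>\<omega>. c - a * indicator ?B \<omega> \<partial>P)"
  proof (rule integral_mono)
    fix \<omega> assume "\<omega> \<in> space P"
    then show "stop_value ?D \<omega> \<le> c - a * indicator ?B \<omega>"
      using le[of \<omega>] B[of \<omega>] c0 by (auto simp: indicator_def)
  qed (use fin in \<open>auto simp: emeasure_eq_measure\<close>)
  also have "\<dots> = c - a * prob ?B"
    by (subst Bochner_Integration.integral_diff) (auto simp: emeasure_eq_measure prob_space)
  finally show ?thesis by simp
qed

lemma stop_value_lower_eq:
  assumes "\<omega> \<in> space P" "hits (lower a) \<omega>" "\<not> stop_value (lower a) \<omega> \<le> - a"
  shows "hits C \<omega>" "stop_value C \<omega> = stop_value (lower a) \<omega>"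
proof -
  interpret f: azema_yor_path "\<lambda>u. W u \<omega>" b by (rule ay_path[OF assms(1)])
  note hp = f.hit_time_props[OF lower(1) assms(2)]
  have "W (f.hit_time (lower a)) \<omega> > - a" using assms by (simp add: stop_value_def)
  then have "f.pos (f.hit_time (lower a)) \<in> C" using hp(2) by (auto simp: lower_def f.pos_def)
  moreover from this show h: "f.hits C" using hp(1) unfolding f.hits_def by blast
  ultimately have "f.hit_time C = f.hit_time (lower a)"
    using hp(1,3) by (intro f.hit_time_eqI) (auto simp: lower_def)
  then show "stop_value C \<omega> = stop_value (lower a) \<omega>" using h assms by (simp add: stop_value_def)
qed

text \<open>Up to its hitting time the path has a minimum, and barriers below this minimum are not
  met.\<close>

lemma stop_value_lower_eventually:
  assumes \<omega>: "\<omega> \<in> space P" "hits C \<omega>"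
  shows "eventually (\<lambda>n. hits (lower (real (Suc n))) \<omega> \<and> stop_value (lower (real (Suc n))) \<omega> = stop_value C \<omega>
    \<and> \<not> stop_value (lower (real (Suc n))) \<omega> \<le> - real (Suc n)) sequentially"
proof -
  interpret f: azema_yor_path "\<lambda>u. W u \<omega>" b by (rule ay_path[OF \<omega>(1)])
  note hp = f.hit_time_props[OF C(1) \<omega>(2)]
  have "continuous_on {0..f.hit_time C} (\<lambda>u. W u \<omega>)"
    using f.cont continuous_on_subset by fastforce
  then obtain m where m: "\<And>u. u \<in> {0..f.hit_time C} \<Longrightarrow> m \<le> W u \<omega>"
    using continuous_attains_inf[of "{0..f.hit_time C}" "\<lambda>u. W u \<omega>"] hp(1) by fastforce
  have "eventually (\<lambda>n. 1 - m \<le> real n) sequentially" by (rule eventually_nat_ge_real)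
  then show ?thesis
  proof eventually_elim
    case (elim n)
    have big: "- real (Suc n) < W u \<omega>" if "u \<in> {0..f.hit_time C}" for u
      using m[OF that] elim by simp
    have in_l: "f.pos (f.hit_time C) \<in> lower (real (Suc n))" using hp(2) by (simp add: lower_def)
    then have h: "f.hits (lower (real (Suc n)))" using hp(1) unfolding f.hits_def by blast
    have "f.hit_time (lower (real (Suc n))) = f.hit_time C"
    proof (rule f.hit_time_eqI[OF hp(1) in_l])
      fix u assume u: "0 \<le> u" "u < f.hit_time C"
      then show "f.pos u \<notin> lower (real (Suc n))"
        using hp(3)[OF u] big[of u] by (auto simp: lower_def f.pos_def)
    qed
    then show ?case using h \<omega> big[of "f.hit_time C"] hp(1) by (simp add: stop_value_def)
  qed
qed

text \<open>Almost every path that never hits \<open>C\<close> is stopped at the barrier, for every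
  \<open>a\<close>. The crude choice \<open>c = b (- a) + 1\<close> in \<open>lower_prob\<close>
  suffices, as \<open>c\<close> is then divided by \<open>a\<close>.\<close>

lemma AE_hits_C: "AE \<omega> in P. hits C \<omega>"
proof -
  let ?N = "space P - {\<omega> \<in> space P. hits C \<omega>}"
  have [measurable]: "?N \<in> sets P" using sets_hits[OF C(1) C_ne] by (rule sets.compl_sets)
  have "prob ?N \<le> (b (- real (Suc n)) + 1) / real (Suc n)" for n
  proof -
    let ?a = "real (Suc n)"
    let ?B = "{\<omega> \<in> space P. hits (lower ?a) \<omega> \<and> stop_value (lower ?a) \<omega> \<le> - ?a}"
    have a: "0 < ?a" by simp
    have [measurable]: "?B \<in> sets P"
      using sets_hits[OF lower(1,2)] measurable_stop_value[OF lower(1,2)] by measurable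
    have "AE \<omega> in P. \<omega> \<in> ?N \<longrightarrow> \<omega> \<in> ?B"
      using stop_value_lower(3)[OF a] AE_space by eventually_elim (use stop_value_lower_eq(1)[of _ ?a] in blast)
    then have "prob ?N \<le> prob ?B" by (rule finite_measure_mono_AE) measurable
    also have "\<dots> \<le> (b (- ?a) + 1) / ?a"
      using lower_prob[OF a, of "b (- ?a) + 1"] a by (simp add: field_simps)
    finally show ?thesis .
  qed
  moreover have "(\<lambda>n. (b (- real (Suc n)) + 1) / real (Suc n)) \<longlonglongrightarrow> 0"
  proof -
    have "(\<lambda>n. b (- real (Suc n)) + 1) \<longlonglongrightarrow> 0 + 1"
      by (intro tendsto_intros filterlim_compose[OF b_at_bot] filterlim_compose[OF filterlim_uminus_at_bot_at_top]
          filterlim_real_Suc)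
    then show ?thesis
      by (rule tendsto_divide_0[OF _ filterlim_at_top_imp_at_infinity])
        (rule filterlim_real_Suc)
  qed
  ultimately show ?thesis by (rule AE_of_prob_bound[OF sets_hits[OF C(1) C_ne]])
qed

lemma AE_stop_value_lower_eventually:
  "AE \<omega> in P. eventually (\<lambda>n. hits (lower (real (Suc n))) \<omega> \<and> stop_value (lower (real (Suc n))) \<omega> = stop_value C \<omega>
    \<and> \<not> stop_value (lower (real (Suc n))) \<omega> \<le> - real (Suc n)) sequentially"
  using AE_hits_C AE_space by eventually_elim (rule stop_value_lower_eventually)

text \<open>With the barrier in place the value \<open>x\<close> has mean 0 and is at most
  \<open>s\<close>, so that \<open>\<bar>x\<bar> \<le> 2 * s - x\<close> bounds its first absolute
  moment by \<open>2 * s\<close>. Fatou's lemma carries the bound to the limit.\<close>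

lemma integrable_stop_value_C: "integrable P (stop_value C)"
proof (rule integrableI_bounded)
  show "stop_value C \<in> borel_measurable P" by (rule measurable_stop_value[OF C(1) C_ne])
  have meas: "stop_value (lower a) \<in> borel_measurable P" for a by (rule measurable_stop_value[OF lower(1,2)])
  have bound: "(\<integral>\<^sup>+\<omega>. ennreal (norm (stop_value (lower (real (Suc n))) \<omega>)) \<partial>P) \<le> ennreal (2 * s)" for n
  proof -
    have a: "0 < real (Suc n)" by simp
    note fl = stop_value_lower[OF a]
    have "(\<integral>\<omega>. norm (stop_value (lower (real (Suc n))) \<omega>) \<partial>P) \<le> (\<integral>\<omega>. 2 * s - stop_value (lower (real (Suc n))) \<omega> \<partial>P)"
    proof (rule integral_mono)
      fix \<omega> assume "\<omega> \<in> space P"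
      then show "norm (stop_value (lower (real (Suc n))) \<omega>) \<le> 2 * s - stop_value (lower (real (Suc n))) \<omega>"
        using fl(4)[of \<omega>] s by auto
    qed (use fl(1) in auto)
    also have "\<dots> = 2 * s" using fl(1,2) prob_space by simp
    finally show ?thesis
      using fl(1) by (subst nn_integral_eq_integral) (auto intro: ennreal_leI)
  qed
  have "(\<integral>\<^sup>+\<omega>. ennreal (norm (stop_value C \<omega>)) \<partial>P) =
      (\<integral>\<^sup>+\<omega>. liminf (\<lambda>n. ennreal (norm (stop_value (lower (real (Suc n))) \<omega>))) \<partial>P)"
  proof (rule nn_integral_cong_AE)
    show "AE \<omega> in P. ennreal (norm (stop_value C \<omega>)) = liminf (\<lambda>n. ennreal (norm (stop_value (lower (real (Suc n))) \<omega>)))"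
      using AE_stop_value_lower_eventually
    proof eventually_elim
      case (elim \<omega>)
      then have "eventually (\<lambda>n. ennreal (norm (stop_value (lower (real (Suc n))) \<omega>)) = ennreal (norm (stop_value C \<omega>))) sequentially"
        by eventually_elim simp
      then have "(\<lambda>n. ennreal (norm (stop_value (lower (real (Suc n))) \<omega>))) \<longlonglongrightarrow> ennreal (norm (stop_value C \<omega>))"
        by (rule tendsto_eventually)
      then show ?case by (intro lim_imp_Liminf[symmetric]) simp
    qed
  qed
  also have "\<dots> \<le> liminf (\<lambda>n. \<integral>\<^sup>+\<omega>. ennreal (norm (stop_value (lower (real (Suc n))) \<omega>)) \<partial>P)"
    by (intro nn_integral_liminf) (use meas in measurable)
  also have "\<dots> \<le> ennreal (2 * s)"
    using bound by (intro Liminf_le) auto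
  also have "\<dots> < \<infinity>" by simp
  finally show "(\<integral>\<^sup>+\<omega>. ennreal (norm (stop_value C \<omega>)) \<partial>P) < \<infinity>" .
qed

text \<open>The barrier matters only on paths that reach it, where the stopped value is
  \<open>- a\<close>. The error is at most \<open>a\<close> times their probability plus the mean of
  \<open>\<bar>W t0\<bar>\<close> over them, and both tend to 0.\<close>

lemma optional_stopping_unbounded_below:
  assumes t: "0 \<le> t0" and A: "A \<in> sets (Fil t0)"
  shows "(\<integral>\<omega>. indicator {\<omega> \<in> A. \<not> hit_by C t0 \<omega>} \<omega> * (stop_value C \<omega> - W t0 \<omega>) \<partial>P) = 0"
proof -
  let ?a = "\<lambda>n. real (Suc n)"
  let ?A = "\<lambda>D. {\<omega> \<in> A. \<not> hit_by D t0 \<omega>}"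
  let ?B = "\<lambda>n. {\<omega> \<in> space P. hits (lower (?a n)) \<omega> \<and> stop_value (lower (?a n)) \<omega> \<le> - ?a n}"
  let ?Z = "\<lambda>n \<omega>. indicator (?A (lower (?a n))) \<omega> * (indicator (- ?B n) \<omega> * (stop_value C \<omega> - W t0 \<omega>))"
  have a: "0 < ?a n" for n by simp
  have K: "0 \<le> max (?a n) s" for n by simp
  note [measurable] = measurable_stop_value[OF C(1) C_ne] measurable_stop_value[OF lower(1,2)] measurable_W[OF t]
    not_hit_sets[OF C(1) C_ne t A, THEN Fil_sets] not_hit_sets[OF lower(1,2) t A, THEN Fil_sets]
    sets_hits[OF lower(1,2)]
  have B[measurable]: "?B n \<in> sets P" for n by measurable
  have ev: "AE \<omega> in P. eventually (\<lambda>n. \<omega> \<notin> ?B n) sequentially"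
    using AE_stop_value_lower_eventually by eventually_elim (auto elim: eventually_mono)
  have "(\<lambda>n. \<integral>\<omega>. ?Z n \<omega> \<partial>P) \<longlonglongrightarrow> (\<integral>\<omega>. indicator (?A C) \<omega> * (stop_value C \<omega> - W t0 \<omega>) \<partial>P)"
  proof (rule integral_dominated_convergence[where w = "\<lambda>\<omega>. \<bar>stop_value C \<omega>\<bar> + \<bar>W t0 \<omega>\<bar>"])
    show "integrable P (\<lambda>\<omega>. \<bar>stop_value C \<omega>\<bar> + \<bar>W t0 \<omega>\<bar>)"
      by (intro Bochner_Integration.integrable_add integrable_abs integrable_stop_value_C integrable_W t)
    show "AE \<omega> in P. (\<lambda>n. ?Z n \<omega>) \<longlonglongrightarrow> indicator (?A C) \<omega> * (stop_value C \<omega> - W t0 \<omega>)"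
      using ev AE_space
    proof eventually_elim
      case (elim \<omega>)
      interpret f: azema_yor_path "\<lambda>u. W u \<omega>" b by (rule ay_path[OF elim(2)])
      have "continuous_on {0..t0} (\<lambda>u. W u \<omega>)"
        using f.cont continuous_on_subset by fastforce
      then obtain m where m: "\<And>u. u \<in> {0..t0} \<Longrightarrow> m \<le> W u \<omega>"
        using continuous_attains_inf[of "{0..t0}" "\<lambda>u. W u \<omega>"] t by fastforce
      have "eventually (\<lambda>n. 1 - m \<le> real n) sequentially" by (rule eventually_nat_ge_real)
      with elim(1) have "eventually (\<lambda>n. ?Z n \<omega> = indicator (?A C) \<omega> * (stop_value C \<omega> - W t0 \<omega>)) sequentially"
      proof eventually_elim
        case (elim n)
        have "f.pos v \<in> lower (?a n) \<longleftrightarrow> f.pos v \<in> C" if "v \<in> {0..t0}" for v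
          using m[OF that] elim(2) by (auto simp: lower_def f.pos_def)
        then have "f.hit_by (lower (?a n)) t0 \<longleftrightarrow> f.hit_by C t0"
          unfolding f.hit_by_def by blast
        moreover have "indicator (- ?B n) \<omega> = (1 :: real)" using elim(1) by (auto simp: indicator_def)
        ultimately show ?case by (simp add: indicator_def)
      qed
      then show ?case by (rule tendsto_eventually)
    qed
    show "AE \<omega> in P. norm (?Z n \<omega>) \<le> \<bar>stop_value C \<omega>\<bar> + \<bar>W t0 \<omega>\<bar>" for n
      by (intro AE_I2) (auto simp: indicator_def)
    show "?Z n \<in> borel_measurable P" for n
    proof -
      have "(\<lambda>\<omega>. indicator (- ?B n) \<omega> :: real) \<in> borel_measurable P"
        by (subst measurable_cong[where g = "indicator (space P - ?B n)"]) (auto simp: indicator_def)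
      then show ?thesis by measurable
    qed
  qed measurable
  moreover have "(\<lambda>n. \<integral>\<omega>. ?Z n \<omega> \<partial>P) \<longlonglongrightarrow> 0"
  proof (rule Lim_null_comparison)
    \<comment> \<open>The slack over \<open>b (- a)\<close> in \<open>lower_prob\<close> must vanish
      this time, hence \<open>1 / a\<close>: \<open>a\<close> times the probability has to tend to
      0, whereas \<open>AE_hits_C\<close> only concerns the probability.\<close>
    let ?r = "\<lambda>n. (b (- ?a n) + 1 / ?a n) + (\<integral>\<omega>. indicator (?B n) \<omega> * \<bar>W t0 \<omega>\<bar> \<partial>P)"
    have "norm (\<integral>\<omega>. ?Z n \<omega> \<partial>P) \<le> ?r n" for n
    proof -
      let ?R = "\<lambda>\<omega>. indicator (?A (lower (?a n))) \<omega> * (stop_value (lower (?a n)) \<omega> - W t0 \<omega>)"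
      let ?V = "\<lambda>\<omega>. indicator (?B n) \<omega> * ?R \<omega>"
      have iR: "integrable P ?R"
      proof (rule Bochner_Integration.integrable_bound[where f = "\<lambda>\<omega>. \<bar>stop_value (lower (?a n)) \<omega>\<bar> + \<bar>W t0 \<omega>\<bar>"])
        show "integrable P (\<lambda>\<omega>. \<bar>stop_value (lower (?a n)) \<omega>\<bar> + \<bar>W t0 \<omega>\<bar>)"
          by (intro Bochner_Integration.integrable_add integrable_abs stop_value_lower(1)[OF a] integrable_W t)
        show "AE \<omega> in P. norm (?R \<omega>) \<le> norm (\<bar>stop_value (lower (?a n)) \<omega>\<bar> + \<bar>W t0 \<omega>\<bar>)"
          by (intro AE_I2) (auto simp: indicator_def simp del: of_nat_Suc)
      qed measurable
      have iV: "integrable P ?V"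
        using integrable_real_mult_indicator[OF B iR] by (simp add: mult.commute)
      have "(\<integral>\<omega>. ?Z n \<omega> \<partial>P) = (\<integral>\<omega>. ?R \<omega> - ?V \<omega> \<partial>P)"
      proof (rule integral_cong_AE)
        show "AE \<omega> in P. ?Z n \<omega> = ?R \<omega> - ?V \<omega>"
          using stop_value_lower(3)[OF a[of n]] AE_space
        proof eventually_elim
          case (elim \<omega>)
          show ?case
          proof (cases "\<omega> \<in> ?B n")
            case False
            then have "stop_value C \<omega> = stop_value (lower (?a n)) \<omega>" using stop_value_lower_eq(2)[of \<omega> "?a n"] elim by auto
            then show ?thesis using False by simp
          qed simp
        qed
        have "(\<lambda>\<omega>. indicator (- ?B n) \<omega> :: real) \<in> borel_measurable P"
          by (subst measurable_cong[where g = "indicator (space P - ?B n)"]) (auto simp: indicator_def)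
        then show "?Z n \<in> borel_measurable P" by measurable
      qed measurable
      also have "\<dots> = - (\<integral>\<omega>. ?V \<omega> \<partial>P)"
      proof -
        have "(\<integral>\<omega>. ?R \<omega> \<partial>P) = 0"
          by (rule optional_stopping_hit[OF lower(1,2) lower_bound[OF a] K t A]) assumption+
        then show ?thesis using iR iV by (simp del: of_nat_Suc)
      qed
      finally have "norm (\<integral>\<omega>. ?Z n \<omega> \<partial>P) = norm (\<integral>\<omega>. ?V \<omega> \<partial>P)" by simp
      also have "\<dots> \<le> (\<integral>\<omega>. norm (?V \<omega>) \<partial>P)" by (rule integral_norm_bound)
      also have "\<dots> \<le> (\<integral>\<omega>. ?a n * indicator (?B n) \<omega> + indicator (?B n) \<omega> * \<bar>W t0 \<omega>\<bar> \<partial>P)"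
      proof (rule integral_mono)
        fix \<omega> assume \<omega>: "\<omega> \<in> space P"
        show "norm (?V \<omega>) \<le> ?a n * indicator (?B n) \<omega> + indicator (?B n) \<omega> * \<bar>W t0 \<omega>\<bar>"
        proof (cases "\<omega> \<in> ?B n")
          case True
          then have "stop_value (lower (?a n)) \<omega> = - ?a n" using stop_value_lower(4)[OF a \<omega>, of n] by auto
          then show ?thesis using True by (auto simp: indicator_def)
        qed simp
      qed (use iV integrable_real_mult_indicator[OF B integrable_abs[OF integrable_W[OF t]]] in
          \<open>auto simp: emeasure_eq_measure mult.commute simp del: of_nat_Suc\<close>)
      also have "\<dots> = ?a n * prob (?B n) + (\<integral>\<omega>. indicator (?B n) \<omega> * \<bar>W t0 \<omega>\<bar> \<partial>P)"
        using integrable_real_mult_indicator[OF B integrable_abs[OF integrable_W[OF t]]]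
        by (subst Bochner_Integration.integral_add) (auto simp: emeasure_eq_measure mult.commute simp del: of_nat_Suc)
      also have "\<dots> \<le> ?r n"
        using lower_prob[OF a, of n "b (- ?a n) + 1 / ?a n"] by simp
      finally show ?thesis .
    qed
    then show "eventually (\<lambda>n. norm (\<integral>\<omega>. ?Z n \<omega> \<partial>P) \<le> ?r n) sequentially" by simp
    have "(\<lambda>n. \<integral>\<omega>. indicator (?B n) \<omega> * \<bar>W t0 \<omega>\<bar> \<partial>P) \<longlonglongrightarrow> (\<integral>\<omega>. 0 \<partial>P)"
    proof (rule integral_dominated_convergence[where w = "\<lambda>\<omega>. \<bar>W t0 \<omega>\<bar>"])
      show "AE \<omega> in P. (\<lambda>n. indicator (?B n) \<omega> * \<bar>W t0 \<omega>\<bar>) \<longlonglongrightarrow> 0"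
        using ev
      proof eventually_elim
        case (elim \<omega>)
        then have "eventually (\<lambda>n. indicator (?B n) \<omega> * \<bar>W t0 \<omega>\<bar> = 0) sequentially"
          by eventually_elim simp
        then show ?case by (rule tendsto_eventually)
      qed
    qed (auto simp: indicator_def intro: integrable_W[OF t])
    moreover have "(\<lambda>n. b (- ?a n) + 1 / ?a n) \<longlonglongrightarrow> 0 + 0"
      by (intro tendsto_add filterlim_compose[OF b_at_bot] filterlim_compose[OF filterlim_uminus_at_bot_at_top]
          filterlim_real_Suc
          tendsto_divide_0[OF tendsto_const] filterlim_at_top_imp_at_infinity)
    ultimately show "?r \<longlonglongrightarrow> 0" using tendsto_add by fastforce
  qed
  ultimately show ?thesis by (rule LIMSEQ_unique)
qed

end

end

section \<open>The Azema-Yor embedding\<close>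

text \<open>The event \<open>{\<bar>S\<bar> \<ge> K}\<close> has probability at most \<open>E\<bar>X\<bar> / K\<close>, and the mean of \<open>\<bar>S\<bar>\<close> on it is at most that
  of \<open>\<bar>X\<bar>\<close>.\<close>

lemma (in prob_space) uniformly_integrable_closed_martingale:
  fixes X :: "'a \<Rightarrow> real"
  assumes X: "integrable M X" and eps: "0 < e"
  shows "\<exists>K. \<forall>F S. subalgebra M F \<longrightarrow> S \<in> borel_measurable F \<longrightarrow> integrable M S \<longrightarrow>
    (\<forall>A\<in>sets F. (\<integral>\<omega>. indicator A \<omega> * S \<omega> \<partial>M) = (\<integral>\<omega>. indicator A \<omega> * X \<omega> \<partial>M)) \<longrightarrow>
    (\<integral>\<omega>. \<bar>S \<omega>\<bar> * indicator {\<omega>. K \<le> \<bar>S \<omega>\<bar>} \<omega> \<partial>M) \<le> e"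
proof -
  have [measurable]: "X \<in> borel_measurable M" using X by simp
  have "(\<lambda>n. \<integral>\<omega>. \<bar>X \<omega>\<bar> * indicator {\<omega> \<in> space M. real n \<le> \<bar>X \<omega>\<bar>} \<omega> \<partial>M) \<longlonglongrightarrow> (\<integral>\<omega>. 0 \<partial>M)"
  proof (rule integral_dominated_convergence[where w = "\<lambda>\<omega>. \<bar>X \<omega>\<bar>"])
    show "AE \<omega> in M. (\<lambda>n. \<bar>X \<omega>\<bar> * indicator {\<omega> \<in> space M. real n \<le> \<bar>X \<omega>\<bar>} \<omega>) \<longlonglongrightarrow> 0"
    proof (rule AE_I2)
      fix \<omega>
      have "eventually (\<lambda>n. \<bar>X \<omega>\<bar> + 1 \<le> real n) sequentially" by (rule eventually_nat_ge_real)
      then have "eventually (\<lambda>n. \<bar>X \<omega>\<bar> * indicator {\<omega> \<in> space M. real n \<le> \<bar>X \<omega>\<bar>} \<omega> = 0) sequentially"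
        by eventually_elim (auto simp: indicator_def)
      then show "(\<lambda>n. \<bar>X \<omega>\<bar> * indicator {\<omega> \<in> space M. real n \<le> \<bar>X \<omega>\<bar>} \<omega>) \<longlonglongrightarrow> 0" by (rule tendsto_eventually)
    qed
  qed (use X in \<open>auto simp: indicator_def\<close>)
  then have "eventually (\<lambda>n. (\<integral>\<omega>. \<bar>X \<omega>\<bar> * indicator {\<omega> \<in> space M. real n \<le> \<bar>X \<omega>\<bar>} \<omega> \<partial>M) < e / 2) sequentially"
    using eps by (intro order_tendstoD(2)[where a = "e / 2"]) auto
  then obtain n where n: "(\<integral>\<omega>. \<bar>X \<omega>\<bar> * indicator {\<omega> \<in> space M. real n \<le> \<bar>X \<omega>\<bar>} \<omega> \<partial>M) < e / 2"
    by (auto simp: eventually_sequentially)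
  define E where "E = (\<integral>\<omega>. \<bar>X \<omega>\<bar> \<partial>M)"
  have E0: "0 \<le> E" by (simp add: E_def)
  \<comment> \<open>Chosen so that the probability bound \<open>E / K\<close>, multiplied by the
    cutoff level \<open>n\<close> of \<open>X\<close>, is at most \<open>e / 2\<close>. The summand
    1 makes \<open>K\<close> positive.\<close>
  define K where "K = 2 * real n * E / e + 1"
  have "0 \<le> 2 * real n * E / e" using E0 eps by simp
  then have K: "0 < K" by (simp add: K_def)
  have K2: "real n * E \<le> K * (e / 2)" using E0 eps by (simp add: K_def field_simps)
  show ?thesis
  proof (intro exI[of _ K] allI impI)
    fix F S
    assume F: "subalgebra M F" and S: "S \<in> borel_measurable F" and iS: "integrable M S"
      and eq: "\<forall>A\<in>sets F. (\<integral>\<omega>. indicator A \<omega> * S \<omega> \<partial>M) = (\<integral>\<omega>. indicator A \<omega> * X \<omega> \<partial>M)"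
    have sp: "space F = space M" using F by (simp add: subalgebra_def)
    define B where "B = {\<omega> \<in> space F. K \<le> \<bar>S \<omega>\<bar>}"
    define B1 where "B1 = {\<omega> \<in> space F. K \<le> \<bar>S \<omega>\<bar> \<and> 0 \<le> S \<omega>}"
    define B2 where "B2 = {\<omega> \<in> space F. K \<le> \<bar>S \<omega>\<bar> \<and> S \<omega> < 0}"
    have BF: "B \<in> sets F" "B1 \<in> sets F" "B2 \<in> sets F" using S unfolding B_def B1_def B2_def by measurable
    have [measurable]: "S \<in> borel_measurable M" using iS by simp
    have BM [measurable]: "B \<in> sets M" "B1 \<in> sets M" "B2 \<in> sets M" using BF F by (auto simp: subalgebra_def)
    have absX: "integrable M (\<lambda>\<omega>. indicator B \<omega> * \<bar>X \<omega>\<bar>)"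
      by (intro integrable_indicator_mult BM integrable_abs X)
    have absS: "integrable M (\<lambda>\<omega>. indicator B \<omega> * \<bar>S \<omega>\<bar>)"
      by (intro integrable_indicator_mult BM integrable_abs iS)
    have "(\<integral>\<omega>. indicator B \<omega> * \<bar>S \<omega>\<bar> \<partial>M) = (\<integral>\<omega>. indicator B1 \<omega> * S \<omega> - indicator B2 \<omega> * S \<omega> \<partial>M)"
      by (intro Bochner_Integration.integral_cong) (auto simp: B_def B1_def B2_def indicator_def sp)
    also have "\<dots> = (\<integral>\<omega>. indicator B1 \<omega> * S \<omega> \<partial>M) - (\<integral>\<omega>. indicator B2 \<omega> * S \<omega> \<partial>M)"
      by (intro Bochner_Integration.integral_diff integrable_indicator_mult BM iS)
    also have "\<dots> = (\<integral>\<omega>. indicator B1 \<omega> * X \<omega> \<partial>M) - (\<integral>\<omega>. indicator B2 \<omega> * X \<omega> \<partial>M)"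
      using eq BF by simp
    also have "\<dots> = (\<integral>\<omega>. indicator B1 \<omega> * X \<omega> - indicator B2 \<omega> * X \<omega> \<partial>M)"
      by (intro Bochner_Integration.integral_diff[symmetric] integrable_indicator_mult BM X)
    also have "\<dots> \<le> (\<integral>\<omega>. indicator B \<omega> * \<bar>X \<omega>\<bar> \<partial>M)"
      by (intro integral_mono absX Bochner_Integration.integrable_diff integrable_indicator_mult BM X)
        (auto simp: B_def B1_def B2_def indicator_def)
    finally have le: "(\<integral>\<omega>. indicator B \<omega> * \<bar>S \<omega>\<bar> \<partial>M) \<le> (\<integral>\<omega>. indicator B \<omega> * \<bar>X \<omega>\<bar> \<partial>M)" .
    have "K * prob B = (\<integral>\<omega>. K * indicator B \<omega> \<partial>M)" by simp
    also have "\<dots> \<le> (\<integral>\<omega>. indicator B \<omega> * \<bar>S \<omega>\<bar> \<partial>M)"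
    proof (rule integral_mono[OF _ absS])
      show "integrable M (\<lambda>\<omega>. K * indicator B \<omega>)" using BM(1) by (simp add: emeasure_eq_measure)
    qed (auto simp: indicator_def B_def)
    also note le
    also have "(\<integral>\<omega>. indicator B \<omega> * \<bar>X \<omega>\<bar> \<partial>M) \<le> E"
      unfolding E_def by (intro integral_mono absX integrable_abs X) (auto simp: indicator_def)
    finally have KB: "K * prob B \<le> E" .
    let ?L = "{\<omega> \<in> space M. real n \<le> \<bar>X \<omega>\<bar>}"
    have iL: "integrable M (\<lambda>\<omega>. \<bar>X \<omega>\<bar> * indicator ?L \<omega>)"
      by (rule integrable_real_mult_indicator[OF _ integrable_abs[OF X]]) measurable
    have iB: "integrable M (\<lambda>\<omega>. real n * indicator B \<omega>)" using BM(1) by (simp add: emeasure_eq_measure)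
    have "(\<integral>\<omega>. indicator B \<omega> * \<bar>X \<omega>\<bar> \<partial>M) \<le> (\<integral>\<omega>. \<bar>X \<omega>\<bar> * indicator ?L \<omega> + real n * indicator B \<omega> \<partial>M)"
      by (intro integral_mono absX Bochner_Integration.integrable_add iL iB) (auto simp: indicator_def)
    also have "\<dots> = (\<integral>\<omega>. \<bar>X \<omega>\<bar> * indicator ?L \<omega> \<partial>M) + real n * prob B"
      by (subst Bochner_Integration.integral_add[OF iL iB]) simp
    also have "real n * prob B \<le> e / 2"
    proof -
      have "real n * (K * prob B) \<le> real n * E" using KB by (intro mult_left_mono) auto
      also have "\<dots> \<le> K * (e / 2)" by (rule K2)
      finally have "K * (real n * prob B) \<le> K * (e / 2)" by (simp add: ac_simps)
      then show ?thesis using K by simp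
    qed
    finally have "(\<integral>\<omega>. indicator B \<omega> * \<bar>S \<omega>\<bar> \<partial>M) \<le> e" using le n by simp
    moreover have "(\<integral>\<omega>. \<bar>S \<omega>\<bar> * indicator {\<omega>. K \<le> \<bar>S \<omega>\<bar>} \<omega> \<partial>M) = (\<integral>\<omega>. indicator B \<omega> * \<bar>S \<omega>\<bar> \<partial>M)"
      by (intro Bochner_Integration.integral_cong) (auto simp: B_def indicator_def sp)
    ultimately show "(\<integral>\<omega>. \<bar>S \<omega>\<bar> * indicator {\<omega>. K \<le> \<bar>S \<omega>\<bar>} \<omega> \<partial>M) \<le> e" by simp
  qed
qed

section \<open>Law and martingale property of the stopped Brownian path\<close>

locale ay_embedding = brownian P W + law: centred_law \<mu>
  for P :: "'a measure" and W and \<mu> :: "real measure"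
begin

abbreviation "\<beta> \<equiv> barycenter \<mu>"

sublocale ay_brownian P W \<beta>
proof
  show "continuous_on UNIV \<beta>" by (intro continuous_at_imp_continuous_on ballI law.isCont_barycenter)
qed (simp_all add: law.mono_barycenter law.barycenter_ge law.barycenter_0_pos law.barycenter_nonneg law.barycenter_at_bot)

definition X :: "'a \<Rightarrow> real" where "X = stop_value (ay_region \<beta>)"

text \<open>The condition on \<open>hits\<close> removes the default value 0 of \<open>X\<close> on
  paths that are never stopped; these are shown to be negligible only in
  \<open>AE_hits_region\<close>.\<close>

definition before :: "real \<Rightarrow> 'a set" where
  "before k = {\<omega> \<in> space P. hits (ay_region \<beta>) \<omega> \<and> X \<omega> < k}"

lemma ay_region_props: "closed (ay_region \<beta>)" "ay_region \<beta> \<noteq> {}"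
  using closed_ay_region[OF cont_b] by (auto simp: ay_region_def)

lemma ay_cut_props:
  assumes "0 < \<beta> k"
  shows "closed (ay_cut \<beta> k)" "ay_region \<beta> \<subseteq> ay_cut \<beta> k" "(0, 0) \<notin> ay_cut \<beta> k"
    "\<And>x y. x \<le> y \<Longrightarrow> (x, y) \<notin> ay_cut \<beta> k \<Longrightarrow> x \<le> \<beta> k" "0 \<le> \<beta> k"
  using closed_ay_cut[OF cont_b] b_0 assms by (auto simp: ay_region_def ay_cut_def)

lemma measurable_X [measurable]: "X \<in> borel_measurable P"
  unfolding X_def by (rule measurable_stop_value[OF ay_region_props])

lemma sets_before [measurable]: "before k \<in> sets P"
  unfolding before_def using sets_hits[OF ay_region_props] by measurable

lemma stop_value_cut:
  assumes "0 < \<beta> k" "\<omega> \<in> space P" "hits (ay_cut \<beta> k) \<omega>"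
  shows "stop_value (ay_cut \<beta> k) \<omega> = (if \<omega> \<in> before k then X \<omega> else \<beta> k)"
  using azema_yor_path.ay_cut_hit[OF ay_path[OF assms(2)] assms(1,3)] assms
  by (auto simp: stop_value_def before_def X_def)

lemma integrable_before: "integrable P (\<lambda>\<omega>. X \<omega> * indicator (before k) \<omega>)"
  and integral_before: "(\<integral>\<omega>. X \<omega> * indicator (before k) \<omega> \<partial>P) = - \<beta> k * (1 - prob (before k))"
proof -
  have "integrable P (\<lambda>\<omega>. X \<omega> * indicator (before k) \<omega>) \<and>
    (\<integral>\<omega>. X \<omega> * indicator (before k) \<omega> \<partial>P) = - \<beta> k * (1 - prob (before k))"
  proof (cases "0 < \<beta> k")
    \<comment> \<open>For \<beta>(k) = 0 the cut contains the starting point, and optional stopping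
      at it says nothing. But stopping below \<open>k\<close> would require a negative maximum, so
      both sides are 0.\<close>
    case False
    then have k: "\<beta> k = 0" using b_nonneg[of k] by simp
    have "before k = {}"
    proof safe
      fix \<omega> assume "\<omega> \<in> before k"
      then have \<omega>: "\<omega> \<in> space P" "hits (ay_region \<beta>) \<omega>" "hit_value (ay_region \<beta>) \<omega> < k"
        by (auto simp: before_def X_def stop_value_def)
      interpret f: azema_yor_path "\<lambda>u. W u \<omega>" \<beta> by (rule ay_path[OF \<omega>(1)])
      have "path_max (\<lambda>u. W u \<omega>) (f.hit_time (ay_region \<beta>)) < 0" using f.ay_hit(3)[OF \<omega>(2)] \<omega>(3) k by simp
      then show "\<omega> \<in> {}" using f.path_max_nonneg f.hit_time_props(1)[OF ay_region_props(1) \<omega>(2)] by force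
    qed
    then show ?thesis using k by simp
  next
    case True
    note c = ay_cut_props[OF True]
    have ii: "integrable P (stop_value (ay_cut \<beta> k))" by (rule integrable_stop_value_C[OF c]) assumption+
    have hc: "AE \<omega> in P. hits (ay_cut \<beta> k) \<omega>" by (rule AE_hits_C[OF c]) assumption+
    have ae: "AE \<omega> in P. stop_value (ay_cut \<beta> k) \<omega> = X \<omega> * indicator (before k) \<omega> + \<beta> k * indicator (space P - before k) \<omega>"
      using hc AE_space
      by eventually_elim (use stop_value_cut[OF True] in \<open>auto simp: indicator_def\<close>)
    have [measurable]: "stop_value (ay_cut \<beta> k) \<in> borel_measurable P" using ii by simp
    have i1: "integrable P (\<lambda>\<omega>. X \<omega> * indicator (before k) \<omega> + \<beta> k * indicator (space P - before k) \<omega>)"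
      using ii by (subst integrable_cong_AE[OF _ _ ae, symmetric]) measurable
    have i2: "integrable P (\<lambda>\<omega>. \<beta> k * indicator (space P - before k) \<omega>)"
      by (simp add: emeasure_eq_measure)
    have i3: "integrable P (\<lambda>\<omega>. X \<omega> * indicator (before k) \<omega>)"
      using Bochner_Integration.integrable_diff[OF i1 i2] by simp
    have "\<not> hit_by (ay_cut \<beta> k) 0 \<omega>" if "\<omega> \<in> space P" for \<omega>
      using based_path.hit_by_def[OF based_path[OF that]] based_path.pos_0[OF based_path[OF that]] c(3) by auto
    then have "(\<integral>\<omega>. stop_value (ay_cut \<beta> k) \<omega> \<partial>P) =
        (\<integral>\<omega>. indicator {\<omega> \<in> space P. \<not> hit_by (ay_cut \<beta> k) 0 \<omega>} \<omega> * (stop_value (ay_cut \<beta> k) \<omega> - W 0 \<omega>) \<partial>P)"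
      using W_0 by (intro Bochner_Integration.integral_cong) auto
    also have "\<dots> = 0"
      using sets.top[of "Fil 0"] by (intro optional_stopping_unbounded_below[OF c]) auto
    finally have "0 = (\<integral>\<omega>. X \<omega> * indicator (before k) \<omega> + \<beta> k * indicator (space P - before k) \<omega> \<partial>P)"
      by (subst integral_cong_AE[OF _ _ ae, symmetric]) measurable
    also have "\<dots> = (\<integral>\<omega>. X \<omega> * indicator (before k) \<omega> \<partial>P) + \<beta> k * prob (space P - before k)"
      using i2 i3 by (subst Bochner_Integration.integral_add) auto
    finally show ?thesis using i3 by (simp add: prob_compl algebra_simps)
  qed
  then show "integrable P (\<lambda>\<omega>. X \<omega> * indicator (before k) \<omega>)"
    "(\<integral>\<omega>. X \<omega> * indicator (before k) \<omega> \<partial>P) = - \<beta> k * (1 - prob (before k))" by blast+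
qed

text \<open>For positive \<open>k\<close>, passing from \<open>before 0\<close> to
  \<open>before k\<close> adds only nonnegative values of \<open>X\<close>. By
  \<open>integral_before\<close>, \<beta>(k) times the probability of the complement is then at most
  \<beta>(0), whereas \<beta>(k) is at least \<open>k\<close>.\<close>

lemma AE_hits_region: "AE \<omega> in P. hits (ay_region \<beta>) \<omega>"
proof -
  let ?N = "space P - {\<omega> \<in> space P. hits (ay_region \<beta>) \<omega>}"
  have "prob ?N \<le> \<beta> 0 / real (Suc n)" for n
  proof -
    let ?k = "real (Suc n)"
    have "(\<integral>\<omega>. X \<omega> * indicator (before 0) \<omega> \<partial>P) \<le> (\<integral>\<omega>. X \<omega> * indicator (before ?k) \<omega> \<partial>P)"
      by (intro integral_mono integrable_before) (auto simp: before_def indicator_def)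
    then have "\<beta> ?k * (1 - prob (before ?k)) \<le> \<beta> 0 * (1 - prob (before 0))"
      by (simp only: integral_before)
    also have "\<dots> \<le> \<beta> 0" using b_nonneg[of 0] mult_left_le[of "1 - prob (before 0)" "\<beta> 0"] by simp
    finally have "\<beta> ?k * (1 - prob (before ?k)) \<le> \<beta> 0" .
    moreover have "?k * (1 - prob (before ?k)) \<le> \<beta> ?k * (1 - prob (before ?k))"
      using b_ge[of ?k] by (intro mult_right_mono) auto
    ultimately have "1 - prob (before ?k) \<le> \<beta> 0 / ?k" by (simp add: field_simps)
    moreover have "prob ?N \<le> prob (space P - before ?k)"
    proof (rule finite_measure_mono)
      show "?N \<subseteq> space P - before ?k" by (auto simp: before_def)
    qed measurable
    ultimately show ?thesis by (simp add: prob_compl)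
  qed
  moreover have "(\<lambda>n. \<beta> 0 / real (Suc n)) \<longlonglongrightarrow> 0"
    by (rule LIMSEQ_Suc) (rule lim_const_over_n)
  ultimately show ?thesis by (rule AE_of_prob_bound[OF sets_hits[OF ay_region_props]])
qed

lemma AE_before: "AE \<omega> in P. \<omega> \<in> before k \<longleftrightarrow> X \<omega> < k"
  using AE_hits_region AE_space by eventually_elim (auto simp: before_def)

lemma prob_not_before: "1 - prob (before k) = measure (distr P borel X) {k..}"
proof -
  have "1 - prob (before k) = prob (space P - before k)" by (simp add: prob_compl)
  also have "\<dots> = prob (X -` {k..} \<inter> space P)"
  proof (rule finite_measure_eq_AE)
    show "AE \<omega> in P. (\<omega> \<in> space P - before k) = (\<omega> \<in> X -` {k..} \<inter> space P)"
      using AE_before[of k] AE_space by eventually_elim auto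
  qed measurable
  also have "\<dots> = measure (distr P borel X) {k..}" by (simp add: measure_distr)
  finally show ?thesis .
qed

lemma distr_X: "distr P borel X = \<mu>"
proof (rule law.barycenter_unique)
  have ind: "AE \<omega> in P. X \<omega> * indicator {..<k} (X \<omega>) = X \<omega> * indicator (before k) \<omega>" for k
    using AE_before[of k] by eventually_elim (auto simp: indicator_def)
  interpret d: prob_space "distr P borel X" by (rule prob_space_distr) measurable
  show "barycenter_relation (distr P borel X) \<beta>"
  proof
    have "integrable P (\<lambda>\<omega>. X \<omega> * indicator {..<0} (X \<omega>))"
      using integrable_before[of 0] by (subst integrable_cong_AE[OF _ _ ind]) measurable
    then show "integrable (distr P borel X) (\<lambda>x. x * indicator {..<0} x)"
      by (subst integrable_distr_eq) measurable
    fix k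
    have "(\<integral>x. x * indicator {..<k} x \<partial>distr P borel X) = (\<integral>\<omega>. X \<omega> * indicator {..<k} (X \<omega>) \<partial>P)"
      by (subst integral_distr) measurable
    also have "\<dots> = (\<integral>\<omega>. X \<omega> * indicator (before k) \<omega> \<partial>P)"
      by (intro integral_cong_AE ind) measurable
    also have "\<dots> = - \<beta> k * (1 - prob (before k))" by (rule integral_before)
    also note prob_not_before
    finally show "(\<integral>x. x * indicator {..<k} x \<partial>distr P borel X) = - \<beta> k * measure (distr P borel X) {k..}" .
    show "isCont \<beta> k" by (rule law.isCont_barycenter)
  qed simp
qed

lemma integrable_X: "integrable P X"
proof -
  have "integrable (distr P borel X) (\<lambda>x. x)" unfolding distr_X by (rule law.integrable_id)
  then show ?thesis by (rule integrable_distr[OF measurable_X])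
qed

lemma prob_before: "1 - prob (before k) = law.tail k"
  by (simp add: prob_not_before distr_X law.tail_def)

text \<open>Cuts at increasing levels \<open>k\<close> approach the region. The paths stopped at the
  level \<beta>(k) contribute at most \<beta>(k) times their probability; as \<open>X\<close> is now
  known to have law \<mu>, this is \<open>tail_mean k\<close>, which tends to 0.\<close>

lemma optional_stopping_ay:
  assumes t: "0 \<le> t0" and A: "A \<in> sets (Fil t0)"
  shows "(\<integral>\<omega>. indicator {\<omega> \<in> A. \<not> hit_by (ay_region \<beta>) t0 \<omega>} \<omega> * (X \<omega> - W t0 \<omega>) \<partial>P) = 0"
proof -
  let ?k = "\<lambda>n. real (Suc n)"
  let ?A = "\<lambda>D. {\<omega> \<in> A. \<not> hit_by D t0 \<omega>}"
  let ?Y = "\<lambda>n \<omega>. indicator (?A (ay_cut \<beta> (?k n))) \<omega> * (X \<omega> * indicator (before (?k n)) \<omega> - W t0 \<omega>)"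
  have pos: "0 < \<beta> (?k n)" for n by (rule less_le_trans[OF _ b_ge]) simp
  note c = ay_cut_props[OF pos]
  have c_ne: "ay_cut \<beta> (?k n) \<noteq> {}" for n using c(2)[of n] ay_region_props(2) by blast
  note [measurable] = measurable_W[OF t] not_hit_sets[OF ay_region_props t A, THEN Fil_sets]
    not_hit_sets[OF c(1) c_ne t A, THEN Fil_sets]
  have "(\<lambda>n. \<integral>\<omega>. ?Y n \<omega> \<partial>P) \<longlonglongrightarrow> (\<integral>\<omega>. indicator (?A (ay_region \<beta>)) \<omega> * (X \<omega> - W t0 \<omega>) \<partial>P)"
  proof (rule integral_dominated_convergence[where w = "\<lambda>\<omega>. \<bar>X \<omega>\<bar> + \<bar>W t0 \<omega>\<bar>"])
    show "integrable P (\<lambda>\<omega>. \<bar>X \<omega>\<bar> + \<bar>W t0 \<omega>\<bar>)"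
      by (intro Bochner_Integration.integrable_add integrable_abs integrable_X integrable_W t)
    show "AE \<omega> in P. (\<lambda>n. ?Y n \<omega>) \<longlonglongrightarrow> indicator (?A (ay_region \<beta>)) \<omega> * (X \<omega> - W t0 \<omega>)"
      using AE_hits_region AE_space
    proof eventually_elim
      case (elim \<omega>)
      interpret f: azema_yor_path "\<lambda>u. W u \<omega>" \<beta> by (rule ay_path[OF elim(2)])
      have "eventually (\<lambda>n. path_max (\<lambda>u. W u \<omega>) t0 \<le> real n) sequentially"
        "eventually (\<lambda>n. X \<omega> \<le> real n) sequentially" by (rule eventually_nat_ge_real)+
      then have "eventually (\<lambda>n. ?Y n \<omega> = indicator (?A (ay_region \<beta>)) \<omega> * (X \<omega> - W t0 \<omega>)) sequentially"
      proof eventually_elim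
        case (elim n)
        have "f.pos v \<in> ay_cut \<beta> (?k n) \<longleftrightarrow> f.pos v \<in> ay_region \<beta>" if "v \<in> {0..t0}" for v
        proof -
          have "path_max (\<lambda>u. W u \<omega>) v \<le> path_max (\<lambda>u. W u \<omega>) t0"
            using that by (intro path_max_mono f.cont) auto
          then have "path_max (\<lambda>u. W u \<omega>) v < \<beta> (?k n)" using elim b_ge[of "?k n"] by simp
          then show ?thesis by (simp add: ay_cut_def ay_region_def f.pos_def)
        qed
        then have "f.hit_by (ay_cut \<beta> (?k n)) t0 \<longleftrightarrow> f.hit_by (ay_region \<beta>) t0"
          unfolding f.hit_by_def by blast
        moreover have "\<omega> \<in> before (?k n)" using elim \<open>hits (ay_region \<beta>) \<omega>\<close> \<open>\<omega> \<in> space P\<close> by (simp add: before_def)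
        ultimately show ?case by (simp add: indicator_def)
      qed
      then show ?case by (rule tendsto_eventually)
    qed
    show "AE \<omega> in P. norm (?Y n \<omega>) \<le> \<bar>X \<omega>\<bar> + \<bar>W t0 \<omega>\<bar>" for n
      by (intro AE_I2) (auto simp: indicator_def)
  qed measurable
  moreover have "(\<lambda>n. \<integral>\<omega>. ?Y n \<omega> \<partial>P) \<longlonglongrightarrow> 0"
  proof (rule Lim_null_comparison)
    have "norm (\<integral>\<omega>. ?Y n \<omega> \<partial>P) \<le> law.tail_mean (?k n)" for n
    proof -
      let ?I = "indicator (?A (ay_cut \<beta> (?k n))) :: 'a \<Rightarrow> real"
      let ?R = "\<lambda>\<omega>. ?I \<omega> * (\<beta> (?k n) * indicator (space P - before (?k n)) \<omega>)"
      have iY: "integrable P (?Y n)"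
      proof (rule Bochner_Integration.integrable_bound[where f = "\<lambda>\<omega>. \<bar>X \<omega>\<bar> + \<bar>W t0 \<omega>\<bar>"])
        show "integrable P (\<lambda>\<omega>. \<bar>X \<omega>\<bar> + \<bar>W t0 \<omega>\<bar>)"
          by (intro Bochner_Integration.integrable_add integrable_abs integrable_X integrable_W t)
        show "AE \<omega> in P. norm (?Y n \<omega>) \<le> norm (\<bar>X \<omega>\<bar> + \<bar>W t0 \<omega>\<bar>)"
          by (intro AE_I2) (auto simp: indicator_def simp del: of_nat_Suc)
      qed measurable
      have iR: "integrable P ?R"
      proof (rule integrable_const_bound[where B = "\<beta> (?k n)"])
        show "AE \<omega> in P. norm (?R \<omega>) \<le> \<beta> (?k n)"
          using pos[of n] by (intro AE_I2) (auto simp: indicator_def simp del: of_nat_Suc)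
      qed measurable
      have hc: "AE \<omega> in P. hits (ay_cut \<beta> (?k n)) \<omega>" by (rule AE_hits_C[OF c]) assumption+
      have [measurable]: "stop_value (ay_cut \<beta> (?k n)) \<in> borel_measurable P" by (rule measurable_stop_value[OF c(1) c_ne])
      have "0 = (\<integral>\<omega>. ?I \<omega> * (stop_value (ay_cut \<beta> (?k n)) \<omega> - W t0 \<omega>) \<partial>P)"
        by (rule optional_stopping_unbounded_below[OF c t A, symmetric]) assumption+
      also have "\<dots> = (\<integral>\<omega>. ?Y n \<omega> + ?R \<omega> \<partial>P)"
      proof (rule integral_cong_AE)
        show "AE \<omega> in P. ?I \<omega> * (stop_value (ay_cut \<beta> (?k n)) \<omega> - W t0 \<omega>) = ?Y n \<omega> + ?R \<omega>"
          using hc AE_space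
        proof eventually_elim
          case (elim \<omega>)
          then show ?case using stop_value_cut[OF pos elim(2,1)] by (auto simp: indicator_def)
        qed
      qed measurable
      also have "\<dots> = (\<integral>\<omega>. ?Y n \<omega> \<partial>P) + (\<integral>\<omega>. ?R \<omega> \<partial>P)"
        by (rule Bochner_Integration.integral_add[OF iY iR])
      finally have "norm (\<integral>\<omega>. ?Y n \<omega> \<partial>P) = norm (\<integral>\<omega>. ?R \<omega> \<partial>P)" by simp
      also have "\<dots> \<le> (\<integral>\<omega>. norm (?R \<omega>) \<partial>P)" by (rule integral_norm_bound)
      also have "\<dots> \<le> (\<integral>\<omega>. \<beta> (?k n) * indicator (space P - before (?k n)) \<omega> \<partial>P)"
      proof (rule integral_mono)
        show "integrable P (\<lambda>\<omega>. \<beta> (?k n) * indicator (space P - before (?k n)) \<omega>)"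
          by (simp add: emeasure_eq_measure)
        show "norm (?R \<omega>) \<le> \<beta> (?k n) * indicator (space P - before (?k n)) \<omega>" for \<omega>
          using pos[of n] by (auto simp: indicator_def simp del: of_nat_Suc)
      qed (rule integrable_norm[OF iR])
      also have "\<dots> = \<beta> (?k n) * (1 - prob (before (?k n)))" by (simp add: prob_compl)
      also have "\<beta> (?k n) * (1 - prob (before (?k n))) = law.tail_mean (?k n)" unfolding prob_before by (rule law.barycenter_mult)
      finally show ?thesis .
    qed
    then show "eventually (\<lambda>n. norm (\<integral>\<omega>. ?Y n \<omega> \<partial>P) \<le> law.tail_mean (?k n)) sequentially" by simp
    show "(\<lambda>n. law.tail_mean (?k n)) \<longlonglongrightarrow> 0"
      by (rule filterlim_compose[OF law.tail_limits(3) filterlim_real_Suc])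
  qed
  ultimately show ?thesis by (rule LIMSEQ_unique)
qed

definition Y :: "real \<Rightarrow> 'a \<Rightarrow> real" where "Y t = stopped (ay_region \<beta>) t"

lemma measurable_Y: "0 \<le> t \<Longrightarrow> Y t \<in> borel_measurable (Fil t)"
  unfolding Y_def by (rule measurable_stopped_0[OF ay_region_props])

lemma Y_cases:
  assumes "\<omega> \<in> space P" "0 \<le> t"
  shows "Y t \<omega> = (if hit_by (ay_region \<beta>) t \<omega> then X \<omega> else W t \<omega>)"
proof -
  interpret f: azema_yor_path "\<lambda>u. W u \<omega>" \<beta> by (rule ay_path[OF assms(1)])
  show ?thesis using f.hits_iff by (auto simp: Y_def X_def stop_value_def f.stop_time_def)
qed

lemma integrable_Y:
  assumes t: "0 \<le> t"
  shows "integrable P (Y t)"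
proof (rule Bochner_Integration.integrable_bound[where f = "\<lambda>\<omega>. \<bar>X \<omega>\<bar> + \<bar>W t \<omega>\<bar>"])
  show "integrable P (\<lambda>\<omega>. \<bar>X \<omega>\<bar> + \<bar>W t \<omega>\<bar>)"
    by (intro Bochner_Integration.integrable_add integrable_abs integrable_X integrable_W t)
  show "Y t \<in> borel_measurable P" by (rule measurable_from_subalg[OF subalgebra_Fil measurable_Y[OF t]])
  show "AE \<omega> in P. norm (Y t \<omega>) \<le> norm (\<bar>X \<omega>\<bar> + \<bar>W t \<omega>\<bar>)"
    using Y_cases[OF _ t] by (intro AE_I2) auto
qed

text \<open>\<open>Y t\<close> and \<open>X\<close> differ only on paths not stopped by time
  \<open>t\<close>, which is the event in \<open>optional_stopping_ay\<close>. Hence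
  \<open>Y t\<close> is the conditional expectation of \<open>X\<close>, and uniform integrability
  follows as well.\<close>

lemma integral_Y:
  assumes t: "0 \<le> t" and A: "A \<in> sets (Fil t)"
  shows "(\<integral>\<omega>. indicator A \<omega> * Y t \<omega> \<partial>P) = (\<integral>\<omega>. indicator A \<omega> * X \<omega> \<partial>P)"
proof -
  have i1: "integrable P (\<lambda>\<omega>. indicator A \<omega> * X \<omega>)"
    by (rule integrable_indicator_mult[OF Fil_sets[OF A] integrable_X])
  have i2: "integrable P (\<lambda>\<omega>. indicator A \<omega> * Y t \<omega>)"
    by (rule integrable_indicator_mult[OF Fil_sets[OF A] integrable_Y[OF t]])
  have "(\<integral>\<omega>. indicator A \<omega> * X \<omega> \<partial>P) - (\<integral>\<omega>. indicator A \<omega> * Y t \<omega> \<partial>P) =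
      (\<integral>\<omega>. indicator A \<omega> * X \<omega> - indicator A \<omega> * Y t \<omega> \<partial>P)"
    by (rule Bochner_Integration.integral_diff[OF i1 i2, symmetric])
  also have "\<dots> = (\<integral>\<omega>. indicator {\<omega> \<in> A. \<not> hit_by (ay_region \<beta>) t \<omega>} \<omega> * (X \<omega> - W t \<omega>) \<partial>P)"
    using Y_cases[OF _ t] by (intro Bochner_Integration.integral_cong) (auto simp: indicator_def)
  also have "\<dots> = 0" by (rule optional_stopping_ay[OF t A])
  finally show ?thesis by simp
qed

lemma azema_yor_time_eq:
  assumes \<omega>: "\<omega> \<in> space P"
  shows "azema_yor_time \<mu> W \<omega> =
    (if hits (ay_region \<beta>) \<omega> then ereal (based_path.hit_time (\<lambda>u. W u \<omega>) (ay_region \<beta>)) else \<infinity>)"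
proof -
  interpret f: azema_yor_path "\<lambda>u. W u \<omega>" \<beta> by (rule ay_path[OF \<omega>])
  have S: "{ereal t | t. 0 \<le> t \<and> running_max W t \<omega> \<ge> \<beta> (W t \<omega>)} = ereal ` {t. 0 \<le> t \<and> f.pos t \<in> ay_region \<beta>}"
    by (auto simp: running_max_def path_max_def f.pos_def ay_region_def)
  show ?thesis
  proof (cases "f.hits (ay_region \<beta>)")
    case True
    note hp = f.hit_time_props[OF ay_region_props(1) True]
    have "Inf (ereal ` {t. 0 \<le> t \<and> f.pos t \<in> ay_region \<beta>}) = ereal (f.hit_time (ay_region \<beta>))"
    proof (rule Inf_eqI)
      show "ereal (f.hit_time (ay_region \<beta>)) \<le> i" if "i \<in> ereal ` {t. 0 \<le> t \<and> f.pos t \<in> ay_region \<beta>}" for i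
        using that hp(3) by (auto simp: not_less[symmetric])
      show "y \<le> ereal (f.hit_time (ay_region \<beta>))"
        if "\<And>i. i \<in> ereal ` {t. 0 \<le> t \<and> f.pos t \<in> ay_region \<beta>} \<Longrightarrow> y \<le> i" for y
        using that hp(1,2) by blast
    qed
    then show ?thesis using True unfolding azema_yor_time_def S by simp
  next
    case False
    then have E: "{t. 0 \<le> t \<and> f.pos t \<in> ay_region \<beta>} = {}" by (auto simp: f.hits_def)
    show ?thesis using False unfolding azema_yor_time_def S E by (simp add: top_ereal_def)
  qed
qed

section \<open>The time change to a finite horizon\<close>

context
  fixes T :: real
  assumes T: "0 < T"
begin

abbreviation "clock \<equiv> \<lambda>t. t / (T - t)"
abbreviation "AY \<equiv> azema_yor_process T \<mu> W"

lemma clock_nonneg: "0 \<le> t \<Longrightarrow> t < T \<Longrightarrow> 0 \<le> clock t"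
  by simp

lemma clock_mono: "0 \<le> s \<Longrightarrow> s \<le> t \<Longrightarrow> t < T \<Longrightarrow> clock s \<le> clock t"
  by (intro frac_le) auto

lemma process_eq:
  assumes \<omega>: "\<omega> \<in> space P"
  shows "0 \<le> t \<Longrightarrow> t < T \<Longrightarrow> AY t \<omega> = Y (clock t) \<omega>" "AY T \<omega> = X \<omega>"
proof -
  interpret f: azema_yor_path "\<lambda>u. W u \<omega>" \<beta> by (rule ay_path[OF \<omega>])
  show "AY T \<omega> = X \<omega>"
    using W_0[OF \<omega>] by (simp add: azema_yor_process_def azema_yor_time_eq[OF \<omega>] X_def stop_value_def)
  assume t: "0 \<le> t" "t < T"
  show "AY t \<omega> = Y (clock t) \<omega>"
  proof (cases "f.hits (ay_region \<beta>)")
    case True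
    then show ?thesis
      using t f.hit_by_iff[OF ay_region_props(1) True clock_nonneg[OF t]]
      by (auto simp: azema_yor_process_def azema_yor_time_eq[OF \<omega>] Y_def f.stop_time_def min_def)
  next
    case False
    then have "\<not> f.hit_by (ay_region \<beta>) (clock t)" using f.hits_iff by blast
    then show ?thesis using False t
      by (auto simp: azema_yor_process_def azema_yor_time_eq[OF \<omega>] Y_def f.stop_time_def min_def)
  qed
qed

lemma process_min:
  assumes \<omega>: "\<omega> \<in> space P" "hits (ay_region \<beta>) \<omega>" and t: "0 \<le> t" "t < T"
  shows "AY t \<omega> = W (min (based_path.hit_time (\<lambda>u. W u \<omega>) (ay_region \<beta>)) (clock t)) \<omega>"
proof -
  interpret f: azema_yor_path "\<lambda>u. W u \<omega>" \<beta> by (rule ay_path[OF \<omega>(1)])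
  show ?thesis
    using f.hit_by_iff[OF ay_region_props(1) \<omega>(2) clock_nonneg[OF t]] process_eq(1)[OF \<omega>(1) t]
    by (auto simp: Y_def f.stop_time_def min_def)
qed

text \<open>At time \<open>T\<close> the clock has run to infinity; the \<sigma>-algebra of
  \<open>P\<close> itself then makes \<open>X\<close> measurable.\<close>

definition Filt :: "real \<Rightarrow> 'a measure" where
  "Filt t = (if t < T then Fil (clock t) else P)"

lemma Filt_mono:
  assumes "s \<in> {0..T}" "s \<le> t"
  shows "sets (Filt s) \<subseteq> sets (Filt t)"
proof (cases "t < T")
  case True
  then show ?thesis using assms natural_filtration_mono[OF clock_mono, of s t P W] by (simp add: Filt_def)
next
  case False
  then show ?thesis using Fil_sets by (auto simp: Filt_def)
qed

lemma filtration_Filt: "filtration_on T P Filt"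
proof -
  have "subalgebra P P" by (simp add: subalgebra_def)
  then have "subalgebra P (Filt t)" for t using subalgebra_Fil by (simp add: Filt_def)
  then show ?thesis unfolding filtration_on_def using Filt_mono by blast
qed

lemma measurable_process:
  assumes t: "t \<in> {0..T}"
  shows "AY t \<in> borel_measurable (Filt t)"
proof (cases "t < T")
  case True
  then have "Y (clock t) \<in> borel_measurable (Filt t)"
    using t measurable_Y[OF clock_nonneg] by (simp add: Filt_def)
  then show ?thesis
    by (rule measurable_cong[THEN iffD1, rotated]) (use True t process_eq in \<open>simp add: Filt_def\<close>)
next
  case False
  then have "t = T" using t by simp
  have "X \<in> borel_measurable (Filt t)" using False by (simp add: Filt_def)
  then show ?thesis
    by (rule measurable_cong[THEN iffD1, rotated]) (use \<open>t = T\<close> process_eq in \<open>simp add: Filt_def\<close>)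
qed

lemma integrable_process:
  assumes t: "t \<in> {0..T}"
  shows "integrable P (AY t)"
proof (cases "t < T")
  case True
  then show ?thesis
    using t process_eq integrable_Y[OF clock_nonneg, of t]
    by (subst Bochner_Integration.integrable_cong[where g = "Y (clock t)"]) auto
next
  case False
  then show ?thesis
    using t process_eq integrable_X
    by (subst Bochner_Integration.integrable_cong[where g = X]) auto
qed

lemma subalgebra_Filt: "t \<in> {0..T} \<Longrightarrow> subalgebra P (Filt t)"
  using filtration_Filt by (auto simp: filtration_on_def)

lemma integral_process:
  assumes t: "t \<in> {0..T}" and A: "A \<in> sets (Filt t)"
  shows "(\<integral>\<omega>. indicator A \<omega> * AY t \<omega> \<partial>P) = (\<integral>\<omega>. indicator A \<omega> * X \<omega> \<partial>P)"
proof (cases "t < T")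
  case True
  have "(\<integral>\<omega>. indicator A \<omega> * AY t \<omega> \<partial>P) = (\<integral>\<omega>. indicator A \<omega> * Y (clock t) \<omega> \<partial>P)"
    using True t process_eq by (intro Bochner_Integration.integral_cong) auto
  also have "\<dots> = (\<integral>\<omega>. indicator A \<omega> * X \<omega> \<partial>P)"
    using A t True clock_nonneg by (intro integral_Y) (auto simp: Filt_def)
  finally show ?thesis .
next
  case False
  then show ?thesis using t process_eq by (intro Bochner_Integration.integral_cong) auto
qed

lemma martingale_process: "martingale_on T P Filt AY"
  unfolding martingale_on_def
proof (intro conjI ballI impI measurable_process integrable_process)
  fix s t assume st: "s \<in> {0..T}" "t \<in> {0..T}" "s \<le> t"
  interpret finite_measure_subalgebra P "Filt s"
    by unfold_locales (rule subalgebra_Filt[OF st(1)])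
  show "AE \<omega> in P. real_cond_exp P (Filt s) (AY t) \<omega> = AY s \<omega>"
  proof (rule real_cond_exp_charact)
    fix A assume A: "A \<in> sets (Filt s)"
    then have A': "A \<in> sets (Filt t)" using Filt_mono[OF st(1,3)] by blast
    show "(\<integral>\<omega>\<in>A. AY t \<omega> \<partial>P) = (\<integral>\<omega>\<in>A. AY s \<omega> \<partial>P)"
      using integral_process[OF st(1) A] integral_process[OF st(2) A']
      by (simp add: set_lebesgue_integral_def)
  qed (use st measurable_process integrable_process in auto)
qed

lemma cadlag_process:
  assumes \<omega>: "\<omega> \<in> space P" "hits (ay_region \<beta>) \<omega>"
  shows "cadlag_on T (\<lambda>t. AY t \<omega>)"
proof -
  interpret f: azema_yor_path "\<lambda>u. W u \<omega>" \<beta> by (rule ay_path[OF \<omega>(1)])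
  let ?\<tau> = "f.hit_time (ay_region \<beta>)"
  note \<tau> = f.hit_time_props[OF ay_region_props(1) \<omega>(2)]
  let ?c = "\<lambda>t. t / (T - t)"
  have lim: "((\<lambda>t. AY t \<omega>) \<longlongrightarrow> AY t \<omega>) F"
    if t: "0 \<le> t" "t < T" and F: "F \<le> at t" "eventually (\<lambda>u. u \<in> {0..<T}) F" for t F
  proof -
    have "((\<lambda>t. min ?\<tau> (?c t)) \<longlongrightarrow> min ?\<tau> (?c t)) (at t)"
      using t by (intro tendsto_intros) auto
    then have "((\<lambda>t. min ?\<tau> (?c t)) \<longlongrightarrow> min ?\<tau> (?c t)) F" by (rule tendsto_mono[OF F(1)])
    moreover have "eventually (\<lambda>u. min ?\<tau> (?c u) \<in> {0..}) F"
      using F(2) by eventually_elim (use \<tau>(1) in auto)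
    ultimately have "((\<lambda>t. W (min ?\<tau> (?c t)) \<omega>) \<longlongrightarrow> W (min ?\<tau> (?c t)) \<omega>) F"
      using f.cont \<tau>(1) t by (intro continuous_on_tendsto_compose[of "{0..}" "\<lambda>u. W u \<omega>"]) auto
    moreover have "eventually (\<lambda>t. W (min ?\<tau> (?c t)) \<omega> = AY t \<omega>) F"
      using F(2) by eventually_elim (use process_min[OF \<omega>] in auto)
    ultimately show ?thesis
      using process_min[OF \<omega> t] by (simp add: Lim_transform_eventually)
  qed
  show ?thesis
    unfolding cadlag_on_def
  proof safe
    fix t assume "t \<in> {0..<T}"
    then have t: "0 \<le> t" "t < T" by auto
    have "eventually (\<lambda>u. u \<in> {0..<T}) (at_right t)"
      using eventually_at_right_real[OF t(2)] by eventually_elim (use t in auto)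
    then show "((\<lambda>t. AY t \<omega>) \<longlongrightarrow> AY t \<omega>) (at_right t)" by (intro lim t) (simp_all add: at_le)
  next
    fix t assume "t \<in> {0<..T}"
    then have t: "0 < t" "t \<le> T" by auto
    show "\<exists>l. ((\<lambda>t. AY t \<omega>) \<longlongrightarrow> l) (at_left t)"
    proof (cases "t < T")
      case True
      have "eventually (\<lambda>u. u \<in> {0..<T}) (at_left t)"
        using eventually_at_left_real[OF t(1)] by eventually_elim (use t in auto)
      then show ?thesis using t True by (intro exI[of _ "AY t \<omega>"] lim) (simp_all add: at_le)
    next
      case False
      then have tT: "t = T" using t by simp
      \<comment> \<open>The solution of \<open>a / (T - a) = \<tau>\<close>. After time
        \<open>a\<close> the process is frozen, which gives the left limit at
        \<open>T\<close>.\<close>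
      define a where "a = T * ?\<tau> / (1 + ?\<tau>)"
      have a: "0 \<le> a" "a < T" using \<tau>(1) T by (auto simp: a_def field_simps)
      have "AY u \<omega> = W ?\<tau> \<omega>" if u: "a < u" "u < T" for u
      proof -
        have "T * ?\<tau> < u * (1 + ?\<tau>)" using u(1) \<tau>(1) by (simp add: a_def field_simps)
        then have "?\<tau> * (T - u) \<le> u" by (simp add: algebra_simps)
        then have "?\<tau> \<le> ?c u" using u by (simp add: field_simps)
        then show ?thesis using process_min[OF \<omega>, of u] u a by simp
      qed
      then have "eventually (\<lambda>u. AY u \<omega> = W ?\<tau> \<omega>) (at_left T)"
        using eventually_at_left_real[OF a(2)] by (auto elim: eventually_mono)
      then show ?thesis unfolding tT by (intro exI tendsto_eventually)
    qed
  qed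
qed

lemma running_max_process:
  assumes \<omega>: "\<omega> \<in> space P" "hits (ay_region \<beta>) \<omega>"
  shows "running_max AY T \<omega> = \<beta> (X \<omega>)"
proof -
  interpret f: azema_yor_path "\<lambda>u. W u \<omega>" \<beta> by (rule ay_path[OF \<omega>(1)])
  let ?\<tau> = "f.hit_time (ay_region \<beta>)"
  let ?c = "\<lambda>t. t / (T - t)"
  note \<tau> = f.hit_time_props[OF ay_region_props(1) \<omega>(2)]
  have X\<tau>: "X \<omega> = W ?\<tau> \<omega>" using \<omega> by (simp add: X_def stop_value_def)
  obtain v where v: "v \<in> {0..?\<tau>}" "path_max (\<lambda>u. W u \<omega>) ?\<tau> = W v \<omega>"
    using path_max_attained[OF f.cont \<tau>(1)] by blast
  \<comment> \<open>The time at which the clock shows \<open>v\<close>. It is smaller than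
    \<open>T\<close>, so the maximum of the Brownian path up to \<tau> is attained by the
    process.\<close>
  define u where "u = T * v / (1 + v)"
  have u: "0 \<le> u" "u < T" using v T by (auto simp: u_def field_simps)
  have "T - u = T / (1 + v)" using v by (simp add: u_def field_simps)
  moreover have "1 + v \<noteq> 0" using v by simp
  ultimately have cu: "?c u = v" using T by (simp only:) (simp add: u_def)
  have "running_max AY T \<omega> = path_max (\<lambda>u. W u \<omega>) ?\<tau>"
    unfolding running_max_def
  proof (rule cSup_eq_maximum)
    show "path_max (\<lambda>u. W u \<omega>) ?\<tau> \<in> (\<lambda>u. AY u \<omega>) ` {0..T}"
      using process_min[OF \<omega> u] cu u v by (intro image_eqI[of _ _ u]) auto
    fix x assume "x \<in> (\<lambda>u. AY u \<omega>) ` {0..T}"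
    then obtain t where t: "0 \<le> t" "t \<le> T" "x = AY t \<omega>" by auto
    show "x \<le> path_max (\<lambda>u. W u \<omega>) ?\<tau>"
    proof (cases "t < T")
      case True
      then have "x = W (min ?\<tau> (?c t)) \<omega>" using process_min[OF \<omega> t(1)] t by simp
      then show ?thesis using \<tau>(1) t True path_max_ge[OF f.cont, of "min ?\<tau> (?c t)" ?\<tau>] by auto
    next
      case False
      then have "x = W ?\<tau> \<omega>" using t process_eq(2)[OF \<omega>(1)] X\<tau> by simp
      then show ?thesis using \<tau>(1) path_max_ge[OF f.cont, of ?\<tau> ?\<tau>] by simp
    qed
  qed
  then show ?thesis using f.ay_hit(2)[OF \<omega>(2)] X\<tau> by simp
qed

lemma admissible_process: "admissible T \<mu> P AY"
  unfolding admissible_def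
proof (intro conjI exI)
  show "prob_space P" by (rule prob_space_axioms)
  show "filtration_on T P Filt" by (rule filtration_Filt)
  show "martingale_on T P Filt AY" by (rule martingale_process)
  show "uniformly_integrable_on P {0..T} AY"
    unfolding uniformly_integrable_on_def
  proof (intro conjI ballI allI impI integrable_process)
    fix e :: real assume "0 < e"
    from uniformly_integrable_closed_martingale[OF integrable_X this]
    obtain K where K: "\<And>F S. subalgebra P F \<Longrightarrow> S \<in> borel_measurable F \<Longrightarrow> integrable P S \<Longrightarrow>
      (\<forall>A\<in>sets F. (\<integral>\<omega>. indicator A \<omega> * S \<omega> \<partial>P) = (\<integral>\<omega>. indicator A \<omega> * X \<omega> \<partial>P)) \<Longrightarrow>
      (\<integral>\<omega>. \<bar>S \<omega>\<bar> * indicator {\<omega>. K \<le> \<bar>S \<omega>\<bar>} \<omega> \<partial>P) \<le> e" by blast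
    show "\<exists>K. \<forall>i\<in>{0..T}. (\<integral>\<omega>. \<bar>AY i \<omega>\<bar> * indicator {\<omega>. K \<le> \<bar>AY i \<omega>\<bar>} \<omega> \<partial>P) \<le> e"
    proof (intro exI[of _ K] ballI)
      fix i assume i: "i \<in> {0..T}"
      show "(\<integral>\<omega>. \<bar>AY i \<omega>\<bar> * indicator {\<omega>. K \<le> \<bar>AY i \<omega>\<bar>} \<omega> \<partial>P) \<le> e"
        by (rule K[OF subalgebra_Filt[OF i] measurable_process[OF i] integrable_process[OF i]])
          (use integral_process[OF i] in blast)
    qed
  qed
  show "AE \<omega> in P. cadlag_on T (\<lambda>t. AY t \<omega>)"
    using AE_hits_region AE_space by eventually_elim (rule cadlag_process)
  show "AE \<omega> in P. AY 0 \<omega> = 0"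
    using AE_hits_region AE_space
  proof eventually_elim
    case (elim \<omega>)
    interpret f: azema_yor_path "\<lambda>u. W u \<omega>" \<beta> by (rule ay_path[OF elim(2)])
    show ?case using process_min[OF elim(2,1) order_refl T] W_0[OF elim(2)]
        f.hit_time_props(1)[OF ay_region_props(1) elim(1)] by simp
  qed
  have "distr P borel (AY T) = distr P borel X"
    using process_eq(2) by (intro distr_cong) auto
  then show "distr P borel (AY T) = \<mu>" by (simp add: distr_X)
qed

end

end

section \<open>Potentials of supermodular functions and stochastic dominance\<close>

text \<open>Each step keeps the first argument of \<open>F\<close> and moves the second one to the
  image under \<open>b\<close> of the next point; the last step moves it to \<open>s\<close>. For
  \<open>s = b p\<close> this is the sum over a closed cycle, as in the definition of cyclical
  monotonicity.\<close>

fun chain :: "(real \<Rightarrow> real \<Rightarrow> real) \<Rightarrow> (real \<Rightarrow> real) \<Rightarrow> real \<Rightarrow> real list \<Rightarrow> real \<Rightarrow> real" where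
  "chain F b p [] s = F p s - F p (b p)"
| "chain F b p (w # ws) s = F p (b w) - F p (b p) + chain F b w ws s"

lemma chain_append: "chain F b p (us @ m # vs) s = chain F b p us (b m) + chain F b m vs s"
  by (induction us arbitrary: p) auto

locale supermodular_coupling =
  fixes F :: "real \<Rightarrow> real \<Rightarrow> real" and b :: "real \<Rightarrow> real"
  assumes supermodular: "w1 \<le> w2 \<Longrightarrow> s1 \<le> s2 \<Longrightarrow> F w1 s2 + F w2 s1 \<le> F w1 s1 + F w2 s2"
    and mono_F: "mono (F w)" and mono_b: "mono b" and b_ge: "k \<le> b k"
begin

text \<open>If \<open>m\<close> is extremal, the passage from \<open>x\<close> over \<open>m\<close>
  to \<open>v\<close> can be replaced by the direct one from \<open>x\<close> to \<open>v\<close>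
  without decreasing a chain.\<close>

lemma supermodular_swap:
  assumes "(x \<le> m \<and> v \<le> m) \<or> (m \<le> x \<and> m \<le> v)"
  shows "F x (b m) + F m (b v) \<le> F x (b v) + F m (b m)"
  using assms
proof
  assume "x \<le> m \<and> v \<le> m"
  then show ?thesis using supermodular[of x m "b v" "b m"] monoD[OF mono_b, of v m] by linarith
next
  assume "m \<le> x \<and> m \<le> v"
  then show ?thesis using supermodular[of m x "b m" "b v"] monoD[OF mono_b, of m v] by linarith
qed

lemma chain_remove:
  assumes "(\<forall>x\<in>set (q # p # us @ vs). x \<le> m) \<or> (\<forall>x\<in>set (q # p # us @ vs). m \<le> x)"
  shows "chain F b p (us @ m # vs) (b q) \<le> chain F b p (us @ vs) (b q)"
  using assms
proof (induction us arbitrary: p)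
  case Nil
  \<comment> \<open>After \<open>m\<close> the chain goes on to the head of \<open>vs\<close>, or it
    ends at \<open>b q\<close>.\<close>
  then show ?case using supermodular_swap[of p m q] supermodular_swap[of p m "hd vs"] by (cases vs) auto
qed auto

text \<open>Cyclical monotonicity: an element which is extremal in the whole cycle can be removed without
  decreasing the sum.\<close>

lemma chain_cyclic: "chain F b p ws (b p) \<le> 0"
proof (induction "length ws" arbitrary: ws)
  case 0
  then show ?case by simp
next
  case (Suc n)
  then have ne: "ws \<noteq> []" by auto
  \<comment> \<open>The base point \<open>p\<close> has to stay in the cycle. If it is larger than
    all of \<open>ws\<close>, the minimum of \<open>ws\<close> is extremal and can be removed in
    place of the maximum.\<close>
  obtain m where m: "m \<in> set ws" "(\<forall>x\<in>set (p # ws). x \<le> m) \<or> (\<forall>x\<in>set (p # ws). m \<le> x)"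
  proof (cases "p \<le> Max (set ws)")
    case True
    then show ?thesis using ne that[of "Max (set ws)"] by auto
  next
    case False
    have "Min (set ws) \<le> Max (set ws)" using ne by simp
    then have "Min (set ws) \<le> p" using False by simp
    then show ?thesis using ne that[of "Min (set ws)"] by auto
  qed
  obtain us vs where ws: "ws = us @ m # vs" using split_list[OF m(1)] by blast
  have "chain F b p ws (b p) \<le> chain F b p (us @ vs) (b p)"
    unfolding ws using m(2) by (intro chain_remove) (auto simp: ws)
  also have "\<dots> \<le> 0" using Suc by (intro Suc(1)) (simp add: ws)
  finally show ?case .
qed

text \<open>Rockafellar's potential of the graph of \<open>b\<close>, based at \<open>0\<close>.\<close>

definition \<psi> :: "real \<Rightarrow> real" where "\<psi> s = (SUP ws. chain F b 0 ws s)"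

lemma chain_mono: "s \<le> t \<Longrightarrow> chain F b p ws s \<le> chain F b p ws t"
  by (induction ws arbitrary: p) (auto intro: monoD[OF mono_F])

text \<open>Since \<open>F\<close> increases in its second argument, the end \<open>s\<close> may be
  raised to \<open>b s\<close>. The chain can then be closed to a cycle by a step from
  \<open>s\<close> back to the base point, so the supremum is finite even for \<open>s\<close>
  outside the range of \<open>b\<close>.\<close>

lemma bdd_chain: "bdd_above (range (\<lambda>ws. chain F b 0 ws s))"
proof (rule bdd_aboveI2)
  fix ws
  have "chain F b 0 ws s \<le> chain F b 0 ws (b s)" by (intro chain_mono b_ge)
  also have "chain F b 0 ws (b s) = chain F b 0 (ws @ [s]) (b 0) - (F s (b 0) - F s (b s))"
    by (simp add: chain_append)
  also have "\<dots> \<le> F s (b s) - F s (b 0)" using chain_cyclic[of 0 "ws @ [s]"] by simp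
  finally show "chain F b 0 ws s \<le> F s (b s) - F s (b 0)" .
qed

lemma mono_\<psi>: "mono \<psi>"
  unfolding \<psi>_def by (intro monoI cSUP_mono bdd_chain) (auto intro: chain_mono)

text \<open>A chain that ends at \<open>b w\<close> extends by the point \<open>w\<close> to one
  that ends at \<open>s\<close>.\<close>

lemma \<psi>_le: "F w s - F w (b w) + \<psi> (b w) \<le> \<psi> s"
proof -
  have "\<psi> (b w) \<le> \<psi> s - (F w s - F w (b w))"
    unfolding \<psi>_def[of "b w"]
  proof (rule cSUP_least)
    fix ws
    have "chain F b 0 (ws @ [w]) s \<le> \<psi> s" unfolding \<psi>_def by (intro cSUP_upper bdd_chain) simp
    then show "chain F b 0 ws (b w) \<le> \<psi> s - (F w s - F w (b w))" by (simp add: chain_append)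
  qed simp
  then show ?thesis by simp
qed

definition \<phi> :: "real \<Rightarrow> real" where "\<phi> w = F w (b w) - \<psi> (b w)"

lemma F_le: "F w s \<le> \<phi> w + \<psi> s"
  using \<psi>_le[of w s] by (simp add: \<phi>_def)

lemma F_eq: "F w (b w) = \<phi> w + \<psi> (b w)"
  by (simp add: \<phi>_def)

end

section \<open>Truncation and extended expectations\<close>

definition clamp :: "nat \<Rightarrow> real \<Rightarrow> real" where
  "clamp n x = max (- real n) (min (real n) x)"

lemma clamp_bound: "\<bar>clamp n x\<bar> \<le> real n"
  by (auto simp: clamp_def)

lemma clamp_minus: "clamp n (- x) = - clamp n x"
  by (auto simp: clamp_def)

lemma mono_clamp: "mono (clamp n)"
  by (auto simp: clamp_def intro!: monoI)

lemma measurable_clamp [measurable]: "clamp n \<in> borel_measurable borel"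
  unfolding clamp_def by measurable

lemma clamp_eventually: "eventually (\<lambda>n. clamp n x = x) sequentially"
proof -
  have "eventually (\<lambda>n. \<bar>x\<bar> \<le> real n) sequentially" by (rule eventually_nat_ge_real)
  then show ?thesis by eventually_elim (auto simp: clamp_def)
qed

text \<open>Raising the level lowers a term only if it is below \<open>- n\<close>; the other
  truncated term is at most \<open>n\<close>, so the sum was at most 0. A positive sum therefore
  does not decrease.\<close>

lemma clamp_add_mono: "ennreal (clamp n u + clamp n v) \<le> ennreal (clamp (Suc n) u + clamp (Suc n) v)"
proof (cases "0 < clamp n u + clamp n v")
  case True
  then show ?thesis by (intro ennreal_leI) (auto simp: clamp_def max_def min_def split: if_splits)
qed (simp add: ennreal_neg)

text \<open>The truncated sums have the same sign as \<open>U + V\<close> and increase in absolute value, so no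
  integrability of \<open>U\<close> or \<open>V\<close> alone is needed.\<close>

lemma (in prob_space) ext_expectation_clamp:
  fixes U V :: "'a \<Rightarrow> real"
  assumes [measurable]: "U \<in> borel_measurable M" "V \<in> borel_measurable M"
    and w: "has_ext_expectation M (\<lambda>x. U x + V x) w"
  shows "(\<lambda>n. ereal ((\<integral>x. clamp n (U x) \<partial>M) + (\<integral>x. clamp n (V x) \<partial>M))) \<longlonglongrightarrow> w"
proof -
  have lim: "(\<lambda>n. \<integral>\<^sup>+x. ennreal (clamp n (U x) + clamp n (V x)) \<partial>M) \<longlonglongrightarrow> (\<integral>\<^sup>+x. ennreal (U x + V x) \<partial>M)"
    if [measurable]: "U \<in> borel_measurable M" "V \<in> borel_measurable M" for U V :: "'a \<Rightarrow> real"
  proof (rule nn_integral_LIMSEQ)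
    show "incseq (\<lambda>n x. ennreal (clamp n (U x) + clamp n (V x)))"
      by (intro incseq_SucI le_funI clamp_add_mono)
    show "(\<lambda>n. ennreal (clamp n (U x) + clamp n (V x))) \<longlonglongrightarrow> ennreal (U x + V x)" for x
    proof (rule tendsto_eventually)
      show "eventually (\<lambda>n. ennreal (clamp n (U x) + clamp n (V x)) = ennreal (U x + V x)) sequentially"
        using clamp_eventually[of "U x"] clamp_eventually[of "V x"] by eventually_elim simp
    qed
  qed measurable
  let ?p = "\<lambda>n. \<integral>\<^sup>+x. ennreal (clamp n (U x) + clamp n (V x)) \<partial>M"
  let ?m = "\<lambda>n. \<integral>\<^sup>+x. ennreal (- (clamp n (U x) + clamp n (V x))) \<partial>M"
  have ic: "integrable M (\<lambda>x. clamp n (Z x))" if [measurable]: "Z \<in> borel_measurable M" for Z n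
    by (rule integrable_const_bound[where B = "real n"]) (use clamp_bound in auto)
  have p: "?p \<longlonglongrightarrow> (\<integral>\<^sup>+x. ennreal (U x + V x) \<partial>M)" by (rule lim) measurable
  have m: "?m \<longlonglongrightarrow> (\<integral>\<^sup>+x. ennreal (- (U x + V x)) \<partial>M)"
    using lim[of "\<lambda>x. - U x" "\<lambda>x. - V x"] by (simp add: clamp_minus algebra_simps)
  have eq: "ereal ((\<integral>x. clamp n (U x) \<partial>M) + (\<integral>x. clamp n (V x) \<partial>M)) = enn2ereal (?p n) - enn2ereal (?m n)" for n
  proof -
    have i: "integrable M (\<lambda>x. clamp n (U x) + clamp n (V x))"
      by (intro Bochner_Integration.integrable_add ic) measurable
    have fin: "?p n \<noteq> \<infinity>" "?m n \<noteq> \<infinity>"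
      using i real_integrable_def by blast+
    have "(\<integral>x. clamp n (U x) \<partial>M) + (\<integral>x. clamp n (V x) \<partial>M) = (\<integral>x. clamp n (U x) + clamp n (V x) \<partial>M)"
      by (subst Bochner_Integration.integral_add) (auto intro: ic)
    also have "\<dots> = enn2real (?p n) - enn2real (?m n)" by (rule real_lebesgue_integral_def[OF i])
    finally show ?thesis using fin
      by (cases "?p n" rule: ennreal_cases; cases "?m n" rule: ennreal_cases) auto
  qed
  have "(\<lambda>n. enn2ereal (?p n) - enn2ereal (?m n)) \<longlonglongrightarrow> w"
    unfolding conjunct2[OF w[unfolded has_ext_expectation_def]]
  proof (rule tendsto_diff_ereal_general)
    show "(\<lambda>n. enn2ereal (?p n)) \<longlonglongrightarrow> enn2ereal (\<integral>\<^sup>+x. ennreal (U x + V x) \<partial>M)" by (intro tendsto_intros p)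
    show "(\<lambda>n. enn2ereal (?m n)) \<longlonglongrightarrow> enn2ereal (\<integral>\<^sup>+x. ennreal (- (U x + V x)) \<partial>M)" by (intro tendsto_intros m)
    show "\<not> (enn2ereal (\<integral>\<^sup>+x. ennreal (U x + V x) \<partial>M) = \<infinity> \<and> enn2ereal (\<integral>\<^sup>+x. ennreal (- (U x + V x)) \<partial>M) = \<infinity> \<or>
      enn2ereal (\<integral>\<^sup>+x. ennreal (U x + V x) \<partial>M) = - \<infinity> \<and> enn2ereal (\<integral>\<^sup>+x. ennreal (- (U x + V x)) \<partial>M) = - \<infinity>)"
      using w unfolding has_ext_expectation_def by (auto simp: enn2ereal_eq_top_iff)
  qed
  then show ?thesis unfolding eq .
qed

lemma has_ext_expectation_cong_AE:
  assumes "AE x in M. U x = V x"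
  shows "has_ext_expectation M U w \<longleftrightarrow> has_ext_expectation M V w"
proof -
  have "(\<integral>\<^sup>+x. ennreal (U x) \<partial>M) = (\<integral>\<^sup>+x. ennreal (V x) \<partial>M)"
    "(\<integral>\<^sup>+x. ennreal (- U x) \<partial>M) = (\<integral>\<^sup>+x. ennreal (- V x) \<partial>M)"
    using assms by (auto intro!: nn_integral_cong_AE elim: eventually_mono)
  then show ?thesis by (simp add: has_ext_expectation_def)
qed

text \<open>A value other than minus infinity means that the negative part of \<open>U\<close> has a
  finite integral. This passes to \<open>V\<close>, whose expectation is thereby free of the
  indeterminate difference.\<close>

lemma ext_expectation_mono:
  assumes v: "has_ext_expectation M U v" "v \<noteq> - \<infinity>" and le: "AE x in M. U x \<le> V x"
  shows "\<exists>w. has_ext_expectation M V w \<and> v \<le> w"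
proof -
  let ?p = "\<lambda>U. \<integral>\<^sup>+x. ennreal (U x) \<partial>M"
  have p: "?p U \<le> ?p V" using le by (intro nn_integral_mono_AE) (auto elim: eventually_mono intro: ennreal_leI)
  have m: "?p (\<lambda>x. - V x) \<le> ?p (\<lambda>x. - U x)"
    using le by (intro nn_integral_mono_AE, eventually_elim) (simp add: ennreal_leI)
  have "?p (\<lambda>x. - U x) \<noteq> \<infinity>"
  proof
    assume i: "?p (\<lambda>x. - U x) = \<infinity>"
    then have "?p U \<noteq> \<infinity>" using v(1) by (auto simp: has_ext_expectation_def)
    then have "v = - \<infinity>" using v(1) i unfolding has_ext_expectation_def
      by (cases "?p U" rule: ennreal_cases) auto
    with v(2) show False by simp
  qed
  then have "?p (\<lambda>x. - V x) \<noteq> \<infinity>" using m by (auto simp: top_unique)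
  moreover have "v \<le> enn2ereal (?p V) - enn2ereal (?p (\<lambda>x. - V x))"
    using v(1) p m unfolding has_ext_expectation_def by (auto intro!: ereal_minus_mono simp: less_eq_ennreal.rep_eq)
  ultimately show ?thesis unfolding has_ext_expectation_def by blast
qed

section \<open>Stochastic dominance in integrated form\<close>

lemma nn_integral_layer_cake:
  fixes V :: "'a \<Rightarrow> real"
  assumes "sigma_finite_measure M" and [measurable]: "V \<in> borel_measurable M"
  shows "(\<integral>\<^sup>+x. ennreal (V x) \<partial>M) = (\<integral>\<^sup>+c. indicator {0..} c * emeasure M {x \<in> space M. c < V x} \<partial>lborel)"
proof -
  interpret sigma_finite_measure M by fact
  interpret pair_sigma_finite M lborel
    by (simp add: pair_sigma_finite_def assms lborel.sigma_finite_measure_axioms)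
  have "(\<integral>\<^sup>+x. ennreal (V x) \<partial>M) = (\<integral>\<^sup>+x. (\<integral>\<^sup>+c. indicator {0..<V x} c \<partial>lborel) \<partial>M)"
  proof (rule nn_integral_cong)
    show "ennreal (V x) = (\<integral>\<^sup>+c. indicator {0..<V x} c \<partial>lborel)" for x
      by (cases "0 \<le> V x") (simp_all add: ennreal_neg)
  qed
  also have "\<dots> = (\<integral>\<^sup>+x. (\<integral>\<^sup>+c. indicator {0..} c * indicator {x \<in> space M. c < V x} x \<partial>lborel) \<partial>M)"
    by (intro nn_integral_cong) (auto simp: indicator_def)
  also have "\<dots> = (\<integral>\<^sup>+c. (\<integral>\<^sup>+x. indicator {0..} c * indicator {x \<in> space M. c < V x} x \<partial>M) \<partial>lborel)"
  proof (rule Fubini'[symmetric])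
    have "(\<lambda>p. indicator {p \<in> space (M \<Otimes>\<^sub>M lborel). snd p < V (fst p)} p * indicator {0..} (snd p) :: ennreal)
        \<in> borel_measurable (M \<Otimes>\<^sub>M lborel)"
      by measurable
    then show "(\<lambda>(x, c). indicator {0..} c * indicator {x \<in> space M. c < V x} x :: ennreal) \<in> borel_measurable (M \<Otimes>\<^sub>M lborel)"
      by (rule measurable_cong[THEN iffD1, rotated]) (auto simp: indicator_def space_pair_measure)
  qed
  also have "\<dots> = (\<integral>\<^sup>+c. indicator {0..} c * emeasure M {x \<in> space M. c < V x} \<partial>lborel)"
    by (intro nn_integral_cong) (simp add: nn_integral_cmult)
  finally show ?thesis .
qed

lemma (in prob_space) measure_ge_limit:
  fixes X :: "'a \<Rightarrow> real"
  assumes [measurable]: "X \<in> borel_measurable M"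
  shows "(\<lambda>n. prob {x \<in> space M. a - 1 / real (Suc n) < X x}) \<longlonglongrightarrow> prob {x \<in> space M. X x \<in> {a..}}"
proof -
  have "(\<lambda>n. prob {x \<in> space M. a - 1 / real (Suc n) < X x}) \<longlonglongrightarrow>
      prob (\<Inter>n. {x \<in> space M. a - 1 / real (Suc n) < X x})"
  proof (rule finite_Lim_measure_decseq)
    show "decseq (\<lambda>n. {x \<in> space M. a - 1 / real (Suc n) < X x})"
    proof (rule decseq_SucI, safe)
      fix n x assume "a - 1 / real (Suc (Suc n)) < X x"
      moreover have "1 / real (Suc (Suc n)) \<le> 1 / real (Suc n)" by (intro divide_left_mono) auto
      ultimately show "a - 1 / real (Suc n) < X x" by linarith
    qed
  qed auto
  moreover have "(\<forall>n. a - 1 / real (Suc n) < y) \<longleftrightarrow> a \<le> y" for y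
  proof
    assume y: "\<forall>n. a - 1 / real (Suc n) < y"
    show "a \<le> y"
    proof (rule ccontr)
      assume "\<not> a \<le> y"
      then have "0 < a - y" by simp
      then obtain n where "1 / real (Suc n) < a - y" using nat_approx_posE by blast
      moreover have "a - 1 / real (Suc n) < y" using y by blast
      ultimately show False by linarith
    qed
  next
    assume y: "a \<le> y"
    show "\<forall>n. a - 1 / real (Suc n) < y"
    proof
      fix n
      have "0 < 1 / real (Suc n)" by simp
      then show "a - 1 / real (Suc n) < y" using y by linarith
    qed
  qed
  then have "(\<Inter>n. {x \<in> space M. a - 1 / real (Suc n) < X x}) = {x \<in> space M. X x \<in> {a..}}"
    unfolding atLeast_iff by blast
  ultimately show ?thesis by simp
qed

text \<open>The superlevel sets of a monotone \<open>h\<close> are upward closed, hence half lines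
  or trivial. As \<open>h\<close> may jump, closed half lines occur too, and these are limits of the
  open ones in the assumption. The layer cake formula, applied to the nonnegative
  \<open>h + B\<close>, turns the comparison of tails into one of integrals.\<close>

lemma stochastic_dominance:
  fixes Y :: "'a \<Rightarrow> real" and Z :: "'b \<Rightarrow> real" and h :: "real \<Rightarrow> real"
  assumes "prob_space M" "prob_space N" and [measurable]: "Y \<in> borel_measurable M" "Z \<in> borel_measurable N"
    and dom: "\<And>c. measure M {x \<in> space M. c < Y x} \<le> measure N {x \<in> space N. c < Z x}"
    and h: "mono h" "\<And>x. \<bar>h x\<bar> \<le> B"
  shows "(\<integral>x. h (Y x) \<partial>M) \<le> (\<integral>x. h (Z x) \<partial>N)"
proof -
  interpret M: prob_space M by fact
  interpret N: prob_space N by fact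
  have [measurable]: "h \<in> borel_measurable borel" by (rule borel_measurable_mono[OF h(1)])
  have up: "measure M {x \<in> space M. Y x \<in> S} \<le> measure N {x \<in> space N. Z x \<in> S}"
    if S: "\<And>x y. x \<in> S \<Longrightarrow> x \<le> y \<Longrightarrow> y \<in> S" for S
  proof -
    consider "S = {}" | "S = UNIV" | a where "S = {a<..}" | a where "S = {a..}"
    proof (cases "S = {} \<or> \<not> bdd_below S")
      case True
      have "S = UNIV" if nb: "\<not> bdd_below S"
      proof safe
        fix x
        obtain y where "y \<in> S" "y \<le> x" using nb unfolding bdd_below_def by (metis linear)
        then show "x \<in> S" using S by blast
      qed simp
      then show ?thesis using True that(1,2) by metis
    next
      case False
      define a where "a = Inf S"
      have ge: "a \<le> x" if "x \<in> S" for x unfolding a_def using False that by (intro cInf_lower) auto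
      have gt: "x \<in> S" if "a < x" for x
      proof -
        have "\<exists>y\<in>S. y < x" using that False unfolding a_def by (subst (asm) cInf_less_iff) auto
        then show ?thesis using S by (meson less_imp_le)
      qed
      show ?thesis
      proof (cases "a \<in> S")
        case True
        then have "S = {a..}" using ge S by auto
        then show ?thesis by (rule that(4))
      next
        case False
        then have "S = {a<..}" using ge gt by (force simp: less_le)
        then show ?thesis by (rule that(3))
      qed
    qed
    then show ?thesis
    proof cases
      case 2
      then show ?thesis by (simp add: M.prob_space N.prob_space)
    next
      case (3 a)
      then show ?thesis using dom[of a] by simp
    next
      case (4 a)
      show ?thesis unfolding 4
        by (rule LIMSEQ_le[OF M.measure_ge_limit[OF assms(3)] N.measure_ge_limit[OF assms(4)]]) (use dom in auto)
    qed simp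
  qed
  have B: "0 \<le> h x + B" "h x + B \<le> 2 * B" for x using h(2)[of x] by auto
  have iM: "integrable M (\<lambda>x. h (Y x))" and iN: "integrable N (\<lambda>x. h (Z x))"
    by (intro M.integrable_const_bound[where B = B] N.integrable_const_bound[where B = B] AE_I2; use h(2) in simp)+
  have "(\<integral>\<^sup>+x. ennreal (h (Y x) + B) \<partial>M) \<le> (\<integral>\<^sup>+x. ennreal (h (Z x) + B) \<partial>N)"
  proof (subst nn_integral_layer_cake[OF M.sigma_finite_measure_axioms],
      (measurable; fail), subst nn_integral_layer_cake[OF N.sigma_finite_measure_axioms], (measurable; fail),
      intro nn_integral_mono mult_left_mono)
    fix c
    have "measure M {x \<in> space M. Y x \<in> {y. c < h y + B}} \<le> measure N {x \<in> space N. Z x \<in> {y. c < h y + B}}"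
    proof (rule up)
      fix x y :: real assume "x \<in> {y. c < h y + B}" "x \<le> y"
      then show "y \<in> {y. c < h y + B}" using monoD[OF h(1), of x y] by simp
    qed
    then show "emeasure M {x \<in> space M. c < h (Y x) + B} \<le> emeasure N {x \<in> space N. c < h (Z x) + B}"
      by (simp add: M.emeasure_eq_measure N.emeasure_eq_measure)
  qed simp
  moreover have "(\<integral>\<^sup>+x. ennreal (h (Y x) + B) \<partial>M) = ennreal ((\<integral>x. h (Y x) \<partial>M) + B)"
    using iM B by (subst nn_integral_eq_integral) (auto simp: M.prob_space)
  moreover have "(\<integral>\<^sup>+x. ennreal (h (Z x) + B) \<partial>N) = ennreal ((\<integral>x. h (Z x) \<partial>N) + B)"
    using iN B by (subst nn_integral_eq_integral) (auto simp: N.prob_space)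
  moreover have "0 \<le> (\<integral>x. h (Z x) \<partial>N) + B"
  proof -
    have "0 \<le> (\<integral>x. h (Z x) + B \<partial>N)" using B by simp
    then show ?thesis using iN by (simp add: N.prob_space)
  qed
  ultimately show ?thesis by (simp add: ennreal_le_iff)
qed

section \<open>Doob's maximal inequality\<close>

text \<open>Multiples of \<open>T\<close> rather than rational times, so that \<open>T\<close>
  itself belongs to the grid: right continuity gives no access to the endpoint from other grid
  points.\<close>

definition grid_times :: "real \<Rightarrow> real set" where "grid_times T = (*) T ` (\<rat> \<inter> {0..1})"

lemma grid_times: "countable (grid_times T)" "0 \<le> T \<Longrightarrow> grid_times T \<subseteq> {0..T}" "grid_times T \<noteq> {}" "T \<in> grid_times T"
proof -
  show "countable (grid_times T)" by (simp add: grid_times_def countable_rat)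
  show "T \<in> grid_times T" unfolding grid_times_def by (rule image_eqI[of _ _ 1]) auto
  then show "grid_times T \<noteq> {}" by blast
  show "grid_times T \<subseteq> {0..T}" if "0 \<le> T" using that by (auto simp: grid_times_def mult_left_le)
qed

lemma cadlag_exceeds_on_grid:
  assumes f: "cadlag_on T f" and T: "0 < T" and u: "u \<in> {0..T}" "c < f u"
  shows "\<exists>q\<in>grid_times T. c < f q"
proof (cases "u = T")
  case True
  then show ?thesis using u grid_times(4) by blast
next
  case False
  then have uT: "0 \<le> u" "u < T" using u by auto
  have "(f \<longlongrightarrow> f u) (at_right u)" using f uT by (auto simp: cadlag_on_def)
  then have "eventually (\<lambda>v. c < f v) (at_right u)" using u(2) by (rule order_tendstoD)
  then obtain d where d: "u < d" "\<And>v. u < v \<Longrightarrow> v < d \<Longrightarrow> c < f v"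
    using uT by (auto simp: eventually_at_right[OF uT(2)])
  have "u / T < min d T / T" using d uT T by (intro divide_strict_right_mono) auto
  then obtain x where x: "x \<in> \<rat>" "u / T < x" "x < min d T / T" using Rats_dense_in_real by blast
  then have tx: "u < T * x" "T * x < min d T" using T by (simp_all add: field_simps)
  have "0 \<le> u / T" "min d T / T \<le> 1" using uT T by auto
  then have "x \<in> {0..1}" using x by auto
  then have "T * x \<in> grid_times T" using x(1) by (auto simp: grid_times_def)
  then show ?thesis using d(2) tx by auto
qed

text \<open>One-sided limits bound the path near every point, and bisection makes the bound global.
  Without it the real supremum in \<open>running_max\<close> would be unspecified.\<close>

lemma cadlag_bdd_above:
  assumes f: "cadlag_on T f" and T: "0 < T"
  shows "bdd_above (f ` {0..T})"
proof -
  have "0 \<le> T" using T by simp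
  then have "bdd_above (f ` ({0..T} \<inter> {0..T}))"
  proof (induction rule: Bolzano[of 0 T "\<lambda>a b. bdd_above (f ` ({a..b} \<inter> {0..T}))"])
    case (trans a b c)
    obtain A where A: "\<And>y. y \<in> f ` ({a..b} \<inter> {0..T}) \<Longrightarrow> y \<le> A"
      using trans(1) by (rule bdd_above.E) blast
    obtain B where B: "\<And>y. y \<in> f ` ({b..c} \<inter> {0..T}) \<Longrightarrow> y \<le> B"
      using trans(2) by (rule bdd_above.E) blast
    show ?case
    proof (rule bdd_aboveI2)
      fix x assume x: "x \<in> {a..c} \<inter> {0..T}"
      show "f x \<le> max A B" using A[of "f x"] B[of "f x"] x by (cases "x \<le> b") (auto simp: le_max_iff_disj)
    qed
  next
    case (local x)
    have r: "\<exists>d>0. \<exists>B. \<forall>v. x < v \<and> v < x + d \<and> v \<in> {0..T} \<longrightarrow> f v \<le> B"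
    proof (cases "x < T")
      case True
      then have "(f \<longlongrightarrow> f x) (at_right x)" using f local by (auto simp: cadlag_on_def)
      then have "eventually (\<lambda>v. f v < f x + 1) (at_right x)" by (rule order_tendstoD) simp
      then obtain d where "x < d" "\<And>v. x < v \<Longrightarrow> v < d \<Longrightarrow> f v < f x + 1"
        using eventually_at_right[OF True] by auto
      then show ?thesis by (intro exI[of _ "d - x"] conjI exI[of _ "f x + 1"]) (auto intro: less_imp_le)
    qed (auto intro: exI[of _ 1])
    have l: "\<exists>d>0. \<exists>B. \<forall>v. x - d < v \<and> v < x \<and> v \<in> {0..T} \<longrightarrow> f v \<le> B"
    proof (cases "0 < x")
      case True
      then obtain l where "(f \<longlongrightarrow> l) (at_left x)" using f local by (fastforce simp: cadlag_on_def)
      then have "eventually (\<lambda>v. f v < l + 1) (at_left x)" by (rule order_tendstoD) simp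
      then obtain d where "d < x" "\<And>v. d < v \<Longrightarrow> v < x \<Longrightarrow> f v < l + 1"
        using eventually_at_left[OF True] by auto
      then show ?thesis by (intro exI[of _ "x - d"] conjI exI[of _ "l + 1"]) (auto intro: less_imp_le)
    qed (auto intro: exI[of _ 1])
    obtain d1 B1 where 1: "d1 > 0" "\<And>v. x < v \<Longrightarrow> v < x + d1 \<Longrightarrow> v \<in> {0..T} \<Longrightarrow> f v \<le> B1" using r by blast
    obtain d2 B2 where 2: "d2 > 0" "\<And>v. x - d2 < v \<Longrightarrow> v < x \<Longrightarrow> v \<in> {0..T} \<Longrightarrow> f v \<le> B2" using l by blast
    show ?case
    proof (intro exI[of _ "min d1 d2"] conjI allI impI)
      show "0 < min d1 d2" using 1 2 by simp
      fix a b assume ab: "a \<le> x \<and> x \<le> b \<and> b - a < min d1 d2"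
      show "bdd_above (f ` ({a..b} \<inter> {0..T}))"
      proof (rule bdd_aboveI2)
        fix v assume v: "v \<in> {a..b} \<inter> {0..T}"
        show "f v \<le> max (f x) (max B1 B2)"
          using 1(2)[of v] 2(2)[of v] v ab by (cases v x rule: linorder_cases) auto
      qed
    qed
  qed
  then show ?thesis by simp
qed

text \<open>\<open>running_max\<close> is a supremum over uncountably many times, and paths are
  cadlag only almost surely, so its measurability is not evident. This countable version is
  measurable and almost surely equal to it; in \<open>ereal\<close> the supremum makes sense without
  boundedness.\<close>

definition grid_max :: "real \<Rightarrow> (real \<Rightarrow> 'a \<Rightarrow> real) \<Rightarrow> 'a \<Rightarrow> real" where
  "grid_max T M \<omega> = real_of_ereal (SUP q\<in>grid_times T. ereal (M q \<omega>))"

lemma measurable_grid_max: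
  assumes "0 \<le> T" "\<And>t. t \<in> {0..T} \<Longrightarrow> M t \<in> borel_measurable Q"
  shows "grid_max T M \<in> borel_measurable Q"
proof -
  have "(\<lambda>\<omega>. SUP q\<in>grid_times T. ereal (M q \<omega>)) \<in> borel_measurable Q"
    using assms grid_times(2)[OF assms(1)]
    by (intro borel_measurable_SUP grid_times(1) borel_measurable_ereal) auto
  then show ?thesis unfolding grid_max_def[abs_def] by measurable
qed

lemma grid_max_eq:
  assumes f: "cadlag_on T (\<lambda>t. M t \<omega>)" and T: "0 < T"
  shows "grid_max T M \<omega> = running_max M T \<omega>" "c < running_max M T \<omega> \<longleftrightarrow> (\<exists>q\<in>grid_times T. c < M q \<omega>)"
proof -
  note bdd = cadlag_bdd_above[OF f T]
  show 2: "c < running_max M T \<omega> \<longleftrightarrow> (\<exists>q\<in>grid_times T. c < M q \<omega>)" for c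
    unfolding running_max_def using T grid_times(2)[of T] cadlag_exceeds_on_grid[OF f T, of _ c]
    by (subst less_cSUP_iff[OF _ bdd]) auto
  have "(SUP q\<in>grid_times T. ereal (M q \<omega>)) = ereal (running_max M T \<omega>)"
  proof (rule SUP_eqI)
    show "ereal (M q \<omega>) \<le> ereal (running_max M T \<omega>)" if "q \<in> grid_times T" for q
      unfolding running_max_def using that T grid_times(2)[of T] by (auto intro!: cSUP_upper bdd)
    fix y assume y: "\<And>q. q \<in> grid_times T \<Longrightarrow> ereal (M q \<omega>) \<le> y"
    show "ereal (running_max M T \<omega>) \<le> y"
    proof (rule ereal_le_real)
      fix z assume "y \<le> ereal z"
      then have "\<not> z < running_max M T \<omega>" unfolding 2 using y by (meson ereal_less_eq(3) not_le order_trans)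
      then show "ereal (running_max M T \<omega>) \<le> ereal z" by simp
    qed
  qed
  then show "grid_max T M \<omega> = running_max M T \<omega>" by (simp add: grid_max_def)
qed

section \<open>Tails of the maximum of an admissible process\<close>

context
  fixes T :: real and \<mu> :: "real measure" and Q :: "'b measure" and M
  assumes T: "0 < T" and law: "centred_law \<mu>" and adm: "admissible T \<mu> Q M"
begin

interpretation law: centred_law \<mu> by (rule law)
interpretation Q: prob_space Q using adm by (simp add: admissible_def)

lemma adm_measurable: "t \<in> {0..T} \<Longrightarrow> M t \<in> borel_measurable Q"
  and adm_integrable: "t \<in> {0..T} \<Longrightarrow> integrable Q (M t)"
  using adm unfolding admissible_def martingale_on_def by (blast intro: borel_measurable_integrable)+

lemma adm_distr: "distr Q borel (M T) = \<mu>"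
  using adm by (simp add: admissible_def)

text \<open>Doob's maximal inequality, by peeling off the last time \<open>d\<close>: the paths that exceed \<open>c\<close> at \<open>d\<close> only form
  an event of its past, on which \<open>M T\<close> may be replaced by \<open>M d\<close>.\<close>

lemma doob_finite:
  assumes "finite D" "D \<subseteq> {0..T}"
  shows "0 \<le> (\<integral>\<omega>. indicator {\<omega> \<in> space Q. \<exists>q\<in>D. c < M q \<omega>} \<omega> * (M T \<omega> - c) \<partial>Q)"
proof -
  obtain \<F> where F: "filtration_on T Q \<F>" "martingale_on T Q \<F> M" using adm by (auto simp: admissible_def)
  let ?A = "\<lambda>D. {\<omega> \<in> space Q. \<exists>q\<in>D. c < M q \<omega>}"
  have sub: "subalgebra Q (\<F> t)" if "t \<in> {0..T}" for t using F(1) that by (auto simp: filtration_on_def)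
  have sp: "space (\<F> t) = space Q" if "t \<in> {0..T}" for t using sub[OF that] by (simp add: subalgebra_def)
  have T0: "T \<in> {0..T}" using T by simp
  have single: "{\<omega> \<in> space Q. c < M q \<omega>} \<in> sets (\<F> t)" if "q \<in> {0..T}" "t \<in> {0..T}" "q \<le> t" for q t
  proof -
    have "M q \<in> borel_measurable (\<F> q)" using F(2) that by (auto simp: martingale_on_def)
    then have "{\<omega> \<in> space (\<F> q). c < M q \<omega>} \<in> sets (\<F> q)" by measurable
    then have "{\<omega> \<in> space Q. c < M q \<omega>} \<in> sets (\<F> q)" by (simp only: sp[OF that(1)])
    moreover have "sets (\<F> q) \<subseteq> sets (\<F> t)" using F(1) that unfolding filtration_on_def by blast
    ultimately show ?thesis by blast
  qed
  have A_sets: "?A D \<in> sets (\<F> t)" if "finite D" "D \<subseteq> {0..T}" "t \<in> {0..T}" "\<forall>q\<in>D. q \<le> t" for D t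
  proof -
    have "(\<Union>q\<in>D. {\<omega> \<in> space Q. c < M q \<omega>}) \<in> sets (\<F> t)"
      using that by (intro sets.finite_UN single) auto
    moreover have "?A D = (\<Union>q\<in>D. {\<omega> \<in> space Q. c < M q \<omega>})" by auto
    ultimately show ?thesis by simp
  qed
  have mart: "(\<integral>\<omega>. indicator A \<omega> * (M T \<omega> - c) \<partial>Q) = (\<integral>\<omega>. indicator A \<omega> * (M t \<omega> - c) \<partial>Q)"
    if t: "t \<in> {0..T}" and A: "A \<in> sets (\<F> t)" for A t
  proof -
    interpret finite_measure_subalgebra Q "\<F> t" by unfold_locales (rule sub[OF t])
    have AQ: "A \<in> sets Q" using A sub[OF t] by (auto simp: subalgebra_def)
    have "AE \<omega> in Q. real_cond_exp Q (\<F> t) (M T) \<omega> = M t \<omega>" using F(2) t T0 by (auto simp: martingale_on_def)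
    then have "(\<integral>\<omega>. indicator A \<omega> * real_cond_exp Q (\<F> t) (M T) \<omega> \<partial>Q) = (\<integral>\<omega>. indicator A \<omega> * M t \<omega> \<partial>Q)"
      using adm_measurable[OF t] AQ by (intro integral_cong_AE) (auto elim: eventually_mono)
    then have eq: "(\<integral>\<omega>. indicator A \<omega> * M T \<omega> \<partial>Q) = (\<integral>\<omega>. indicator A \<omega> * M t \<omega> \<partial>Q)"
      using real_cond_exp_intA[OF adm_integrable[OF T0] A] by (simp add: set_lebesgue_integral_def)
    have i: "integrable Q (\<lambda>\<omega>. indicator A \<omega> * c)" using AQ by (simp add: Q.emeasure_eq_measure)
    have split: "(\<integral>\<omega>. indicator A \<omega> * (M r \<omega> - c) \<partial>Q) = (\<integral>\<omega>. indicator A \<omega> * M r \<omega> \<partial>Q) - (\<integral>\<omega>. indicator A \<omega> * c \<partial>Q)"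
      if "r \<in> {0..T}" for r
      unfolding right_diff_distrib
      by (rule Bochner_Integration.integral_diff[OF integrable_indicator_mult[OF AQ adm_integrable[OF that]] i])
    show ?thesis unfolding split[OF t] split[OF T0] eq ..
  qed
  show ?thesis
    using assms
  proof (induction D rule: finite_linorder_max_induct)
    case empty
    then show ?case by simp
  next
    case (insert d D)
    then have d: "d \<in> {0..T}" "D \<subseteq> {0..T}" by auto
    let ?E = "{\<omega> \<in> space Q. c < M d \<omega>} - ?A D"
    have AD: "?A D \<in> sets (\<F> d)" using insert d by (intro A_sets) auto
    have E: "?E \<in> sets (\<F> d)" using single[OF d(1) d(1)] AD by auto
    have Q: "?A D \<in> sets Q" "?E \<in> sets Q" using AD E sub[OF d(1)] by (auto simp: subalgebra_def)
    have iT: "integrable Q (\<lambda>\<omega>. M T \<omega> - c)" using adm_integrable[OF T0] by simp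
    have "(\<integral>\<omega>. indicator (?A (insert d D)) \<omega> * (M T \<omega> - c) \<partial>Q) =
        (\<integral>\<omega>. indicator (?A D) \<omega> * (M T \<omega> - c) + indicator ?E \<omega> * (M T \<omega> - c) \<partial>Q)"
      by (intro Bochner_Integration.integral_cong) (auto simp: indicator_def)
    also have "\<dots> = (\<integral>\<omega>. indicator (?A D) \<omega> * (M T \<omega> - c) \<partial>Q) + (\<integral>\<omega>. indicator ?E \<omega> * (M T \<omega> - c) \<partial>Q)"
      by (intro Bochner_Integration.integral_add integrable_indicator_mult Q iT)
    also have "(\<integral>\<omega>. indicator ?E \<omega> * (M T \<omega> - c) \<partial>Q) = (\<integral>\<omega>. indicator ?E \<omega> * (M d \<omega> - c) \<partial>Q)"
      by (rule mart[OF d(1) E])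
    finally have "(\<integral>\<omega>. indicator (?A (insert d D)) \<omega> * (M T \<omega> - c) \<partial>Q) =
      (\<integral>\<omega>. indicator (?A D) \<omega> * (M T \<omega> - c) \<partial>Q) + (\<integral>\<omega>. indicator ?E \<omega> * (M d \<omega> - c) \<partial>Q)" .
    moreover have "0 \<le> (\<integral>\<omega>. indicator ?E \<omega> * (M d \<omega> - c) \<partial>Q)"
      by (intro Bochner_Integration.integral_nonneg) (auto simp: indicator_def)
    ultimately show ?case using insert.IH d(2) by simp
  qed
qed

text \<open>On the event, \<open>(M T - c) + (c - y) = M T - y\<close> is at most the positive part
  of \<open>M T - y\<close>. The level \<open>y\<close> is left free and is optimised in
  \<open>grid_max_dominated\<close>.\<close>

lemma doob_finite_prob:
  assumes D: "finite D" "D \<subseteq> {0..T}" and y: "y < c"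
  shows "(c - y) * measure Q {\<omega> \<in> space Q. \<exists>q\<in>D. c < M q \<omega>} \<le> law.call y"
proof -
  let ?A = "{\<omega> \<in> space Q. \<exists>q\<in>D. c < M q \<omega>}"
  have T0: "T \<in> {0..T}" using T by simp
  have A: "?A \<in> sets Q"
  proof -
    have "(\<Union>q\<in>D. {\<omega> \<in> space Q. c < M q \<omega>}) \<in> sets Q"
    proof (rule sets.finite_UN[OF D(1)])
      fix q assume "q \<in> D"
      then have [measurable]: "M q \<in> borel_measurable Q" using D(2) by (intro adm_measurable) auto
      show "{\<omega> \<in> space Q. c < M q \<omega>} \<in> sets Q" by measurable
    qed
    moreover have "?A = (\<Union>q\<in>D. {\<omega> \<in> space Q. c < M q \<omega>})" by auto
    ultimately show ?thesis by simp
  qed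
  have [measurable]: "M T \<in> borel_measurable Q" by (rule adm_measurable[OF T0])
  have iT: "integrable Q (\<lambda>\<omega>. M T \<omega> - c)" and iy: "integrable Q (\<lambda>\<omega>. max (M T \<omega> - y) 0)"
    using adm_integrable[OF T0] by (auto intro!: integrable_max)
  have i1: "integrable Q (\<lambda>\<omega>. indicator ?A \<omega> * (M T \<omega> - c))" by (rule integrable_indicator_mult[OF A iT])
  have i2: "integrable Q (\<lambda>\<omega>. (c - y) * indicator ?A \<omega>)" using A by (simp add: Q.emeasure_eq_measure)
  have "(c - y) * measure Q ?A \<le> (\<integral>\<omega>. indicator ?A \<omega> * (M T \<omega> - c) \<partial>Q) + (\<integral>\<omega>. (c - y) * indicator ?A \<omega> \<partial>Q)"
    using doob_finite[OF D, of c] A by simp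
  also have "\<dots> = (\<integral>\<omega>. indicator ?A \<omega> * (M T \<omega> - c) + (c - y) * indicator ?A \<omega> \<partial>Q)"
    by (rule Bochner_Integration.integral_add[OF i1 i2, symmetric])
  also have "\<dots> \<le> (\<integral>\<omega>. max (M T \<omega> - y) 0 \<partial>Q)"
    by (intro integral_mono Bochner_Integration.integrable_add i1 i2 iy) (auto simp: indicator_def)
  also have "\<dots> = (\<integral>x. max (x - y) 0 \<partial>distr Q borel (M T))"
    by (rule integral_distr[symmetric]) measurable
  also have "\<dots> = law.call y" by (simp add: adm_distr law.call_def)
  finally show ?thesis .
qed

lemma AE_cadlag: "AE \<omega> in Q. cadlag_on T (\<lambda>t. M t \<omega>)"
  using adm by (simp add: admissible_def)

lemma grid_max_measurable [measurable]: "grid_max T M \<in> borel_measurable Q"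
  using T by (intro measurable_grid_max adm_measurable) auto

text \<open>The events for the first points of an enumeration of the grid increase to the event for
  the whole grid.\<close>

lemma doob_prob:
  assumes y: "y < c"
  shows "(c - y) * measure Q {\<omega> \<in> space Q. c < grid_max T M \<omega>} \<le> law.call y"
proof -
  let ?q = "from_nat_into (grid_times T)"
  let ?A = "\<lambda>n. {\<omega> \<in> space Q. \<exists>q\<in>?q ` {..n}. c < M q \<omega>}"
  have qT: "?q n \<in> {0..T}" for n
    using from_nat_into[OF grid_times(3)[of T], of n] grid_times(2)[of T] T by auto
  have A: "?A n \<in> sets Q" for n
  proof -
    have "{\<omega> \<in> space Q. c < M (?q i) \<omega>} \<in> sets Q" for i
    proof -
      have [measurable]: "M (?q i) \<in> borel_measurable Q" by (rule adm_measurable[OF qT])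
      show ?thesis by measurable
    qed
    moreover have "?A n = (\<Union>i\<in>{..n}. {\<omega> \<in> space Q. c < M (?q i) \<omega>})" by auto
    ultimately show ?thesis by (simp only:) (intro sets.finite_UN; simp)
  qed
  have "(\<lambda>n. measure Q (?A n)) \<longlonglongrightarrow> measure Q (\<Union>n. ?A n)"
  proof (rule Q.finite_Lim_measure_incseq)
    show "range ?A \<subseteq> sets Q" using A by blast
    show "incseq ?A"
    proof (rule monoI)
      fix i j :: nat assume "i \<le> j"
      then have "?q ` {..i} \<subseteq> ?q ` {..j}" by (intro image_mono) simp
      then show "?A i \<subseteq> ?A j" by blast
    qed
  qed
  then have "(\<lambda>n. (c - y) * measure Q (?A n)) \<longlonglongrightarrow> (c - y) * measure Q (\<Union>n. ?A n)"
    by (intro tendsto_intros)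
  moreover have "(c - y) * measure Q (?A n) \<le> law.call y" for n
    using qT by (intro doob_finite_prob y) auto
  ultimately have le: "(c - y) * measure Q (\<Union>n. ?A n) \<le> law.call y"
    by (intro tendsto_upperbound[of _ _ sequentially]) auto
  have "AE \<omega> in Q. \<omega> \<in> {\<omega> \<in> space Q. c < grid_max T M \<omega>} \<longrightarrow> \<omega> \<in> (\<Union>n. ?A n)"
    using AE_cadlag
  proof eventually_elim
    case (elim \<omega>)
    show ?case
    proof
      assume "\<omega> \<in> {\<omega> \<in> space Q. c < grid_max T M \<omega>}"
      then have w: "\<omega> \<in> space Q" "c < grid_max T M \<omega>" by auto
      then obtain q where "q \<in> grid_times T" "c < M q \<omega>" using grid_max_eq[where M = M and \<omega> = \<omega>, OF elim T] by auto
      then have "\<exists>n. c < M (?q n) \<omega>"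
        using from_nat_into_surj[OF grid_times(1)] by metis
      then show "\<omega> \<in> (\<Union>n. ?A n)" using w by auto
    qed
  qed
  then have "measure Q {\<omega> \<in> space Q. c < grid_max T M \<omega>} \<le> measure Q (\<Union>n. ?A n)"
    using A by (intro Q.finite_measure_mono_AE) auto
  then have "(c - y) * measure Q {\<omega> \<in> space Q. c < grid_max T M \<omega>} \<le> (c - y) * measure Q (\<Union>n. ?A n)"
    using y by (intro mult_left_mono) auto
  then show ?thesis using le by simp
qed

text \<open>Doob's bound \<open>call y / (c - y)\<close> is taken at a point \<open>y\<close> with
  \<beta>(y) = c, where \<open>barycenter_call\<close> turns it into the tail of \<mu> at
  \<open>y\<close>. Without atoms this is also the mass of the set where \<beta> exceeds
  \<open>c\<close>.\<close>

lemma grid_max_dominated: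
  "measure Q {\<omega> \<in> space Q. c < grid_max T M \<omega>} \<le> measure \<mu> {x \<in> space \<mu>. c < barycenter \<mu> x}"
proof -
  let ?S = "{x. barycenter \<mu> x \<le> c}"
  let ?p = "\<lambda>c. measure Q {\<omega> \<in> space Q. c < grid_max T M \<omega>}"
  show ?thesis
  proof (cases "?S = {}")
    case True
    then have "{x \<in> space \<mu>. c < barycenter \<mu> x} = space \<mu>" by (auto simp: not_le)
    then show ?thesis by (simp only: law.prob_space) (rule Q.prob_le_1)
  next
    case False
    \<comment> \<open>The largest solution of \<beta>(k) = c is required: \<beta> may be constant on
      an interval, and it exceeds \<open>c\<close> only to the right of that interval.\<close>
    define k where "k = Sup ?S"
    have le_c: "x \<le> c" if "x \<in> ?S" for x using that law.barycenter_ge[of x] by simp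
    then have bdd: "bdd_above ?S" by (rule bdd_aboveI)
    have cont: "continuous_on UNIV (barycenter \<mu>)"
      by (intro continuous_at_imp_continuous_on ballI law.isCont_barycenter)
    then have "closed ?S" by (intro closed_Collect_le) auto
    then have k_S: "barycenter \<mu> k \<le> c" using closed_contains_Sup[OF False bdd] by (simp add: k_def)
    have above: "c < barycenter \<mu> x" if "k < x" for x
      using that cSup_upper[OF _ bdd, of x] by (fastforce simp: k_def)
    have "c \<le> barycenter \<mu> k"
    proof (rule ccontr)
      assume "\<not> ?thesis"
      then have "eventually (\<lambda>x. barycenter \<mu> x < c) (at_right k)"
        using law.isCont_barycenter[of k]
        by (intro order_tendstoD(2)[of _ "barycenter \<mu> k"]) (auto simp: isCont_def filterlim_at_split)
      moreover have "eventually (\<lambda>x. c < barycenter \<mu> x) (at_right k)"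
        using above by (auto simp: eventually_at_filter)
      ultimately have "eventually (\<lambda>x. False) (at_right k)" by eventually_elim simp
      then show False by simp
    qed
    then have k: "barycenter \<mu> k = c" using k_S by simp
    have set: "{x \<in> space \<mu>. c < barycenter \<mu> x} = {k<..}"
      using above monoD[OF law.mono_barycenter, of _ k] k by (force simp: not_le[symmetric])
    have "measure \<mu> {k..} = measure \<mu> {k} + measure \<mu> {k<..}"
    proof -
      have "{k..} = {k} \<union> {k<..}" by auto
      then show ?thesis by (simp only:) (rule law.finite_measure_Union; simp add: law.sets_eq)
    qed
    then have tail: "measure \<mu> {k<..} = law.tail k" using law.atomless by (simp add: atomless_def law.tail_def)
    show ?thesis
    proof (cases "k < c")
      case True
      then have "(c - k) * ?p c \<le> (c - k) * law.tail k"
        using doob_prob[OF True] law.barycenter_call[of k] k by simp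
      then have "?p c \<le> law.tail k" using True by simp
      then show ?thesis unfolding set tail .
    next
      \<comment> \<open>With \<open>k = c\<close> the quotient is 0 / 0. The call at
        \<open>c\<close> vanishes, so Doob's bound is 0 at every level above \<open>c\<close>, and
        these levels exhaust the event.\<close>
      case False
      then have "k = c" using law.barycenter_ge[of k] k by simp
      then have call: "law.call c = 0" using law.barycenter_call[of k] k by simp
      have "?p (c + 1 / real (Suc n)) = 0" for n
      proof -
        have "1 / real (Suc n) * ?p (c + 1 / real (Suc n)) \<le> 0"
          using doob_prob[of c "c + 1 / real (Suc n)"] call by simp
        then have "?p (c + 1 / real (Suc n)) \<le> 0" by (simp add: divide_le_0_iff mult_le_0_iff)
        then show ?thesis by (simp add: measure_le_0_iff)
      qed
      moreover have "(\<lambda>n. ?p (c + 1 / real (Suc n))) \<longlonglongrightarrow> measure Q (\<Union>n. {\<omega> \<in> space Q. c + 1 / real (Suc n) < grid_max T M \<omega>})"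
      proof (rule Q.finite_Lim_measure_incseq)
        show "incseq (\<lambda>n. {\<omega> \<in> space Q. c + 1 / real (Suc n) < grid_max T M \<omega>})"
        proof (rule incseq_SucI, safe)
          fix n x assume "c + 1 / real (Suc n) < grid_max T M x"
          moreover have "1 / real (Suc (Suc n)) \<le> 1 / real (Suc n)" by (intro divide_left_mono) auto
          ultimately show "c + 1 / real (Suc (Suc n)) < grid_max T M x" by linarith
        qed
      qed auto
      ultimately have z: "measure Q (\<Union>n. {\<omega> \<in> space Q. c + 1 / real (Suc n) < grid_max T M \<omega>}) = 0"
        by (simp add: LIMSEQ_const_iff)
      have "{\<omega> \<in> space Q. c < grid_max T M \<omega>} \<subseteq> (\<Union>n. {\<omega> \<in> space Q. c + 1 / real (Suc n) < grid_max T M \<omega>})"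
      proof safe
        fix \<omega> assume w: "\<omega> \<in> space Q" "c < grid_max T M \<omega>"
        then have "0 < grid_max T M \<omega> - c" by simp
        then obtain n where "1 / real (Suc n) < grid_max T M \<omega> - c" using nat_approx_posE by blast
        then have "c + 1 / real (Suc n) < grid_max T M \<omega>" by simp
        then show "\<omega> \<in> (\<Union>n. {\<omega> \<in> space Q. c + 1 / real (Suc n) < grid_max T M \<omega>})" using w(1) by blast
      qed
      then have "?p c \<le> measure Q (\<Union>n. {\<omega> \<in> space Q. c + 1 / real (Suc n) < grid_max T M \<omega>})"
        by (intro Q.finite_measure_mono) auto
      then have "?p c \<le> 0" using z by simp
      then show ?thesis by (rule order_trans) simp
    qed
  qed
qed

lemma grid_max_running_max: "AE \<omega> in Q. grid_max T M \<omega> = running_max M T \<omega>"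
  using AE_cadlag by eventually_elim (rule grid_max_eq(1)[where M = M, OF _ T])

end

section \<open>Optimality\<close>

theorem theorem3:
  fixes T :: real and \<mu> :: "real measure" and F :: "real \<Rightarrow> real \<Rightarrow> real"
    and P :: "'a measure" and W :: "real \<Rightarrow> 'a \<Rightarrow> real"
  assumes "T > 0"
    and "prob_space \<mu>" and "sets \<mu> = sets borel"
    and "centred \<mu>" and "atomless \<mu>"
    and "continuous_on UNIV (\<lambda>(w, s). F w s)"
    and "strictly_supermodular F"
    and "serrated F"
    and "has_ridge F {(w, \<infinity>) | w. True}"
    and "brownian_motion P W"
  shows "admissible T \<mu> P (azema_yor_process T \<mu> W) \<and>
    (\<forall>(Q :: 'b measure) M u v.
       admissible T \<mu> Q M \<and>
       functional_value T F P (azema_yor_process T \<mu> W) u \<and>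
       functional_value T F Q M v \<longrightarrow> v \<le> u)"
proof -
  interpret emb: ay_embedding P W \<mu>
    using assms(2-5,10)
    by (simp add: ay_embedding_def brownian_def brownian_axioms_def centred_law_def centred_law_axioms_def
        brownian_motion_def)
  interpret sm: supermodular_coupling F "barycenter \<mu>"
  proof
    show "F w1 s2 + F w2 s1 \<le> F w1 s1 + F w2 s2" if "w1 \<le> w2" "s1 \<le> s2" for w1 w2 s1 s2
      using assms(7) that by (cases "w1 = w2 \<or> s1 = s2") (auto simp: strictly_supermodular_def less_le)
    obtain a where a: "\<And>w. serrated_at F w (a w)" and R: "{(w, \<infinity>) | w. True} = {(w, a w) | w. True}"
      using assms(9) unfolding has_ridge_def by blast
    show "mono (F w)" for w
    proof -
      \<comment> \<open>The turning points are chosen existentially, but the two descriptions of the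
        ridge agree as sets, which forces each of them to be infinite.\<close>
      have "(w, a w) \<in> {(w, \<infinity> :: ereal) | w. True}" unfolding R by blast
      then have "a w = \<infinity>" by simp
      then show ?thesis using a[of w] by (simp add: serrated_at_def)
    qed
  qed (simp_all add: emb.law.mono_barycenter emb.law.barycenter_ge)
  let ?AY = "azema_yor_process T \<mu> W"
  note [measurable] = borel_measurable_mono[OF sm.mono_\<psi>] borel_measurable_mono[OF emb.law.mono_barycenter]
  have F_meas: "(\<lambda>w. F w (barycenter \<mu> w)) \<in> borel_measurable borel"
    using borel_measurable_continuous_on[OF assms(6), of "\<lambda>w. (w, barycenter \<mu> w)" borel] by simp
  have [measurable]: "sm.\<phi> \<in> borel_measurable borel"
    unfolding sm.\<phi>_def[abs_def] using F_meas by measurable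
  \<comment> \<open>The truncated value that both processes share: it is attained by the embedding
    and bounds every competitor, whose terminal law is \<mu> and whose maximum is dominated. The
    comparison then passes to the limit in \<open>n\<close>.\<close>
  define c where "c n = (\<integral>x. clamp n (sm.\<phi> x) \<partial>\<mu>) + (\<integral>x. clamp n (sm.\<psi> (barycenter \<mu> x)) \<partial>\<mu>)" for n
  have "v \<le> u" if M: "admissible T \<mu> Q M" and u: "functional_value T F P ?AY u" and v: "functional_value T F Q M v"
    for Q :: "'b measure" and M u v
  \<comment> \<open>If \<open>v\<close> is minus infinity there is nothing to compare. Otherwise the
    upper bound by \<phi> + \<psi> also has an expectation.\<close>
  proof (cases "v = - \<infinity>")
    case False
    interpret Q: prob_space Q using M by (simp add: admissible_def)
    let ?S = "grid_max T M"
    note law = emb.law.centred_law_axioms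
    have [measurable]: "M T \<in> borel_measurable Q" "?S \<in> borel_measurable Q"
      using assms(1) by (auto intro: adm_measurable[OF assms(1) law M] grid_max_measurable[OF assms(1) law M])
    have ae: "AE \<omega> in P. F (?AY T \<omega>) (running_max ?AY T \<omega>) = sm.\<phi> (emb.X \<omega>) + sm.\<psi> (barycenter \<mu> (emb.X \<omega>))"
      using emb.AE_hits_region AE_space
    proof eventually_elim
      case (elim \<omega>)
      then show ?case
        using emb.running_max_process[OF assms(1)] emb.process_eq(2)[OF assms(1)] sm.F_eq by simp
    qed
    have "has_ext_expectation P (\<lambda>\<omega>. sm.\<phi> (emb.X \<omega>) + sm.\<psi> (barycenter \<mu> (emb.X \<omega>))) u"
      by (rule has_ext_expectation_cong_AE[OF ae, THEN iffD1, OF u[unfolded functional_value_def]])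
    then have lim_P: "(\<lambda>n. ereal ((\<integral>\<omega>. clamp n (sm.\<phi> (emb.X \<omega>)) \<partial>P) + (\<integral>\<omega>. clamp n (sm.\<psi> (barycenter \<mu> (emb.X \<omega>))) \<partial>P))) \<longlonglongrightarrow> u"
      by (intro emb.ext_expectation_clamp) measurable
    have X_integral: "(\<integral>\<omega>. g (emb.X \<omega>) \<partial>P) = (\<integral>x. g x \<partial>\<mu>)" if [measurable]: "g \<in> borel_measurable borel" for g :: "real \<Rightarrow> real"
    proof -
      have "(\<integral>x. g x \<partial>distr P borel emb.X) = (\<integral>\<omega>. g (emb.X \<omega>) \<partial>P)" by (rule integral_distr) measurable
      then show ?thesis by (simp only: emb.distr_X)
    qed
    have "(\<integral>\<omega>. clamp n (sm.\<phi> (emb.X \<omega>)) \<partial>P) + (\<integral>\<omega>. clamp n (sm.\<psi> (barycenter \<mu> (emb.X \<omega>))) \<partial>P) = c n" for n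
      unfolding c_def by (intro arg_cong2[where f = "(+)"] X_integral) measurable
    then have lim_u: "(\<lambda>n. ereal (c n)) \<longlonglongrightarrow> u" using lim_P by simp
    \<comment> \<open>The running maximum is exchanged for its measurable version, to which
      truncation and dominance apply.\<close>
    have "AE \<omega> in Q. F (M T \<omega>) (running_max M T \<omega>) \<le> sm.\<phi> (M T \<omega>) + sm.\<psi> (?S \<omega>)"
      using grid_max_running_max[OF assms(1) law M]
    proof eventually_elim
      case (elim \<omega>)
      show ?case unfolding elim by (rule sm.F_le)
    qed
    from ext_expectation_mono[OF v[unfolded functional_value_def] False this]
    obtain w where w: "has_ext_expectation Q (\<lambda>\<omega>. sm.\<phi> (M T \<omega>) + sm.\<psi> (?S \<omega>)) w" "v \<le> w" by blast
    have "(\<lambda>n. ereal ((\<integral>\<omega>. clamp n (sm.\<phi> (M T \<omega>)) \<partial>Q) + (\<integral>\<omega>. clamp n (sm.\<psi> (?S \<omega>)) \<partial>Q))) \<longlonglongrightarrow> w"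
      by (rule Q.ext_expectation_clamp[OF _ _ w(1)]) measurable
    moreover have "(\<integral>\<omega>. clamp n (sm.\<phi> (M T \<omega>)) \<partial>Q) + (\<integral>\<omega>. clamp n (sm.\<psi> (?S \<omega>)) \<partial>Q) \<le> c n" for n
      unfolding c_def
    proof (rule add_mono)
      have "(\<integral>\<omega>. clamp n (sm.\<phi> (M T \<omega>)) \<partial>Q) = (\<integral>x. clamp n (sm.\<phi> x) \<partial>distr Q borel (M T))"
        by (rule integral_distr[symmetric]) measurable
      then show "(\<integral>\<omega>. clamp n (sm.\<phi> (M T \<omega>)) \<partial>Q) \<le> (\<integral>x. clamp n (sm.\<phi> x) \<partial>\<mu>)"
        by (simp add: adm_distr[OF assms(1) law M])
      show "(\<integral>\<omega>. clamp n (sm.\<psi> (?S \<omega>)) \<partial>Q) \<le> (\<integral>x. clamp n (sm.\<psi> (barycenter \<mu> x)) \<partial>\<mu>)"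
      proof (rule stochastic_dominance[where h = "\<lambda>s. clamp n (sm.\<psi> s)" and B = "real n", OF Q.prob_space_axioms emb.law.prob_space_axioms])
        show "mono (\<lambda>s. clamp n (sm.\<psi> s))"
          by (intro monoI monoD[OF mono_clamp] monoD[OF sm.mono_\<psi>])
        show "barycenter \<mu> \<in> borel_measurable \<mu>"
          using borel_measurable_mono[OF emb.law.mono_barycenter] by (simp add: measurable_cong_sets[OF assms(3) refl])
      qed (use grid_max_dominated[OF assms(1) law M] in \<open>auto intro: clamp_bound\<close>)
    qed
    ultimately have "w \<le> u" using lim_u by (intro LIMSEQ_le[of _ w _ u]) auto
    then show ?thesis using w(2) by simp
  qed simp
  then show ?thesis using emb.admissible_process[OF assms(1)] by blast
qed

end
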